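(* A graph $G$ is a hereditary chordal-unigraph if and only if $G$ contains none of the following graphs as an induced subgraph: $C_4$, $C_5$, $P_5$, $K_3+K_2$, $2P_3$, $P_4+K_2$, the four graphs $R,\overline{R},S,\overline{S}$, and the three graphs $B_1,B_2,B_3$.
   Context: All graphs are finite and simple; $+$ denotes disjoint union, $P_n$ the path and $C_n$ the cycle on $n$ vertices, $\overline{H}$ the complement. A chordal graph $G$ is a chordal-unigraph if every chordal graph with the same degree sequence as $G$ is isomorphic to $G$; $G$ is a hereditary chordal-unigraph if every induced subgraph of $G$ (including $G$) is a chordal-unigraph. A unigraph is a graph such that every graph with the same degree sequence is isomorphic to it; a hereditary unigraph is a graph all of whose induced subgraphs are unigraphs. A split graph is one whose vertex set partitions into a clique and a stable set. $R,\overline{R},S,\overline{S}$ denote the split graphs among the minimal forbidden induced subgraphs of the class of hereditary unigraphs (graphs that are not hereditary unigraphs but all of whose proper induced subgraphs are); there are exactly four such graphs, forming two complementary pairs. $B_1$ has vertices $u,v,p,q,r,w$ and edges $uv,up,uq,ur,vp,vw,qr$. $B_2$ has vertices $u,v,p,q,r,w$ and edges $uv,up,uq,ur,vp,vq,rw$ ($B_1,B_2$ are the two chordal realizations of the degree sequence $(4,3,2,2,2,1)$). $B_3$ has vertices $u,v,p,q,l,m$ and edges $up,uq,pq,uv,vl,vm$ (a triangle $upq$ with a vertex $v$ attached to $u$ and two pendant vertices $l,m$ attached to $v$; degree sequence $(3,3,2,2,1,1)$). *)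

theory Defs
  imports Main "HOL-Library.Multiset"
begin

datatype 'a graph = Graph (verts: "'a set") (edges: "'a set set")

definition simple_graph :: "'a graph \<Rightarrow> bool" where
  "simple_graph G \<longleftrightarrow> finite (verts G) \<and> (\<forall>e\<in>edges G. e \<subseteq> verts G \<and> card e = 2)"

definition graph_iso :: "'a graph \<Rightarrow> 'b graph \<Rightarrow> bool" (infix \<open>\<simeq>\<close> 50) where
  "G \<simeq> H \<longleftrightarrow> (\<exists>f. bij_betw f (verts G) (verts H) \<and>
     (\<forall>x\<in>verts G. \<forall>y\<in>verts G. {x, y} \<in> edges G \<longleftrightarrow> {f x, f y} \<in> edges H))"

definition induced_subgraph :: "'a graph \<Rightarrow> 'a set \<Rightarrow> 'a graph" where
  "induced_subgraph G W = Graph W {e \<in> edges G. e \<subseteq> W}"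

definition contains_induced :: "'a graph \<Rightarrow> 'b graph \<Rightarrow> bool" where
  "contains_induced G H \<longleftrightarrow> (\<exists>W\<subseteq>verts G. induced_subgraph G W \<simeq> H)"

definition degree :: "'a graph \<Rightarrow> 'a \<Rightarrow> nat" where
  "degree G v = card {e \<in> edges G. v \<in> e}"

definition degree_sequence :: "'a graph \<Rightarrow> nat list" where
  "degree_sequence G =
     rev (sorted_list_of_multiset (image_mset (degree G) (mset_set (verts G))))"

definition complete_graph :: "nat \<Rightarrow> nat graph" where
  "complete_graph n = Graph {..<n} {{i, j} | i j. i < n \<and> j < n \<and> i \<noteq> j}"

definition path_graph :: "nat \<Rightarrow> nat graph" where
  "path_graph n = Graph {..<n} {{i, Suc i} | i. Suc i < n}"

text \<open>Meaningful as the cycle on \<open>n\<close> vertices only for \<open>n \<ge> 3\<close>.\<close>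

definition cycle_graph :: "nat \<Rightarrow> nat graph" where
  "cycle_graph n = Graph {..<n} {{i, Suc i mod n} | i. i < n}"

definition disjoint_union :: "'a graph \<Rightarrow> 'b graph \<Rightarrow> ('a + 'b) graph" where
  "disjoint_union G H =
     Graph (verts G <+> verts H) ((`) Inl ` edges G \<union> (`) Inr ` edges H)"

definition chordal :: "'a graph \<Rightarrow> bool" where
  "chordal G \<longleftrightarrow> (\<forall>n\<ge>4. \<not> contains_induced G (cycle_graph n))"

definition split_graph :: "'a graph \<Rightarrow> bool" where
  "split_graph G \<longleftrightarrow> (\<exists>K S. verts G = K \<union> S \<and> K \<inter> S = {} \<and>
     (\<forall>x\<in>K. \<forall>y\<in>K. x \<noteq> y \<longrightarrow> {x, y} \<in> edges G) \<and>
     (\<forall>x\<in>S. \<forall>y\<in>S. {x, y} \<notin> edges G))"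

text \<open>Every finite graph has an isomorphic copy with vertices in \<^typ>\<open>nat\<close>, so in the
  following definitions it loses no generality to let the competing graph \<open>H\<close> range over
  graphs on \<^typ>\<open>nat\<close>, whatever the vertex type of \<open>G\<close>.\<close>

definition unigraph :: "'a graph \<Rightarrow> bool" where
  "unigraph G \<longleftrightarrow>
     (\<forall>H :: nat graph. simple_graph H \<and> degree_sequence H = degree_sequence G \<longrightarrow> H \<simeq> G)"

definition hereditary_unigraph :: "'a graph \<Rightarrow> bool" where
  "hereditary_unigraph G \<longleftrightarrow> (\<forall>W\<subseteq>verts G. unigraph (induced_subgraph G W))"

definition chordal_unigraph :: "'a graph \<Rightarrow> bool" where
  "chordal_unigraph G \<longleftrightarrow> chordal G \<and>
     (\<forall>H :: nat graph. simple_graph H \<and> chordal H \<and>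
        degree_sequence H = degree_sequence G \<longrightarrow> H \<simeq> G)"

definition hereditary_chordal_unigraph :: "'a graph \<Rightarrow> bool" where
  "hereditary_chordal_unigraph G \<longleftrightarrow> (\<forall>W\<subseteq>verts G. chordal_unigraph (induced_subgraph G W))"

definition minimal_forbidden_hereditary_unigraph :: "'a graph \<Rightarrow> bool" where
  "minimal_forbidden_hereditary_unigraph G \<longleftrightarrow> \<not> hereditary_unigraph G \<and>
     (\<forall>W\<subset>verts G. hereditary_unigraph (induced_subgraph G W))"

text \<open>Up to isomorphism this set consists of the four graphs \<open>R\<close>, \<open>S\<close> and their complements,
  which are defined collectively, as the split minimal forbidden induced subgraphs of the class
  of hereditary unigraphs.\<close>

definition RS_graphs :: "nat graph set" where
  "RS_graphs = {H. simple_graph H \<and> split_graph H \<and> minimal_forbidden_hereditary_unigraph H}"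

definition B1 :: "nat graph" where
  "B1 = (let u = 0; v = 1; p = 2; q = 3; r = 4; w = 5 in
     Graph {u, v, p, q, r, w} {{u,v}, {u,p}, {u,q}, {u,r}, {v,p}, {v,w}, {q,r}})"

definition B2 :: "nat graph" where
  "B2 = (let u = 0; v = 1; p = 2; q = 3; r = 4; w = 5 in
     Graph {u, v, p, q, r, w} {{u,v}, {u,p}, {u,q}, {u,r}, {v,p}, {v,q}, {r,w}})"

definition B3 :: "nat graph" where
  "B3 = (let u = 0; v = 1; p = 2; q = 3; l = 4; m = 5 in
     Graph {u, v, p, q, l, m} {{u,p}, {u,q}, {p,q}, {u,v}, {v,l}, {v,m}})"

end

theory Submission
  imports Defs
begin

text \<open>
  A split graph keeps being split when its degree sequence is realised differently, and split graphs
  are chordal; hence for split graphs the chordal notion agrees with the ordinary one, and a split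
  graph without the split minimal forbidden graphs is a unigraph.  A graph without induced
  \<open>2K\<^sub>2\<close>, \<open>C\<^sub>4\<close>, \<open>C\<^sub>5\<close> is split (Foldes and Hammer), so the remaining graphs contain \<open>2K\<^sub>2\<close>.
  For these take an inclusion-maximal vertex set \<open>C\<close> that induces a graph from one of three explicit
  families, each containing \<open>2K\<^sub>2\<close>. The forbidden graphs force every vertex outside \<open>C\<close> to be complete
  or anticomplete to \<open>C\<close>; the complete ones form a clique \<open>A\<close> and the anticomplete ones a stable set \<open>B\<close>.
  Comparing the degree sums over \<open>A\<close> and \<open>B\<close> shows that every graph with the same degrees decomposes
  in the same way. The members of the three families are determined by their degrees among
  \<open>C\<^sub>4\<close>-free graphs, and the part on \<open>A \<union> B\<close> together with two nonadjacent vertices of \<open>C\<close> is split.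
\<close>

section \<open>Graphs, isomorphisms and degrees\<close>

text \<open>Equal degree sequences only provide a degree-preserving bijection of the vertices, which
  need not respect adjacency. So everything rebuilt in a competitor has to be recognised from
  degrees: the sides \<open>A\<close> and \<open>B\<close> by an extremal degree sum, each core by
  counting neighbours or non-neighbours.

  The split part keeps two vertices of \<open>C\<close> because one would be too few: in the graph
  on \<open>A\<close>, \<open>B\<close> and one core vertex, a vertex of \<open>A\<close> may have
  degree \<open>card A\<close>, and so may a vertex of \<open>B\<close>. With two nonadjacent core
  vertices exactly the vertices of \<open>A\<close> have degree above \<open>card A\<close>.

  The families are used in a fixed order, bipods, windmills, star matchings. A bipod with a single
  clique vertex is the smallest windmill, so bipods count only from two clique vertices on; each
  later family is extended under the assumption that the family before it does not occur. Maximality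
  refers to vertex sets, since absorbing a vertex may move the centre or exchange roles.

  The four split forbidden graphs enter only through their collective definition: a split graph that
  is not a unigraph contains a minimal such graph.\<close>

definition adj :: "'a graph \<Rightarrow> 'a \<Rightarrow> 'a \<Rightarrow> bool" where
  "adj G x y \<longleftrightarrow> {x, y} \<in> edges G"

lemma adj_commute: "adj G x y \<longleftrightarrow> adj G y x"
  by (simp add: adj_def insert_commute)

lemma adj_symD: "adj G x y \<Longrightarrow> adj G y x" and not_adj_symD: "\<not> adj G x y \<Longrightarrow> \<not> adj G y x"
  by (simp_all add: adj_commute)

lemma adj_irrefl: "simple_graph G \<Longrightarrow> \<not> adj G x x"
  by (auto simp: adj_def simple_graph_def)

lemma adj_verts:
  assumes "simple_graph G" "adj G x y"
  shows "x \<in> verts G" "y \<in> verts G"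
  using assms by (auto simp: adj_def simple_graph_def)

lemma verts_induced [simp]: "verts (induced_subgraph G W) = W"
  by (simp add: induced_subgraph_def)

lemma adj_induced [simp]: "adj (induced_subgraph G W) x y \<longleftrightarrow> x \<in> W \<and> y \<in> W \<and> adj G x y"
  by (auto simp: induced_subgraph_def adj_def)

lemma simple_induced: "simple_graph G \<Longrightarrow> W \<subseteq> verts G \<Longrightarrow> simple_graph (induced_subgraph G W)"
  by (auto simp: simple_graph_def induced_subgraph_def finite_subset)

lemma induced_verts: "simple_graph G \<Longrightarrow> induced_subgraph G (verts G) = G"
  by (cases G) (auto simp: induced_subgraph_def simple_graph_def)

lemma finite_verts: "simple_graph G \<Longrightarrow> finite (verts G)"
  by (simp add: simple_graph_def)

lemma degree_eq_card:
  assumes "simple_graph G"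
  shows "degree G v = card {u \<in> verts G. adj G v u}"
proof -
  have "{e \<in> edges G. v \<in> e} = (\<lambda>u. {v, u}) ` {u \<in> verts G. adj G v u}"
  proof (intro equalityI subsetI)
    fix e assume e: "e \<in> {e \<in> edges G. v \<in> e}"
    then have "card e = 2" "e \<subseteq> verts G" using assms by (auto simp: simple_graph_def)
    then obtain a b where "e = {a, b}" by (auto simp: card_2_iff)
    with e have "e = {v, a} \<or> e = {v, b}" by auto
    then show "e \<in> (\<lambda>u. {v, u}) ` {u \<in> verts G. adj G v u}"
      using e \<open>e \<subseteq> verts G\<close> by (auto simp: adj_def)
  qed (auto simp: adj_def)
  moreover have "inj_on (\<lambda>u. {v, u}) {u \<in> verts G. adj G v u}"
    by (rule inj_onI) (auto simp: doubleton_eq_iff)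
  ultimately show ?thesis by (simp add: degree_def card_image)
qed

lemma degree_induced:
  assumes "simple_graph G" "W \<subseteq> verts G" "v \<in> W"
  shows "degree (induced_subgraph G W) v = card {u \<in> W. adj G v u}"
proof -
  have "{u \<in> W. u \<in> W \<and> adj G v u} = {u \<in> W. adj G v u}" by auto
  then show ?thesis
    using degree_eq_card[OF simple_induced[OF assms(1,2)]] assms(3) by simp
qed

lemma graph_iso_iff:
  "G \<simeq> H \<longleftrightarrow> (\<exists>f. bij_betw f (verts G) (verts H) \<and>
     (\<forall>x\<in>verts G. \<forall>y\<in>verts G. adj G x y \<longleftrightarrow> adj H (f x) (f y)))"
  by (simp add: graph_iso_def adj_def)

lemma graph_isoI:
  assumes "bij_betw f (verts G) (verts H)"
    and "\<And>x y. x \<in> verts G \<Longrightarrow> y \<in> verts G \<Longrightarrow> adj G x y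
      \<longleftrightarrow> adj H (f x) (f y)"
  shows "G \<simeq> H"
  using assms by (auto simp: graph_iso_iff)

lemma graph_iso_sym:
  assumes "G \<simeq> H"
  shows "H \<simeq> G"
proof -
  obtain f where f: "bij_betw f (verts G) (verts H)"
    and a: "\<And>x y. x \<in> verts G \<Longrightarrow> y \<in> verts G \<Longrightarrow> adj G x y
      \<longleftrightarrow> adj H (f x) (f y)"
    using assms by (auto simp: graph_iso_iff)
  let ?g = "inv_into (verts G) f"
  have fg: "f (?g x) = x" "?g x \<in> verts G" if "x \<in> verts H" for x
    using that f by (auto simp: bij_betw_def f_inv_into_f inv_into_into)
  show ?thesis
    by (rule graph_isoI[OF bij_betw_inv_into[OF f]]) (simp add: a fg)
qed

lemma graph_iso_trans:
  assumes "G \<simeq> H" "H \<simeq> K"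
  shows "G \<simeq> K"
proof -
  obtain f where f: "bij_betw f (verts G) (verts H)"
    and a: "\<And>x y. x \<in> verts G \<Longrightarrow> y \<in> verts G \<Longrightarrow> adj G x y
      \<longleftrightarrow> adj H (f x) (f y)"
    using assms(1) by (auto simp: graph_iso_iff)
  obtain g where g: "bij_betw g (verts H) (verts K)"
    and b: "\<And>x y. x \<in> verts H \<Longrightarrow> y \<in> verts H \<Longrightarrow> adj H x y
      \<longleftrightarrow> adj K (g x) (g y)"
    using assms(2) by (auto simp: graph_iso_iff)
  have "f x \<in> verts H" if "x \<in> verts G" for x using f that by (auto simp: bij_betw_def)
  then show ?thesis
    by (intro graph_isoI[OF bij_betw_trans[OF f g]]) (simp add: a b)
qed

text \<open>Competitors and members of \<open>RS_graphs\<close> are graphs on \<open>nat\<close>;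
  this brings induced subgraphs and disjoint unions into that range.\<close>

lemma nat_copyE:
  assumes "simple_graph G"
  obtains H :: "nat graph" where "simple_graph H" "G \<simeq> H"
proof -
  obtain f :: "'a \<Rightarrow> nat" where f: "inj_on f (verts G)"
    using finite_imp_inj_to_nat_seg[OF finite_verts[OF assms]] by blast
  let ?H = "Graph (f ` verts G) ((`) f ` edges G)"
  have "simple_graph ?H"
    using assms f by (auto simp: simple_graph_def card_image inj_on_subset)
  moreover have "adj G x y \<longleftrightarrow> adj ?H (f x) (f y)" if "x \<in> verts G" "y \<in> verts G" for x y
  proof -
    have "{f x, f y} = f ` {x, y}" by simp
    moreover have "f ` {x, y} \<in> (`) f ` edges G \<longleftrightarrow> {x, y} \<in> edges G"
    proof
      assume "f ` {x, y} \<in> (`) f ` edges G"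
      then obtain e where "e \<in> edges G" "f ` {x, y} = f ` e" by blast
      moreover from this have "e \<subseteq> verts G" using assms by (auto simp: simple_graph_def)
      ultimately show "{x, y} \<in> edges G" using inj_on_image_eq_iff[OF f, of "{x, y}" e] that by simp
    qed blast
    ultimately show ?thesis by (simp add: adj_def)
  qed
  moreover have "bij_betw f (verts G) (verts ?H)" using f by (simp add: bij_betw_def)
  ultimately show ?thesis using that graph_isoI by blast
qed

text \<open>The embedding form hides the vertex set of the copy, so that containments compose by
  composing maps.\<close>

lemma contains_induced_iff:
  "contains_induced G X \<longleftrightarrow> (\<exists>f. inj_on f (verts X) \<and> f ` verts X \<subseteq> verts G \<and>
     (\<forall>x\<in>verts X. \<forall>y\<in>verts X. adj X x y \<longleftrightarrow> adj G (f x) (f y)))" (is "?L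
       \<longleftrightarrow> ?R")
proof
  assume ?L
  then obtain W where "W \<subseteq> verts G" "X \<simeq> induced_subgraph G W"
    by (auto simp: contains_induced_def intro: graph_iso_sym)
  then show ?R by (auto simp: graph_iso_iff bij_betw_def)
next
  assume ?R
  then obtain f where f: "inj_on f (verts X)" "f ` verts X \<subseteq> verts G"
    "\<forall>x\<in>verts X. \<forall>y\<in>verts X. adj X x y \<longleftrightarrow> adj G (f x) (f y)" by blast
  then have "X \<simeq> induced_subgraph G (f ` verts X)"
    by (intro graph_isoI[of f]) (auto simp: bij_betw_def)
  with f(2) show ?L by (auto simp: contains_induced_def intro: graph_iso_sym)
qed

lemma contains_induced_trans:
  assumes "contains_induced G X" "contains_induced X Y"
  shows "contains_induced G Y"
proof -
  obtain f where f: "inj_on f (verts X)" "f ` verts X \<subseteq> verts G"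
    "\<And>x y. x\<in>verts X \<Longrightarrow> y\<in>verts X \<Longrightarrow> adj X x y \<longleftrightarrow> adj G (f x) (f y)"
    using assms(1) by (auto simp: contains_induced_iff)
  obtain g where g: "inj_on g (verts Y)" "g ` verts Y \<subseteq> verts X"
    "\<And>x y. x\<in>verts Y \<Longrightarrow> y\<in>verts Y \<Longrightarrow> adj Y x y \<longleftrightarrow> adj X (g x) (g y)"
    using assms(2) by (auto simp: contains_induced_iff)
  have "g y \<in> verts X" if "y \<in> verts Y" for y using that g(2) by blast
  then have "inj_on (f \<circ> g) (verts Y)" "(f \<circ> g) ` verts Y \<subseteq> verts G"
    "\<forall>x\<in>verts Y. \<forall>y\<in>verts Y. adj Y x y \<longleftrightarrow> adj G ((f \<circ> g) x) ((f \<circ> g) y)"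
    using f g by (auto simp: inj_on_def)
  then show ?thesis unfolding contains_induced_iff by blast
qed

lemma contains_induced_iso: "G \<simeq> H \<Longrightarrow> contains_induced G H"
  unfolding contains_induced_iff
  by (drule graph_iso_sym) (force simp: graph_iso_iff bij_betw_def)

lemma contains_induced_induced: "W \<subseteq> verts G \<Longrightarrow> contains_induced G (induced_subgraph G W)"
  unfolding contains_induced_iff by (rule exI[of _ id]) auto

lemma chordal_mono:
  assumes "chordal G" "contains_induced G H"
  shows "chordal H"
  using assms contains_induced_trans by (auto simp: chordal_def)

text \<open>Match one element \<open>a\<close> with some \<open>b\<close> of equal value, delete
  both and recurse. Applied to degrees, this is the only form in which equality of degree sequences
  is exploited.\<close>

lemma image_mset_eq_bijE:
  assumes "finite A" "finite B"
    and "image_mset f (mset_set A) = image_mset g (mset_set B)"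
  obtains \<phi> where "bij_betw \<phi> A B" "\<And>x. x \<in> A \<Longrightarrow> g (\<phi> x) = f x"
proof -
  have "\<exists>\<phi>. bij_betw \<phi> A B \<and> (\<forall>x\<in>A. g (\<phi> x) = f x)" using assms
  proof (induction A arbitrary: B rule: finite_induct)
    case empty
    then have "B = {}" by (simp add: mset_set_empty_iff)
    then show ?case by (simp add: bij_betw_def)
  next
    case (insert a A)
    then have "f a \<in># image_mset g (mset_set B)"
      by (metis finite_insert finite_set_mset_mset_set image_eqI insertI1 set_image_mset)
    then obtain b where b: "b \<in> B" "g b = f a" using insert.prems by auto
    then have "mset_set B = add_mset b (mset_set (B - {b}))"
      using insert.prems by (simp add: mset_set.remove)
    then have "image_mset f (mset_set A) = image_mset g (mset_set (B - {b}))"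
      using insert.prems insert.hyps b by simp
    then obtain \<phi> where \<phi>: "bij_betw \<phi> A (B - {b})" "\<forall>x\<in>A. g (\<phi> x) = f x"
      using insert.IH[of "B - {b}"] insert.prems by auto
    have "bij_betw (\<phi>(a := b)) (insert a A) (insert b (B - {b}))"
      using \<phi>(1) insert.hyps by (auto simp: bij_betw_def inj_on_def)
    then have "bij_betw (\<phi>(a := b)) (insert a A) B" using b(1) by (simp add: insert_absorb)
    then show ?case using \<phi>(2) b insert.hyps
      by (intro exI[of _ "\<phi>(a := b)"]) (metis fun_upd_apply insert_iff)
  qed
  then show ?thesis using that by blast
qed

lemma degree_sequence_eq_iff:
  "degree_sequence G = degree_sequence H \<longleftrightarrow>
     image_mset (degree G) (mset_set (verts G)) = image_mset (degree H) (mset_set (verts H))"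
  unfolding degree_sequence_def by (metis mset_rev mset_sorted_list_of_multiset)

lemma degree_sequence_bijE:
  assumes "degree_sequence G = degree_sequence H" "simple_graph G" "simple_graph H"
  obtains \<phi> where "bij_betw \<phi> (verts G) (verts H)"
    "\<And>x. x \<in> verts G \<Longrightarrow> degree H (\<phi> x) = degree G x"
  using image_mset_eq_bijE[of "verts G" "verts H" "degree G" "degree H"] assms
  by (metis degree_sequence_eq_iff finite_verts)

lemma degree_sequence_bijI:
  assumes "bij_betw \<phi> (verts G) (verts H)" "\<And>x. x \<in> verts G \<Longrightarrow> degree H (\<phi> x) = degree G x"
    and "simple_graph G"
  shows "degree_sequence G = degree_sequence H"
proof -
  have "image_mset (degree G) (mset_set (verts G)) =
      image_mset (degree H) (image_mset \<phi> (mset_set (verts G)))"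
    unfolding multiset.map_comp using assms(2) finite_verts[OF assms(3)]
    by (intro image_mset_cong) simp
  also have "image_mset \<phi> (mset_set (verts G)) = mset_set (verts H)"
    using assms(1) by (simp add: bij_betw_def image_mset_mset_set)
  finally show ?thesis by (simp add: degree_sequence_eq_iff)
qed

lemma degree_iso:
  assumes "simple_graph G" "simple_graph H" "bij_betw f (verts G) (verts H)"
    and "\<And>x y. x \<in> verts G \<Longrightarrow> y \<in> verts G \<Longrightarrow> adj G x y
      \<longleftrightarrow> adj H (f x) (f y)" "x \<in> verts G"
  shows "degree H (f x) = degree G x"
proof -
  have "{u \<in> verts H. adj H (f x) u} = f ` {u \<in> verts G. adj G x u}"
  proof (intro equalityI subsetI)
    fix w assume w: "w \<in> {u \<in> verts H. adj H (f x) u}"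
    then obtain u where "u \<in> verts G" "w = f u" using assms(3) by (auto simp: bij_betw_def)
    then show "w \<in> f ` {u \<in> verts G. adj G x u}" using w assms(4,5) by auto
  qed (use assms(3-5) in \<open>auto simp: bij_betw_def\<close>)
  moreover have "inj_on f {u \<in> verts G. adj G x u}"
    using assms(3) by (auto simp: bij_betw_def inj_on_def)
  ultimately show ?thesis using assms(1,2) by (simp add: degree_eq_card card_image)
qed

lemma degree_sequence_iso:
  assumes "simple_graph G" "simple_graph H" "G \<simeq> H"
  shows "degree_sequence G = degree_sequence H"
  using assms degree_iso[OF assms(1,2)]
  by (auto simp: graph_iso_iff intro!: degree_sequence_bijI)

lemma unigraph_iso:
  assumes "simple_graph G" "simple_graph H" "G \<simeq> H" "unigraph G"
  shows "unigraph H"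
  using assms degree_sequence_iso[OF assms(1-3)] graph_iso_trans
  by (auto simp: unigraph_def)

lemma chordal_unigraph_iso:
  assumes "simple_graph G" "simple_graph H" "G \<simeq> H" "chordal_unigraph G"
  shows "chordal_unigraph H"
  using assms degree_sequence_iso[OF assms(1-3)] graph_iso_trans
    chordal_mono[OF _ contains_induced_iso]
  unfolding chordal_unigraph_def by metis

lemma hereditary_unigraph_iso:
  assumes "simple_graph G" "simple_graph H" "G \<simeq> H" "hereditary_unigraph G"
  shows "hereditary_unigraph H"
  unfolding hereditary_unigraph_def
proof (intro allI impI)
  fix W assume W: "W \<subseteq> verts H"
  obtain f where f: "bij_betw f (verts H) (verts G)"
    "\<And>x y. x \<in> verts H \<Longrightarrow> y \<in> verts H \<Longrightarrow> adj H x y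
      \<longleftrightarrow> adj G (f x) (f y)"
    using graph_iso_sym[OF assms(3)] by (auto simp: graph_iso_iff)
  have fW: "f ` W \<subseteq> verts G" using f(1) W by (auto simp: bij_betw_def)
  have "induced_subgraph H W \<simeq> induced_subgraph G (f ` W)"
    using f W by (intro graph_isoI[of f]) (auto simp: bij_betw_def inj_on_subset subset_iff)
  moreover have "unigraph (induced_subgraph G (f ` W))"
    using assms(4) fW by (auto simp: hereditary_unigraph_def)
  ultimately show "unigraph (induced_subgraph H W)"
    using unigraph_iso[OF simple_induced[OF assms(1) fW] simple_induced[OF assms(2) W]]
      graph_iso_sym by blast
qed

section \<open>Split graphs and the collectively defined forbidden graphs\<close>

lemma split_graph_iff:
  "split_graph G \<longleftrightarrow> (\<exists>K S. verts G = K \<union> S \<and> K \<inter> S = {} \<and>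
     (\<forall>x\<in>K. \<forall>y\<in>K. x \<noteq> y \<longrightarrow> adj G x y) \<and> (\<forall>x\<in>S. \<forall>y\<in>S.
       \<not> adj G x y))"
  by (simp add: split_graph_def adj_def)

lemma split_graph_mono:
  assumes "split_graph G" "contains_induced G H"
  shows "split_graph H"
proof -
  obtain f where f: "inj_on f (verts H)" "f ` verts H \<subseteq> verts G"
    "\<And>x y. x\<in>verts H \<Longrightarrow> y\<in>verts H \<Longrightarrow> adj H x y \<longleftrightarrow> adj G (f x) (f y)"
    using assms(2) by (auto simp: contains_induced_iff)
  obtain K S where KS: "verts G = K \<union> S" "K \<inter> S = {}"
     "\<And>x y. x\<in>K \<Longrightarrow> y\<in>K \<Longrightarrow> x \<noteq> y \<Longrightarrow> adj G x y" "\<And>x y. x\<in>S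
       \<Longrightarrow> y\<in>S \<Longrightarrow> \<not> adj G x y"
    using assms(1) by (auto simp: split_graph_iff)
  show ?thesis unfolding split_graph_iff
    using f KS
    by (intro exI[of _ "{x \<in> verts H. f x \<in> K}"] exI[of _ "{x \<in> verts H. f x \<in> S}"])
      (auto simp: inj_on_eq_iff)
qed

text \<open>Among the vertex sets whose induced subgraph is not a hereditary unigraph, one of least
  cardinality is inclusion-minimal. Its induced subgraph inherits splitness, and a copy on
  \<open>nat\<close> belongs to \<open>RS_graphs\<close>.\<close>

lemma contains_RS_graph:
  assumes "simple_graph G" "split_graph G" "\<not> unigraph G"
  obtains H where "H \<in> RS_graphs" "contains_induced G H"
proof -
  let ?P = "\<lambda>W. W \<subseteq> verts G \<and> \<not> hereditary_unigraph (induced_subgraph G W)"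
  have "?P (verts G)"
    using assms(3) induced_verts[OF assms(1)] unfolding hereditary_unigraph_def
    by (metis order_refl verts_induced)
  then obtain W where W: "?P W" and min: "\<And>U. U \<subset> W \<Longrightarrow> \<not> ?P U"
  proof -
    obtain W where "?P W" "\<forall>U. ?P U \<longrightarrow> card W \<le> card U"
      using ex_has_least_nat[of ?P "verts G" card] \<open>?P (verts G)\<close> by blast
    moreover from this have "finite W" using finite_verts[OF assms(1)] finite_subset by blast
    ultimately show ?thesis using that psubset_card_mono leD by metis
  qed
  have sW: "simple_graph (induced_subgraph G W)" using simple_induced assms(1) W by blast
  obtain H :: "nat graph" where H: "simple_graph H" "induced_subgraph G W \<simeq> H"
    using nat_copyE[OF sW] .
  have cH: "contains_induced G H"
    using contains_induced_trans contains_induced_induced W contains_induced_iso H(2) by blast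
  have "hereditary_unigraph (induced_subgraph H U)" if U: "U \<subset> verts H" for U
  proof -
    obtain f where f: "bij_betw f (verts H) W"
      "\<And>x y. x \<in> verts H \<Longrightarrow> y \<in> verts H \<Longrightarrow> adj H x y \<longleftrightarrow> f x \<in> W \<and>
        f y \<in> W \<and> adj G (f x) (f y)"
      using graph_iso_sym[OF H(2)] by (auto simp: graph_iso_iff)
    obtain h where h: "h \<in> verts H" "h \<notin> U" using U by blast
    have fU: "f ` U \<subset> W"
    proof
      show "f ` U \<subseteq> W" using f(1) U by (auto simp: bij_betw_def)
      have "f h \<in> W" "f h \<notin> f ` U" using f(1) U h by (auto simp: bij_betw_def inj_on_def)
      then show "f ` U \<noteq> W" by blast
    qed
    then have "hereditary_unigraph (induced_subgraph G (f ` U))"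
      using min[OF fU] W by (meson order.trans psubset_imp_subset)
    moreover have "induced_subgraph G (f ` U) \<simeq> induced_subgraph H U"
    proof (rule graph_iso_sym, rule graph_isoI)
      show "bij_betw f (verts (induced_subgraph H U)) (verts (induced_subgraph G (f ` U)))"
        using f(1) U by (metis bij_betw_subset psubset_imp_subset verts_induced)
      show "adj (induced_subgraph H U) x y \<longleftrightarrow> adj (induced_subgraph G (f ` U)) (f x) (f y)"
        if "x \<in> verts (induced_subgraph H U)" "y \<in> verts (induced_subgraph H U)" for x y
        using that f(2)[of x y] U fU by auto
    qed
    moreover have "f ` U \<subseteq> verts G" "U \<subseteq> verts H" using fU U W by auto
    ultimately show ?thesis
      using hereditary_unigraph_iso[OF simple_induced[OF assms(1)] simple_induced[OF H(1)]]
      by blast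
  qed
  moreover have "\<not> hereditary_unigraph H"
    using hereditary_unigraph_iso[OF H(1) sW graph_iso_sym[OF H(2)]] W by blast
  ultimately have "H \<in> RS_graphs"
    using H(1) split_graph_mono[OF assms(2) cH]
    by (simp add: RS_graphs_def minimal_forbidden_hereditary_unigraph_def)
  then show ?thesis using that cH by blast
qed

section \<open>Compositions and split graphs\<close>

text \<open>The edges between \<open>A\<close> and \<open>B\<close> contribute equally to both
  degree sums and cancel. The identity is written with sums on both sides to avoid subtraction of
  natural numbers.\<close>

lemma sum_degree_balance:
  assumes "simple_graph G" "verts G = A \<union> B \<union> C" "A \<inter> B = {}" "A \<inter> C = {}" "B \<inter> C = {}"
  shows "(\<Sum>x\<in>A. \<Sum>y\<in>A \<union> C. of_bool (adj G x y)) + (\<Sum>x\<in>B. degree G x) =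
    (\<Sum>x\<in>B. \<Sum>y\<in>B \<union> C. of_bool (adj G x y)) + (\<Sum>x\<in>A. degree G x)"
proof -
  have fin: "finite A" "finite B" "finite C" using assms(1,2) by (auto simp: simple_graph_def)
  have deg: "degree G x = (\<Sum>y\<in>verts G. of_bool (adj G x y))" for x
    using assms(1) by (simp add: degree_eq_card finite_verts sum.If_cases of_bool_def Int_def)
  have "(\<Sum>x\<in>A. degree G x) =
      (\<Sum>x\<in>A. \<Sum>y\<in>A \<union> C. of_bool (adj G x y)) + (\<Sum>x\<in>A. \<Sum>y\<in>B. of_bool (adj G x y))"
  proof -
    have "verts G = (A \<union> C) \<union> B" "(A \<union> C) \<inter> B = {}" using assms by auto
    then show ?thesis using fin unfolding deg
      by (simp only: sum.union_disjoint sum.distrib finite_UnI)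
  qed
  moreover have "(\<Sum>x\<in>B. degree G x) =
      (\<Sum>x\<in>B. \<Sum>y\<in>B \<union> C. of_bool (adj G x y)) + (\<Sum>x\<in>B. \<Sum>y\<in>A. of_bool (adj G x y))"
  proof -
    have "verts G = (B \<union> C) \<union> A" "(B \<union> C) \<inter> A = {}" using assms by auto
    then show ?thesis using fin unfolding deg
      by (simp only: sum.union_disjoint sum.distrib finite_UnI)
  qed
  moreover have "(\<Sum>x\<in>A. \<Sum>y\<in>B. of_bool (adj G x y) :: nat) = (\<Sum>x\<in>B. \<Sum>y\<in>A. of_bool (adj G x y))"
    by (subst sum.swap) (simp add: adj_commute)
  ultimately show ?thesis by simp
qed

text \<open>The sum of the degrees in \<open>A\<close> minus the sum of the degrees in \<open>B\<close> is largest possible exactly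
  for such a composition, so the degrees alone determine it.\<close>

lemma composition_transfer:
  assumes G: "simple_graph G" "verts G = A \<union> B \<union> C" "A \<inter> B = {}" "A \<inter> C = {}" "B \<inter> C = {}"
    and A: "\<And>x y. x \<in> A \<Longrightarrow> y \<in> A \<union> C \<Longrightarrow> x \<noteq> y \<Longrightarrow> adj G x y"
    and B: "\<And>x y. x \<in> B \<Longrightarrow> y \<in> B \<union> C \<Longrightarrow> \<not> adj G x y"
    and H: "simple_graph H" "bij_betw \<phi> (verts G) (verts H)"
      "\<And>x. x \<in> verts G \<Longrightarrow> degree H (\<phi> x) = degree G x"
  shows "\<And>x y. x \<in> \<phi> ` A \<Longrightarrow> y \<in> \<phi> ` A \<union> \<phi> ` C \<Longrightarrow> x \<noteq> y
    \<Longrightarrow> adj H x y"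
    and "\<And>x y. x \<in> \<phi> ` B \<Longrightarrow> y \<in> \<phi> ` B \<union> \<phi> ` C \<Longrightarrow> \<not> adj H x y"
proof -
  have inj: "inj_on \<phi> (A \<union> B \<union> C)" and im: "verts H = \<phi> ` A \<union> \<phi> ` B \<union> \<phi> ` C"
    using H(2) G(2) by (auto simp: bij_betw_def)
  have injs: "inj_on \<phi> A" "inj_on \<phi> B" "inj_on \<phi> (A \<union> C)"
    using inj by (auto intro: inj_on_subset)
  have disj: "\<phi> ` A \<inter> \<phi> ` B = {}" "\<phi> ` A \<inter> \<phi> ` C = {}" "\<phi> ` B \<inter> \<phi> ` C = {}"
    using inj G(3-5) by (auto simp: inj_on_def; blast)+
  have fin: "finite A" "finite B" "finite C" using G(1,2) by (auto simp: simple_graph_def)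
  \<comment> \<open>\<open>?T\<close> counts all off-diagonal ordered pairs from \<open>A\<close> to
    \<open>A \<union> C\<close>, the most adjacencies that can start in \<open>A\<close> without
    reaching \<open>B\<close>.\<close>
  let ?T = "\<Sum>x\<in>A. \<Sum>y\<in>A \<union> C. of_bool (x \<noteq> y) :: nat"
  let ?a = "\<lambda>x y. of_bool (adj H x y) :: nat"
  let ?EA = "\<Sum>x\<in>\<phi> ` A. \<Sum>y\<in>\<phi> ` A \<union> \<phi> ` C. ?a x y"
  let ?EB = "\<Sum>x\<in>\<phi> ` B. \<Sum>y\<in>\<phi> ` B \<union> \<phi> ` C. ?a x y"
  have degs: "(\<Sum>x\<in>\<phi> ` A. degree H x) = (\<Sum>x\<in>A. degree G x)"
    "(\<Sum>x\<in>\<phi> ` B. degree H x) = (\<Sum>x\<in>B. degree G x)"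
    using injs H(3) G(2) by (auto simp: sum.reindex intro!: sum.cong)
  have "(\<Sum>x\<in>A. \<Sum>y\<in>A \<union> C. of_bool (adj G x y)) = ?T"
    using A adj_irrefl[OF G(1)] by (intro sum.cong refl) (auto simp: of_bool_def)
  moreover have "(\<Sum>x\<in>B. \<Sum>y\<in>B \<union> C. of_bool (adj G x y)) = (0::nat)"
    using B by (intro sum.neutral ballI) simp
  ultimately have "?T + (\<Sum>x\<in>B. degree G x) = (\<Sum>x\<in>A. degree G x)"
    using sum_degree_balance[OF G] by simp
  moreover have "?EA + (\<Sum>x\<in>B. degree G x) = ?EB + (\<Sum>x\<in>A. degree G x)"
    using sum_degree_balance[OF H(1) im disj] degs by simp
  ultimately have EA: "?EA = ?EB + ?T" by simp
  let ?S = "\<phi> ` A \<times> (\<phi> ` A \<union> \<phi> ` C)"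
  have EA': "?EA = (\<Sum>(x, y)\<in>?S. ?a x y)" by (simp add: sum.cartesian_product)
  have T': "?T = (\<Sum>(x, y)\<in>?S. of_bool (x \<noteq> y))"
  proof -
    have "(\<Sum>(x, y)\<in>?S. of_bool (x \<noteq> y)) = (\<Sum>x\<in>\<phi> ` A. \<Sum>y\<in>\<phi> ` (A
      \<union> C). of_bool (x \<noteq> y) :: nat)"
      by (simp add: sum.cartesian_product image_Un)
    also have "\<dots> = (\<Sum>x\<in>A. \<Sum>y\<in>A \<union> C. of_bool (\<phi> x \<noteq> \<phi> y))"
      using injs by (simp add: sum.reindex)
    also have "\<dots> = ?T"
      using injs(3) by (intro sum.cong refl) (auto simp: inj_on_def of_bool_def)
    finally show ?thesis ..
  qed
  have le: "?a x y \<le> of_bool (x \<noteq> y)" for x y using adj_irrefl[OF H(1)] by auto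
  \<comment> \<open>Since \<open>?EA = ?EB + ?T\<close>, this bound forces both extremes at once:
    every possible adjacency at \<open>A\<close> is present and every one counted by
    \<open>?EB\<close> is absent.\<close>
  have "?EA \<le> ?T" unfolding EA' T' using le by (intro sum_mono) auto
  with EA have eq: "?EB = 0" "?EA = ?T" by auto
  show "adj H x y" if "x \<in> \<phi> ` A" "y \<in> \<phi> ` A \<union> \<phi> ` C" "x \<noteq> y" for x y
  proof -
    \<comment> \<open>Two equal sums whose terms are ordered pointwise agree term by term.\<close>
    have "(\<lambda>(x, y). ?a x y) (x, y) = (\<lambda>(x, y). of_bool (x \<noteq> y)) (x, y)"
      by (rule sum_mono_inv[OF eq(2)[unfolded EA' T']]) (use le that fin in auto)
    then show ?thesis using that(3) by (simp split: if_splits add: of_bool_def)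
  qed
  show "\<not> adj H x y" if "x \<in> \<phi> ` B" "y \<in> \<phi> ` B \<union> \<phi> ` C" for x y
  proof -
    have "(\<Sum>y\<in>\<phi> ` B \<union> \<phi> ` C. ?a x y) = 0"
      using eq(1) fin(2) that(1) by (simp only: sum_eq_0_iff finite_imageI)
    then have "?a x y = 0" using fin that(2) by (simp only: sum_eq_0_iff finite_imageI finite_UnI)
    then show ?thesis by simp
  qed
qed

text \<open>A split partition is a composition with empty core, so
  \<open>composition_transfer\<close> with \<open>C = {}\<close> carries it over.\<close>

lemma split_graph_degree_sequence:
  assumes "simple_graph G" "split_graph G" "simple_graph H" "degree_sequence H = degree_sequence G"
  shows "split_graph H"
proof -
  obtain K S where KS: "verts G = K \<union> S" "K \<inter> S = {}"
     "\<And>x y. x\<in>K \<Longrightarrow> y\<in>K \<Longrightarrow> x \<noteq> y \<Longrightarrow> adj G x y" "\<And>x y. x\<in>S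
       \<Longrightarrow> y\<in>S \<Longrightarrow> \<not> adj G x y"
    using assms(2) by (auto simp: split_graph_iff)
  obtain \<phi> where \<phi>: "bij_betw \<phi> (verts G) (verts H)"
    "\<And>x. x \<in> verts G \<Longrightarrow> degree H (\<phi> x) = degree G x"
    using degree_sequence_bijE[OF assms(4)[symmetric] assms(1,3)] by blast
  have "verts H = \<phi> ` K \<union> \<phi> ` S" "\<phi> ` K \<inter> \<phi> ` S = {}"
    using \<phi>(1) KS(1,2) inj_on_image_Int[of \<phi> "verts G" K S]
    by (auto simp: bij_betw_def image_Un)
  moreover have "adj H x y" if "x \<in> \<phi> ` K" "y \<in> \<phi> ` K" "x \<noteq> y" for x y
    by (rule composition_transfer(1)[OF assms(1), of K S "{}" H \<phi>]) (use assms(3) KS \<phi> that in \<open>simp_all\<close>)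
  moreover have "\<not> adj H x y" if "x \<in> \<phi> ` S" "y \<in> \<phi> ` S" for x y
    by (rule composition_transfer(2)[OF assms(1), of K S "{}" H \<phi>]) (use assms(3) KS \<phi> that in \<open>simp_all\<close>)
  ultimately show ?thesis
    unfolding split_graph_iff by (intro exI[of _ "\<phi> ` K"] exI[of _ "\<phi> ` S"] conjI) auto
qed

lemma adj_cycle_graph:
  "i < n \<Longrightarrow> j < n \<Longrightarrow> adj (cycle_graph n) i j \<longleftrightarrow> j = Suc i mod n \<or>
    i = Suc j mod n"
  by (auto simp: adj_def cycle_graph_def doubleton_eq_iff)

lemma adj_cycle_graph_lt:
  assumes "i < n" "j < n" "i \<le> j" "3 \<le> n"
  shows "adj (cycle_graph n) i j \<longleftrightarrow> j = Suc i \<or> (i = 0 \<and> Suc j = n)"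
  using assms by (auto simp: adj_cycle_graph mod_Suc split: if_splits)

lemma verts_cycle_graph [simp]: "verts (cycle_graph n) = {..<n}"
  by (simp add: cycle_graph_def)

text \<open>The clique \<open>K\<close> would cover all edges of the cycle. If it contains 0, it
  omits 2 and hence contains the nonadjacent vertices 1 and 3; otherwise it contains the nonadjacent
  vertices 1 and \<open>n - 1\<close>. For \<open>n = 4\<close> the vertices 3 and
  \<open>n - 1\<close> coincide, which does no harm.\<close>

lemma split_graph_chordal:
  assumes "split_graph G"
  shows "chordal G"
  unfolding chordal_def
proof (intro allI impI notI)
  fix n :: nat assume n: "4 \<le> n" and "contains_induced G (cycle_graph n)"
  then have "split_graph (cycle_graph n)" using split_graph_mono assms by blast
  then obtain K S where KS: "{..<n} = K \<union> S"
     "\<And>i j. i\<in>K \<Longrightarrow> j\<in>K \<Longrightarrow> i \<noteq> j \<Longrightarrow> adj (cycle_graph n) i j"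
     "\<And>i j. i\<in>S \<Longrightarrow> j\<in>S \<Longrightarrow> \<not> adj (cycle_graph n) i j"
    by (auto simp: split_graph_iff)
  have cover: "i \<in> K \<or> j \<in> K" if "i < n" "j < n" "adj (cycle_graph n) i j" for i j
    using KS(1,3) that by blast
  note adjs = adj_cycle_graph_lt[of _ n]
  have non: "\<not> adj (cycle_graph n) 0 2" "\<not> adj (cycle_graph n) 1 3" "\<not> adj (cycle_graph n) 1 (n - 1)"
    using n by (auto simp: adjs)
  have "0 \<in> K \<or> 1 \<in> K" "0 \<in> K \<or> n - 1 \<in> K" "1 \<in> K \<or> 2 \<in> K" "2 \<in> K \<or> 3 \<in> K"
    by (rule cover; use n in \<open>simp add: adjs\<close>)+
  then show False using KS(2) non n by (cases "0 \<in> K") force+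
qed

text \<open>Some induced subgraph \<open>?X\<close> of \<open>H\<close> is not a unigraph. As
  \<open>?X\<close> is split, all its competitors are split and therefore chordal, so being a
  chordal-unigraph would make it a unigraph.\<close>

lemma RS_graph_not_contained:
  assumes G: "simple_graph G" "hereditary_chordal_unigraph G" and H: "H \<in> RS_graphs"
  shows "\<not> contains_induced G H"
proof
  assume GH: "contains_induced G H"
  have H': "simple_graph H" "split_graph H" "\<not> hereditary_unigraph H"
    using H by (auto simp: RS_graphs_def minimal_forbidden_hereditary_unigraph_def)
  then obtain U where U: "U \<subseteq> verts H" "\<not> unigraph (induced_subgraph H U)"
    by (auto simp: hereditary_unigraph_def)
  let ?X = "induced_subgraph H U"
  have X: "simple_graph ?X" "contains_induced H ?X"
    using U H' simple_induced contains_induced_induced by blast+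
  obtain W where W: "W \<subseteq> verts G" "induced_subgraph G W \<simeq> ?X"
    using contains_induced_trans[OF GH X(2)] by (auto simp: contains_induced_def)
  then have cu: "chordal_unigraph ?X"
    using chordal_unigraph_iso[OF simple_induced[OF G(1) W(1)] X(1)] G(2)
    by (auto simp: hereditary_chordal_unigraph_def)
  have "unigraph ?X"
    unfolding unigraph_def
  proof (intro allI impI)
    fix Y :: "nat graph" assume Y: "simple_graph Y \<and> degree_sequence Y = degree_sequence ?X"
    then have "chordal Y"
      using split_graph_chordal split_graph_degree_sequence X(1) split_graph_mono[OF H'(2) X(2)] by blast
    then show "Y \<simeq> ?X" using cu Y by (auto simp: chordal_unigraph_def)
  qed
  then show False using U by blast
qed

section \<open>Small graphs\<close>

text \<open>A perfect elimination ordering, with the head of the list eliminated first. On lists the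
  condition can be checked by evaluation.\<close>

fun elimination_order :: "'a graph \<Rightarrow> 'a list \<Rightarrow> bool" where
  "elimination_order G [] \<longleftrightarrow> True"
| "elimination_order G (v # vs) \<longleftrightarrow> elimination_order G vs \<and>
     (\<forall>a\<in>set vs. adj G v a \<longrightarrow> (\<forall>b\<in>set vs. adj G v b \<longrightarrow> a \<noteq> b
       \<longrightarrow> adj G a b))"

lemma cycle_graph_nonadjacent_neighbours:
  assumes "4 \<le> n" "i < n"
  obtains j k where "j < n" "k < n" "j \<noteq> k" "j \<noteq> i" "k \<noteq> i"
    "adj (cycle_graph n) i j" "adj (cycle_graph n) i k" "\<not> adj (cycle_graph n) j k"
proof -
  let ?j = "if Suc i = n then 0 else Suc i" and ?k = "if i = 0 then n - 1 else i - 1"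
  show ?thesis
    by (rule that[of ?j ?k])
      (use assms in \<open>auto simp: adj_cycle_graph mod_Suc split: if_splits\<close>)
qed

text \<open>The first vertex of the list that lies on an induced cycle has both its cycle neighbours
  later in the list, so they would be adjacent; on a cycle of length at least 4 they are
  not.\<close>

lemma elimination_order_chordal:
  assumes "elimination_order G vs" "verts G = set vs"
  shows "chordal G"
  unfolding chordal_def
proof (intro allI impI notI)
  fix n :: nat assume n: "4 \<le> n" and "contains_induced G (cycle_graph n)"
  then obtain f where f: "inj_on f {..<n}" "f ` {..<n} \<subseteq> set vs"
    "\<forall>x<n. \<forall>y<n. adj (cycle_graph n) x y \<longleftrightarrow> adj G (f x) (f y)"
    using assms(2) by (auto simp: contains_induced_iff lessThan_def)
  from assms(1) f(2) show False
  proof (induction vs)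
    case Nil
    then show ?case using n by (auto simp: lessThan_empty_iff)
  next
    case (Cons v vs)
    show ?case
    proof (cases "v \<in> f ` {..<n}")
      case True
      then obtain i where i: "i < n" "v = f i" by blast
      obtain j k where jk: "j < n" "k < n" "j \<noteq> k" "j \<noteq> i" "k \<noteq> i"
        "adj (cycle_graph n) i j" "adj (cycle_graph n) i k" "\<not> adj (cycle_graph n) j k"
        using cycle_graph_nonadjacent_neighbours[OF n i(1)] .
      then have "f j \<noteq> f i" "f k \<noteq> f i" "f j \<noteq> f k" using f(1) i by (auto simp: inj_on_def)
      moreover from this have "f j \<in> set vs" "f k \<in> set vs" using Cons.prems(2) i jk by force+
      ultimately show ?thesis using Cons.prems(1) i jk f(3) by auto
    next
      case False
      then show ?thesis using Cons by auto
    qed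
  qed
qed

lemma degree_list:
  assumes "simple_graph G" "verts G = set xs" "distinct xs"
  shows "degree G v = length (filter (adj G v) xs)"
  using assms by (simp add: degree_eq_card distinct_length_filter Int_def conj_commute)

lemma degree_multiset_list:
  assumes "simple_graph G" "verts G = set xs" "distinct xs"
  shows "image_mset (degree G) (mset_set (verts G)) = mset (map (\<lambda>v. length (filter (adj G v) xs)) xs)"
proof -
  have "degree G = (\<lambda>v. length (filter (adj G v) xs))" using degree_list[OF assms] by blast
  then show ?thesis using assms(2,3) by (simp add: mset_set_set)
qed

lemma adj_path_graph: "adj (path_graph n) i j \<longleftrightarrow> (Suc i = j \<and> j < n) \<or> (Suc j = i \<and> i < n)"
  by (auto simp: adj_def path_graph_def doubleton_eq_iff)

lemma adj_complete_graph: "adj (complete_graph n) i j \<longleftrightarrow> i < n \<and> j < n \<and> i \<noteq> j"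
  by (auto simp: adj_def complete_graph_def doubleton_eq_iff)

lemma adj_disjoint_union:
  "adj (disjoint_union G H) (Inl a) (Inl b) \<longleftrightarrow> adj G a b"
  "adj (disjoint_union G H) (Inr c) (Inr d) \<longleftrightarrow> adj H c d"
  "\<not> adj (disjoint_union G H) (Inl a) (Inr c)"
  "\<not> adj (disjoint_union G H) (Inr c) (Inl a)"
proof -
  have l: "{Inl a, Inl b} = Inl ` {a, b}" and r: "{Inr c, Inr d} = Inr ` {c, d}" by auto
  have "Inl ` e \<noteq> Inr ` e'" if "a \<in> e" for e :: "'a set" and e' :: "'b set" using that by auto
  then show "adj (disjoint_union G H) (Inl a) (Inl b) \<longleftrightarrow> adj G a b"
    by (auto simp: adj_def disjoint_union_def l inj_image_eq_iff simp del: image_insert)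
  have "Inr ` e' \<noteq> Inl ` e" if "c \<in> e'" for e :: "'a set" and e' :: "'b set" using that by auto
  then show "adj (disjoint_union G H) (Inr c) (Inr d) \<longleftrightarrow> adj H c d"
    by (auto simp: adj_def disjoint_union_def r inj_image_eq_iff simp del: image_insert)
qed (auto simp: adj_def disjoint_union_def)

lemma verts_small [simp]:
  "verts (path_graph n) = {..<n}" "verts (complete_graph n) = {..<n}"
  "verts (disjoint_union G H) = verts G <+> verts H"
  by (auto simp: path_graph_def complete_graph_def disjoint_union_def)

lemma simple_path_graph: "simple_graph (path_graph n)"
  by (auto simp: simple_graph_def path_graph_def)

lemma simple_complete_graph: "simple_graph (complete_graph n)"
  by (auto simp: simple_graph_def complete_graph_def)

lemma simple_disjoint_union:
  "simple_graph G \<Longrightarrow> simple_graph H \<Longrightarrow> simple_graph (disjoint_union G H)"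
  by (auto simp: simple_graph_def disjoint_union_def card_image)

text \<open>Edge lists, each edge given once, turn adjacency in concrete graphs into a membership
  test.\<close>

definition edge_graph :: "nat \<Rightarrow> (nat \<times> nat) list \<Rightarrow> nat graph" where
  "edge_graph n es = Graph {..<n} ((\<lambda>(i, j). {i, j}) ` set es)"

lemma adj_edge_graph: "adj (edge_graph n es) i j \<longleftrightarrow> (i, j) \<in> set es \<or> (j, i) \<in> set es"
  by (auto simp: adj_def edge_graph_def doubleton_eq_iff)

lemma verts_edge_graph [simp]: "verts (edge_graph n es) = {..<n}"
  by (simp add: edge_graph_def)

lemma simple_edge_graph:
  "\<forall>(i, j)\<in>set es. i < n \<and> j < n \<and> i \<noteq> j \<Longrightarrow> simple_graph (edge_graph n es)"
  by (auto simp: simple_graph_def edge_graph_def)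

lemma lessThan_list:
  "{..<2} = set [0, 1 :: nat]" "{..<3} = set [0, 1, 2 :: nat]" "{..<4} = set [0, 1, 2, 3 :: nat]"
  "{..<5} = set [0, 1, 2, 3, 4 :: nat]" "{..<6} = set [0, 1, 2, 3, 4, 5 :: nat]"
  by auto

lemma B_edge_graph:
  "B1 = edge_graph 6 [(0,1), (0,2), (0,3), (0,4), (1,2), (1,5), (3,4)]"
  "B2 = edge_graph 6 [(0,1), (0,2), (0,3), (0,4), (1,2), (1,3), (4,5)]"
  "B3 = edge_graph 6 [(0,2), (0,3), (2,3), (0,1), (1,4), (1,5)]"
  by (simp_all add: B1_def B2_def B3_def edge_graph_def lessThan_list)

lemma lessThan_Plus_list:
  "{..<3} <+> {..<2} = set [Inl 0, Inl 1, Inl (2 :: nat), Inr 0, Inr (1 :: nat)]"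
  "{..<3} <+> {..<3} = set [Inl 0, Inl 1, Inl (2 :: nat), Inr 0, Inr 1, Inr (2 :: nat)]"
  "{..<4} <+> {..<2} = set [Inl 0, Inl 1, Inl 2, Inl (3 :: nat), Inr 0, Inr (1 :: nat)]"
  by (auto simp: lessThan_list)

text \<open>The tool for necessity: a chordal \<open>Y\<close> with the degrees of \<open>X\<close>
  but another isomorphism type rules \<open>X\<close> out. \<open>Y\<close> may live on any vertex
  type, hence the copy \<open>Z\<close> on \<open>nat\<close>.\<close>

lemma not_contained_competitor:
  assumes G: "simple_graph G" "hereditary_chordal_unigraph G"
    and X: "simple_graph X" "simple_graph Y" "chordal Y" "degree_sequence Y = degree_sequence X"
      "\<not> Y \<simeq> X"
  shows "\<not> contains_induced G X"
proof
  assume "contains_induced G X"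
  then obtain W where W: "W \<subseteq> verts G" "induced_subgraph G W \<simeq> X"
    by (auto simp: contains_induced_def)
  then have cu: "chordal_unigraph X"
    using chordal_unigraph_iso[OF simple_induced[OF G(1) W(1)] X(1)] G(2)
    by (auto simp: hereditary_chordal_unigraph_def)
  obtain Z :: "nat graph" where Z: "simple_graph Z" "Y \<simeq> Z" using nat_copyE[OF X(2)] .
  then have "chordal Z" "degree_sequence Z = degree_sequence X"
    using X chordal_mono contains_induced_iso degree_sequence_iso by metis+
  then have "Z \<simeq> X" using cu Z(1) by (auto simp: chordal_unigraph_def)
  then show False using Z(2) X(5) graph_iso_trans by blast
qed

abbreviation (input) "K3_K2 \<equiv> disjoint_union (complete_graph 3) (complete_graph 2)"
abbreviation (input) "P3_P3 \<equiv> disjoint_union (path_graph 3) (path_graph 3)"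
abbreviation (input) "P4_K2 \<equiv> disjoint_union (path_graph 4) (complete_graph 2)"

lemmas small_simple = simple_path_graph simple_complete_graph simple_disjoint_union

lemmas small_adj = adj_path_graph adj_complete_graph adj_disjoint_union adj_edge_graph

text \<open>Both graphs realise (2,2,2,1,1), and only one of them has a triangle. Each is the
  competitor that excludes the other.\<close>

lemma P5_K3_K2:
  "chordal (path_graph 5)" "chordal K3_K2"
  "degree_sequence (path_graph 5) = degree_sequence K3_K2"
  "\<not> K3_K2 \<simeq> path_graph 5"
proof -
  show "chordal (path_graph 5)"
    by (rule elimination_order_chordal[OF _ trans[OF verts_small(1) lessThan_list(4)]])
      (simp add: small_adj)
  show "chordal K3_K2"
    by (rule elimination_order_chordal[of _ "[Inl 0, Inl 1, Inl 2, Inr 0, Inr 1]"])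
      (simp_all add: small_adj lessThan_Plus_list)
  show "degree_sequence (path_graph 5) = degree_sequence K3_K2"
    unfolding degree_sequence_eq_iff
    by (subst degree_multiset_list[OF small_simple(1) trans[OF verts_small(1) lessThan_list(4)]],
        simp, subst degree_multiset_list[of _ "[Inl 0, Inl 1, Inl 2, Inr 0, Inr 1]"])
      (simp_all add: small_simple small_adj lessThan_Plus_list)
  show "\<not> K3_K2 \<simeq> path_graph 5"
  proof
    assume "K3_K2 \<simeq> path_graph 5"
    then obtain f where f: "\<And>x y. x \<in> verts K3_K2 \<Longrightarrow> y \<in> verts K3_K2 \<Longrightarrow>
        adj K3_K2 x y \<longleftrightarrow> adj (path_graph 5) (f x) (f y)"
      by (auto simp: graph_iso_iff)
    show False
      using f[of "Inl 0" "Inl 1"] f[of "Inl 0" "Inl 2"] f[of "Inl 1" "Inl 2"]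
      by (auto simp: small_adj lessThan_Plus_list)
  qed
qed

text \<open>Both graphs realise (2,2,1,1,1,1). A walk of three edges inside two disjoint copies of
  the path on three vertices must turn back, so there is no room for a path on four
  vertices.\<close>

lemma P3_P3_P4_K2:
  "chordal P3_P3" "chordal P4_K2"
  "degree_sequence P3_P3 = degree_sequence P4_K2"
  "\<not> P4_K2 \<simeq> P3_P3"
proof -
  show "chordal P3_P3"
    by (rule elimination_order_chordal[of _ "[Inl 0, Inl 1, Inl 2, Inr 0, Inr 1, Inr 2]"])
      (simp_all add: small_adj lessThan_Plus_list)
  show "chordal P4_K2"
    by (rule elimination_order_chordal[of _ "[Inl 0, Inl 1, Inl 2, Inl 3, Inr 0, Inr 1]"])
      (simp_all add: small_adj lessThan_Plus_list)
  show "degree_sequence P3_P3 = degree_sequence P4_K2"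
  proof -
    have "image_mset (degree P3_P3) (mset_set (verts P3_P3)) = {#Suc 1, Suc 1, 1, 1, 1, 1#}"
      by (subst degree_multiset_list[of _ "[Inl 0, Inl 1, Inl 2, Inr 0, Inr 1, Inr 2]"])
        (simp_all add: small_simple small_adj lessThan_Plus_list)
    moreover have "image_mset (degree P4_K2) (mset_set (verts P4_K2)) = {#Suc 1, Suc 1, 1, 1, 1, 1#}"
      by (subst degree_multiset_list[of _ "[Inl 0, Inl 1, Inl 2, Inl 3, Inr 0, Inr 1]"])
        (simp_all add: small_simple small_adj lessThan_Plus_list)
    ultimately show ?thesis by (simp only: degree_sequence_eq_iff)
  qed
  show "\<not> P4_K2 \<simeq> P3_P3"
  proof
    assume "P4_K2 \<simeq> P3_P3"
    then obtain f where inj: "inj_on f (verts P4_K2)" and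
      f: "\<And>x y. x \<in> verts P4_K2 \<Longrightarrow> y \<in> verts P4_K2 \<Longrightarrow> adj P4_K2 x y
        \<longleftrightarrow> adj P3_P3 (f x) (f y)"
      by (auto simp: graph_iso_iff bij_betw_def)
    have "f (Inl 0) \<noteq> f (Inl 2)" "f (Inl 1) \<noteq> f (Inl 3)"
      using inj by (auto simp: inj_on_eq_iff lessThan_Plus_list)
    moreover have "adj P3_P3 (f (Inl 0)) (f (Inl 1))" "adj P3_P3 (f (Inl 1)) (f (Inl 2))"
      "adj P3_P3 (f (Inl 2)) (f (Inl 3))"
      by (subst f[symmetric]; simp add: small_adj lessThan_Plus_list)+
    moreover have "a = c \<or> b = d" if "adj P3_P3 a b" "adj P3_P3 b c" "adj P3_P3 c d" for a b c d
      using that by (cases a; cases b; cases c; cases d) (auto simp: small_adj)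
    ultimately show False by blast
  qed
qed

text \<open>The chordal competitor of \<open>B3\<close>: a triangle with a pendant vertex at one
  corner and a pendant path of two edges at another, again with degrees (3,3,2,2,1,1).\<close>

definition B3' :: "nat graph" where
  "B3' = edge_graph 6 [(0,1), (0,2), (1,2), (0,3), (1,4), (4,5)]"

text \<open>In \<open>B2\<close> the edge \<open>uv\<close> lies in two triangles; in
  \<open>B1\<close> adjacent vertices have at most one common neighbour.\<close>

lemma B1_B2:
  "chordal B1" "chordal B2" "degree_sequence B1 = degree_sequence B2" "\<not> B2 \<simeq> B1"
proof -
  note verts = trans[OF verts_edge_graph lessThan_list(5)]
  show "chordal B1" "chordal B2"
    unfolding B_edge_graph
    by (rule elimination_order_chordal[of _ "[5, 4, 3, 2, 1, 0]"];
        (auto simp: adj_edge_graph lessThan_list; fail)+)+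
  show "degree_sequence B1 = degree_sequence B2"
    unfolding B_edge_graph degree_sequence_eq_iff
    by (subst (1 2) degree_multiset_list[OF _ verts]) (simp_all add: simple_edge_graph adj_edge_graph)
  show "\<not> B2 \<simeq> B1"
  proof
    assume "B2 \<simeq> B1"
    then obtain f where inj: "inj_on f (verts B2)" and
      f: "\<And>x y. x \<in> verts B2 \<Longrightarrow> y \<in> verts B2 \<Longrightarrow> adj B2 x y
        \<longleftrightarrow> adj B1 (f x) (f y)"
      by (auto simp: graph_iso_iff bij_betw_def)
    have "f 2 \<noteq> f 3" using inj by (auto simp: inj_on_eq_iff B_edge_graph)
    moreover have "adj B1 (f 0) (f 1)" "adj B1 (f 0) (f 2)" "adj B1 (f 0) (f 3)"
      "adj B1 (f 1) (f 2)" "adj B1 (f 1) (f 3)"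
      by (subst f[symmetric]; simp add: B_edge_graph adj_edge_graph)+
    moreover have "c = d"
      if "adj B1 a b" "adj B1 a c" "adj B1 a d" "adj B1 b c" "adj B1 b d" for a b c d
      using that(1) by (simp add: B_edge_graph adj_edge_graph)
        (elim disjE conjE; use that(2-) in \<open>auto simp: B_edge_graph adj_edge_graph\<close>)
    ultimately show False by blast
  qed
qed

text \<open>\<open>B3\<close> has an induced claw centred at \<open>v\<close>, whereas
  \<open>B3'\<close> is claw-free.\<close>

lemma B3_B3':
  "chordal B3'" "degree_sequence B3' = degree_sequence B3" "\<not> B3 \<simeq> B3'"
proof -
  note verts = trans[OF verts_edge_graph lessThan_list(5)]
  show "chordal B3'"
    unfolding B3'_def
    by (rule elimination_order_chordal[of _ "[5, 4, 3, 2, 1, 0]"])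
      (auto simp: adj_edge_graph lessThan_list)
  show "degree_sequence B3' = degree_sequence B3"
    unfolding B_edge_graph B3'_def degree_sequence_eq_iff
    by (subst (1 2) degree_multiset_list[OF _ verts]) (simp_all add: simple_edge_graph adj_edge_graph)
  show "\<not> B3 \<simeq> B3'"
  proof
    assume "B3 \<simeq> B3'"
    then obtain f where inj: "inj_on f (verts B3)" and
      f: "\<And>x y. x \<in> verts B3 \<Longrightarrow> y \<in> verts B3 \<Longrightarrow> adj B3 x y
        \<longleftrightarrow> adj B3' (f x) (f y)"
      by (auto simp: graph_iso_iff bij_betw_def)
    have "f 0 \<noteq> f 4" "f 0 \<noteq> f 5" "f 4 \<noteq> f 5" using inj by (auto simp: inj_on_eq_iff B_edge_graph)
    moreover have "adj B3' (f 1) (f 0)" "adj B3' (f 1) (f 4)" "adj B3' (f 1) (f 5)"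
      "\<not> adj B3' (f 0) (f 4)" "\<not> adj B3' (f 0) (f 5)" "\<not> adj B3' (f 4) (f 5)"
      by (subst f[symmetric]; simp add: B_edge_graph adj_edge_graph)+
    moreover have "a = b \<or> a = c \<or> b = c \<or> adj B3' a b \<or> adj B3' a c \<or> adj B3' b c"
      if "adj B3' v a" "adj B3' v b" "adj B3' v c" for v a b c
      using that(1) by (simp add: B3'_def adj_edge_graph)
        (elim disjE conjE; use that(2-) in \<open>auto simp: B3'_def adj_edge_graph\<close>)
    ultimately show False by blast
  qed
qed

section \<open>Forbidden configurations\<close>

text \<open>Concrete split graphs on the clique 3, 4, 5 and the stable set 0, 1, 2.
  \<open>R1\<close> and \<open>R2\<close> share the degrees (4,3,3,2,1,1), \<open>S1\<close> and
  \<open>S2\<close> share (4,4,3,2,2,1). They need not be identified inside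
  \<open>RS_graphs\<close>: it suffices that a split graph that is not a unigraph contains a member
  of that set.\<close>

definition "R1 = edge_graph 6 [(0,5), (1,5), (2,3), (2,4), (3,4), (3,5), (4,5)]"
definition "R2 = edge_graph 6 [(0,3), (1,5), (2,4), (2,5), (3,4), (3,5), (4,5)]"
definition "S1 = edge_graph 6 [(0,3), (1,4), (1,5), (2,4), (2,5), (3,4), (3,5), (4,5)]"
definition "S2 = edge_graph 6 [(0,4), (1,3), (1,5), (2,4), (2,5), (3,4), (3,5), (4,5)]"

lemmas RS_defs = R1_def R2_def S1_def S2_def

lemma RS_simple: "simple_graph R1" "simple_graph R2" "simple_graph S1" "simple_graph S2"
  unfolding RS_defs by (rule simple_edge_graph; simp; fail)+

lemma RS_split: "split_graph R2" "split_graph S1" "split_graph S2"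
  unfolding RS_defs split_graph_iff
  by (rule exI[of _ "{3, 4, 5}"], rule exI[of _ "{0, 1, 2}"], auto simp: adj_edge_graph lessThan_list; fail)+

lemma RS_degree_sequence: "degree_sequence R1 = degree_sequence R2" "degree_sequence S1 = degree_sequence S2"
proof -
  note verts = trans[OF verts_edge_graph lessThan_list(5)]
  show "degree_sequence R1 = degree_sequence R2"
    unfolding RS_defs degree_sequence_eq_iff
    by (subst (1 2) degree_multiset_list[OF _ verts]) (simp_all add: simple_edge_graph adj_edge_graph)
  show "degree_sequence S1 = degree_sequence S2"
    unfolding RS_defs degree_sequence_eq_iff
    by (subst (1 2) degree_multiset_list[OF _ verts]) (simp_all add: simple_edge_graph adj_edge_graph)
qed

lemma RS_degree:
  "map (degree R1) [0, 1, 2, 3, 4, 5] = [1, 1, 2, 3, 3, 4]"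
  "map (degree R2) [0, 1, 2, 3, 4, 5] = [1, 1, 2, 3, 3, 4]"
  "map (degree S1) [0, 1, 2, 3, 4, 5] = [1, 2, 2, 3, 4, 4]"
  "map (degree S2) [0, 1, 2, 3, 4, 5] = [1, 2, 2, 3, 4, 4]"
  using RS_simple
  by (simp_all add: RS_defs degree_list[OF _ trans[OF verts_edge_graph lessThan_list(5)]] adj_edge_graph)

text \<open>Both vertices of degree 1 hang at the vertex of degree 4 in \<open>R1\<close>, but only
  one of them does in \<open>R2\<close>.\<close>

lemma R1_not_iso_R2: "\<not> R1 \<simeq> R2"
proof
  assume "R1 \<simeq> R2"
  then obtain f where f: "bij_betw f (verts R1) (verts R2)"
    "\<And>x y. x \<in> verts R1 \<Longrightarrow> y \<in> verts R1 \<Longrightarrow> adj R1 x y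
      \<longleftrightarrow> adj R2 (f x) (f y)"
    by (auto simp: graph_iso_iff)
  have im: "f i \<in> {0, 1, 2, 3, 4, 5}" if "i < 6" for i
  proof -
    have "f i < 6" using bij_betwE[OF f(1)] that by (simp add: RS_defs)
    then show ?thesis by auto
  qed
  have deg: "degree R2 (f i) = degree R1 i" if "i < 6" for i
    using degree_iso[OF RS_simple(1,2) f] that by (simp add: RS_defs)
  have "f 5 = 5" using im[of 5] deg[of 5] RS_degree by auto
  moreover have "f 0 \<in> {0, 1}" "f 1 \<in> {0, 1}"
    using im[of 0] deg[of 0] im[of 1] deg[of 1] RS_degree by auto
  moreover have "f 0 \<noteq> f 1" using inj_on_eq_iff[OF bij_betw_imp_inj_on[OF f(1)], of 0 1] by (simp add: RS_defs)
  moreover have "adj R2 (f 0) (f 5)" "adj R2 (f 1) (f 5)"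
    by (subst f(2)[symmetric]; simp add: RS_defs adj_edge_graph)+
  ultimately show False by (auto simp: RS_defs adj_edge_graph)
qed

text \<open>The unique vertex of degree 1 hangs at the unique vertex of degree 3 in
  \<open>S1\<close>, but at a vertex of degree 4 in \<open>S2\<close>.\<close>

lemma S1_not_iso_S2: "\<not> S1 \<simeq> S2"
proof
  assume "S1 \<simeq> S2"
  then obtain f where f: "bij_betw f (verts S1) (verts S2)"
    "\<And>x y. x \<in> verts S1 \<Longrightarrow> y \<in> verts S1 \<Longrightarrow> adj S1 x y
      \<longleftrightarrow> adj S2 (f x) (f y)"
    by (auto simp: graph_iso_iff)
  have im: "f i \<in> {0, 1, 2, 3, 4, 5}" if "i < 6" for i
  proof -
    have "f i < 6" using bij_betwE[OF f(1)] that by (simp add: RS_defs)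
    then show ?thesis by auto
  qed
  have deg: "degree S2 (f i) = degree S1 i" if "i < 6" for i
    using degree_iso[OF RS_simple(3,4) f] that by (simp add: RS_defs)
  have "f 0 = 0" "f 3 = 3" using im[of 0] deg[of 0] im[of 3] deg[of 3] RS_degree by auto
  moreover have "adj S2 (f 0) (f 3)"
    by (subst f(2)[symmetric]; simp add: RS_defs adj_edge_graph)+
  ultimately show False by (simp add: RS_defs adj_edge_graph)
qed

lemma RS_not_unigraph: "\<not> unigraph R2" "\<not> unigraph S1" "\<not> unigraph S2"
  using RS_simple RS_degree_sequence R1_not_iso_R2 S1_not_iso_S2 graph_iso_sym
  unfolding unigraph_def by metis+

text \<open>The copy is given by listing the images \<open>vs\<close> in the order of
  \<open>xs\<close>. Symmetry and irreflexivity reduce the check to the pairs with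
  \<open>i < j\<close>, which unfold to finitely many facts.\<close>

lemma contains_induced_listI:
  assumes "simple_graph G" "simple_graph X" "verts X = set xs" "distinct xs" "distinct vs"
    and "set vs \<subseteq> verts G" "length vs = length xs"
    and "\<forall>j<length xs. \<forall>i<j. adj X (xs ! i) (xs ! j) \<longleftrightarrow> adj G (vs ! i) (vs ! j)"
  shows "contains_induced G X"
  unfolding contains_induced_iff
proof (intro exI conjI ballI)
  let ?f = "\<lambda>x. the (map_of (zip xs vs) x)"
  have f: "?f (xs ! i) = vs ! i" if "i < length xs" for i
    using that assms(4,7) by (simp add: map_of_zip_nth)
  show "inj_on ?f (verts X)"
    unfolding inj_on_def assms(3) using f assms(5,7)
    by (metis (no_types, lifting) in_set_conv_nth nth_eq_iff_index_eq)
  show "?f ` verts X \<subseteq> verts G"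
    unfolding assms(3) using f assms(6,7) by (auto simp: in_set_conv_nth) (metis nth_mem subsetD)
  fix x y assume "x \<in> verts X" "y \<in> verts X"
  then obtain i j where ij: "i < length xs" "x = xs ! i" "j < length xs" "y = xs ! j"
    using assms(3) by (auto simp: in_set_conv_nth)
  show "adj X x y \<longleftrightarrow> adj G (?f x) (?f y)"
    using assms(8) ij f adj_irrefl[OF assms(1)] adj_irrefl[OF assms(2)]
    by (cases i j rule: linorder_cases) (auto simp: adj_commute)
qed

lemma all_less_Suc:
  "(\<forall>i<Suc n. P i) \<longleftrightarrow> P n \<and> (\<forall>i<n. P i)" "(\<forall>i<1. P i)
    \<longleftrightarrow> P (0 :: nat)"
  "(\<forall>i<numeral k. P i) \<longleftrightarrow> P (pred_numeral k) \<and> (\<forall>i<pred_numeral k. P i)"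
  by (auto simp: less_Suc_eq numeral_eq_Suc)

lemma simple_cycle_graph: "3 \<le> n \<Longrightarrow> simple_graph (cycle_graph n)"
  by (auto simp: simple_graph_def cycle_graph_def mod_Suc card_insert_if split: if_splits)

lemma simple_cycle_4: "simple_graph (cycle_graph 4)" and simple_cycle_5: "simple_graph (cycle_graph 5)"
  by (simp_all add: simple_cycle_graph)

lemma B_simple: "simple_graph B1" "simple_graph B2" "simple_graph B3"
  unfolding B_edge_graph by (rule simple_edge_graph; simp; fail)+

text \<open>A forbidden graph as an implication from its edges to a disjunction of its non-edges,
  the form suited to propositional reasoning. Distinctness has to be assumed only for nonadjacent
  vertices with equal neighbourhoods in the pattern; all other inequalities follow from the
  adjacencies. The same holds for the rules named \<open>no_...\<close> below.\<close>

lemma C4_chord: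
  assumes "simple_graph G" "\<not> contains_induced G (cycle_graph 4)"
    and "adj G a b" "adj G b c" "adj G c d" "adj G a d" "a \<noteq> c" "b \<noteq> d"
  shows "adj G a c \<or> adj G b d"
proof (rule ccontr)
  assume non: "\<not> ?thesis"
  have "distinct [a, b, c, d]"
    using assms non adj_irrefl[OF assms(1)] by (auto simp: adj_commute)
  moreover have "set [a, b, c, d] \<subseteq> verts G" using assms adj_verts[OF assms(1)] by simp
  ultimately have "contains_induced G (cycle_graph 4)"
    by (rule contains_induced_listI[OF assms(1) simple_cycle_4, where xs = "[0, 1, 2, 3]", rotated 2])
      (use assms non in \<open>simp_all add: adj_cycle_graph all_less_Suc lessThan_list adj_commute\<close>)
  then show False using assms(2) by contradiction
qed

section \<open>The forbidden graphs as implications between adjacencies\<close>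

locale forbidden_free =
  fixes G :: "'a graph"
  assumes simple: "simple_graph G"
    and free_C4: "\<not> contains_induced G (cycle_graph 4)"
    and free_C5: "\<not> contains_induced G (cycle_graph 5)"
    and free_P5: "\<not> contains_induced G (path_graph 5)"
    and free_K3_K2: "\<not> contains_induced G (disjoint_union (complete_graph 3) (complete_graph 2))"
    and free_P3_P3: "\<not> contains_induced G (disjoint_union (path_graph 3) (path_graph 3))"
    and free_P4_K2: "\<not> contains_induced G (disjoint_union (path_graph 4) (complete_graph 2))"
    and free_RS: "\<forall>H\<in>RS_graphs. \<not> contains_induced G H"
    and free_B1: "\<not> contains_induced G B1"
    and free_B2: "\<not> contains_induced G B2"
    and free_B3: "\<not> contains_induced G B3"
begin

abbreviation E :: "'a \<Rightarrow> 'a \<Rightarrow> bool" (infix \<open>\<sim>\<close> 50) where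
  "x \<sim> y \<equiv> adj G x y"

lemma irrefl: "\<not> x \<sim> x"
  using adj_irrefl[OF simple] .

lemma split_unigraph:
  assumes "simple_graph X" "split_graph X" "contains_induced G X"
  shows "unigraph X"
  using contains_RS_graph[OF assms(1,2)] contains_induced_trans[OF assms(3)] free_RS by blast

lemma free_split: "\<not> contains_induced G R2" "\<not> contains_induced G S1" "\<not> contains_induced G S2"
  using split_unigraph RS_simple RS_split RS_not_unigraph by blast+

lemma induced_listE:
  assumes "\<not> contains_induced G X" "simple_graph X" "distinct vs" "set vs \<subseteq> verts G"
    "verts X = set xs" "distinct xs" "length vs = length xs"
    "\<forall>j<length xs. \<forall>i<j. adj X (xs ! i) (xs ! j) \<longleftrightarrow> adj G (vs ! i) (vs ! j)"
  shows False
  using contains_induced_listI[OF simple assms(2,5,6,3,4,7,8)] assms(1) by contradiction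

lemmas no_C4 = C4_chord[OF simple free_C4]

lemma no_C5:
  assumes "a \<sim> b" "b \<sim> c" "c \<sim> d" "d \<sim> e" "a \<sim> e"
  shows "a \<sim> c \<or> a \<sim> d \<or> b \<sim> d \<or> b \<sim> e \<or> c \<sim> e"
proof (rule ccontr)
  assume non: "\<not> ?thesis"
  have "distinct [a, b, c, d, e]" using assms non irrefl by (auto simp: adj_commute)
  moreover have "set [a, b, c, d, e] \<subseteq> verts G" using assms adj_verts[OF simple] by simp
  ultimately show False
    by (rule induced_listE[OF free_C5 simple_cycle_5, where xs = "[0, 1, 2, 3, 4 :: nat]"])
      (use assms non in \<open>simp_all add: adj_cycle_graph small_adj all_less_Suc lessThan_list adj_commute\<close>)
qed

lemma no_P5:
  assumes "a \<sim> b" "b \<sim> c" "c \<sim> d" "d \<sim> e"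
  shows "a \<sim> c \<or> a \<sim> d \<or> a \<sim> e \<or> b \<sim> d \<or> b \<sim> e \<or>
    c \<sim> e"
proof (rule ccontr)
  assume non: "\<not> ?thesis"
  have "distinct [a, b, c, d, e]" using assms non irrefl by (auto simp: adj_commute)
  moreover have "set [a, b, c, d, e] \<subseteq> verts G" using assms adj_verts[OF simple] by simp
  ultimately show False
    by (rule induced_listE[OF free_P5 small_simple(1), where xs = "[0, 1, 2, 3, 4 :: nat]"])
      (use assms non in \<open>simp_all add: small_adj all_less_Suc lessThan_list adj_commute\<close>)
qed

lemma no_K3_K2:
  assumes "a \<sim> b" "a \<sim> c" "b \<sim> c" "d \<sim> e"
  shows "a \<sim> d \<or> a \<sim> e \<or> b \<sim> d \<or> b \<sim> e \<or> c \<sim> d \<or>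
    c \<sim> e"
proof (rule ccontr)
  assume non: "\<not> ?thesis"
  have "distinct [a, b, c, d, e]" using assms non irrefl by (auto simp: adj_commute)
  moreover have "set [a, b, c, d, e] \<subseteq> verts G" using assms adj_verts[OF simple] by simp
  ultimately show False
    by (rule induced_listE[OF free_K3_K2 small_simple(3)[OF small_simple(2,2)], where xs = "[Inl 0, Inl 1, Inl 2, Inr 0, Inr 1]"])
      (use assms non in \<open>simp_all add: small_adj all_less_Suc lessThan_Plus_list adj_commute\<close>)
qed

lemma no_P3_P3:
  assumes "a \<sim> b" "b \<sim> c" "d \<sim> e" "e \<sim> f" "a \<noteq> c" "d \<noteq> f"
  shows "a \<sim> c \<or> a \<sim> d \<or> a \<sim> e \<or> a \<sim> f \<or> b \<sim> d \<or>
    b \<sim> e \<or> b \<sim> f \<or> c \<sim> d \<or> c \<sim> e \<or> c \<sim> f \<or>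
    d \<sim> f"
proof (rule ccontr)
  assume non: "\<not> ?thesis"
  have "distinct [a, b, c, d, e, f]" using assms non irrefl by (auto simp: adj_commute)
  moreover have "set [a, b, c, d, e, f] \<subseteq> verts G" using assms adj_verts[OF simple] by simp
  ultimately show False
    by (rule induced_listE[OF free_P3_P3 small_simple(3)[OF small_simple(1,1)],
      where xs = "[Inl 0, Inl 1, Inl 2, Inr 0, Inr 1, Inr 2]"])
      (use assms non in \<open>simp_all add: small_adj all_less_Suc lessThan_Plus_list adj_commute\<close>)
qed

lemma no_P4_K2:
  assumes "a \<sim> b" "b \<sim> c" "c \<sim> d" "e \<sim> f"
  shows "a \<sim> c \<or> a \<sim> d \<or> a \<sim> e \<or> a \<sim> f \<or> b \<sim> d \<or>
    b \<sim> e \<or> b \<sim> f \<or> c \<sim> e \<or> c \<sim> f \<or> d \<sim> e \<or>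
    d \<sim> f"
proof (rule ccontr)
  assume non: "\<not> ?thesis"
  have "distinct [a, b, c, d, e, f]" using assms non irrefl by (auto simp: adj_commute)
  moreover have "set [a, b, c, d, e, f] \<subseteq> verts G" using assms adj_verts[OF simple] by simp
  ultimately show False
    by (rule induced_listE[OF free_P4_K2 small_simple(3)[OF small_simple(1,2)],
      where xs = "[Inl 0, Inl 1, Inl 2, Inl 3, Inr 0, Inr 1]"])
      (use assms non in \<open>simp_all add: small_adj all_less_Suc lessThan_Plus_list adj_commute\<close>)
qed

lemma no_B1:
  assumes "a \<sim> b" "a \<sim> c" "a \<sim> d" "a \<sim> e" "b \<sim> c" "b \<sim> f" "d \<sim> e"
  shows "a \<sim> f \<or> b \<sim> d \<or> b \<sim> e \<or> c \<sim> d \<or> c \<sim> e \<or>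
    c \<sim> f \<or> d \<sim> f \<or> e \<sim> f"
proof (rule ccontr)
  assume non: "\<not> ?thesis"
  have "distinct [a, b, c, d, e, f]" using assms non irrefl by (auto simp: adj_commute)
  moreover have "set [a, b, c, d, e, f] \<subseteq> verts G" using assms adj_verts[OF simple] by simp
  ultimately show False
    by (rule induced_listE[OF free_B1 B_simple(1), where xs = "[0, 1, 2, 3, 4, 5]"])
      (use assms non in \<open>simp_all add: B_edge_graph RS_defs small_adj all_less_Suc lessThan_list adj_commute\<close>)
qed

lemma no_B2:
  assumes "a \<sim> b" "a \<sim> c" "a \<sim> d" "a \<sim> e" "b \<sim> c" "b \<sim> d" "e \<sim> f"
    "c \<noteq> d"
  shows "a \<sim> f \<or> b \<sim> e \<or> b \<sim> f \<or> c \<sim> d \<or> c \<sim> e \<or>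
    c \<sim> f \<or> d \<sim> e \<or> d \<sim> f"
proof (rule ccontr)
  assume non: "\<not> ?thesis"
  have "distinct [a, b, c, d, e, f]" using assms non irrefl by (auto simp: adj_commute)
  moreover have "set [a, b, c, d, e, f] \<subseteq> verts G" using assms adj_verts[OF simple] by simp
  ultimately show False
    by (rule induced_listE[OF free_B2 B_simple(2), where xs = "[0, 1, 2, 3, 4, 5]"])
      (use assms non in \<open>simp_all add: B_edge_graph RS_defs small_adj all_less_Suc lessThan_list adj_commute\<close>)
qed

lemma no_B3:
  assumes "a \<sim> b" "a \<sim> c" "b \<sim> c" "a \<sim> d" "d \<sim> e" "d \<sim> f" "e \<noteq> f"
  shows "a \<sim> e \<or> a \<sim> f \<or> d \<sim> b \<or> d \<sim> c \<or> b \<sim> e \<or>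
    b \<sim> f \<or> c \<sim> e \<or> c \<sim> f \<or> e \<sim> f"
proof (rule ccontr)
  assume non: "\<not> ?thesis"
  have "distinct [a, d, b, c, e, f]" using assms non irrefl by (auto simp: adj_commute)
  moreover have "set [a, d, b, c, e, f] \<subseteq> verts G" using assms adj_verts[OF simple] by simp
  ultimately show False
    by (rule induced_listE[OF free_B3 B_simple(3), where xs = "[0, 1, 2, 3, 4, 5]"])
      (use assms non in \<open>simp_all add: B_edge_graph RS_defs small_adj all_less_Suc lessThan_list adj_commute\<close>)
qed

text \<open>Roles: the triangle \<open>b\<close>, \<open>f\<close>, \<open>d\<close>, with
  \<open>a\<close> hanging at \<open>b\<close>, \<open>c\<close> hanging at \<open>d\<close>, and
  \<open>e\<close> attached to the edge \<open>fd\<close>.\<close>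

lemma no_R2:
  assumes "a \<sim> b" "c \<sim> d" "e \<sim> f" "e \<sim> d" "b \<sim> f" "b \<sim> d" "f \<sim> d"
  shows "a \<sim> c \<or> a \<sim> e \<or> a \<sim> f \<or> a \<sim> d \<or> c \<sim> e \<or>
    c \<sim> b \<or> c \<sim> f \<or> e \<sim> b"
proof (rule ccontr)
  assume non: "\<not> ?thesis"
  have "distinct [a, c, e, b, f, d]" using assms non irrefl by (auto simp: adj_commute)
  moreover have "set [a, c, e, b, f, d] \<subseteq> verts G" using assms adj_verts[OF simple] by simp
  ultimately show False
    by (rule induced_listE[OF free_split(1) RS_simple(2), where xs = "[0, 1, 2, 3, 4, 5]"])
      (use assms non in \<open>simp_all add: B_edge_graph RS_defs small_adj all_less_Suc lessThan_list adj_commute\<close>)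
qed

text \<open>Roles: the triangle \<open>b\<close>, \<open>d\<close>, \<open>e\<close>, with
  \<open>a\<close> hanging at \<open>b\<close> and both \<open>c\<close> and \<open>f\<close>
  attached to the opposite edge \<open>de\<close>.\<close>

lemma no_S1:
  assumes "a \<sim> b" "c \<sim> d" "c \<sim> e" "f \<sim> d" "f \<sim> e" "b \<sim> d" "b \<sim> e"
    "d \<sim> e" "c \<noteq> f"
  shows "a \<sim> c \<or> a \<sim> f \<or> a \<sim> d \<or> a \<sim> e \<or> c \<sim> f \<or>
    c \<sim> b \<or> f \<sim> b"
proof (rule ccontr)
  assume non: "\<not> ?thesis"
  have "distinct [a, c, f, b, d, e]" using assms non irrefl by (auto simp: adj_commute)
  moreover have "set [a, c, f, b, d, e] \<subseteq> verts G" using assms adj_verts[OF simple] by simp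
  ultimately show False
    by (rule induced_listE[OF free_split(2) RS_simple(3), where xs = "[0, 1, 2, 3, 4, 5]"])
      (use assms non in \<open>simp_all add: B_edge_graph RS_defs small_adj all_less_Suc lessThan_list adj_commute\<close>)
qed

text \<open>Roles: the triangle \<open>b\<close>, \<open>d\<close>, \<open>e\<close>, with
  \<open>a\<close> hanging at \<open>b\<close>, \<open>c\<close> attached to the edge
  \<open>de\<close> and \<open>f\<close> to the edge \<open>be\<close>.\<close>

lemma no_S2:
  assumes "a \<sim> b" "c \<sim> d" "c \<sim> e" "f \<sim> b" "f \<sim> e" "d \<sim> b" "d \<sim> e"
    "b \<sim> e"
  shows "a \<sim> c \<or> a \<sim> f \<or> a \<sim> d \<or> a \<sim> e \<or> c \<sim> f \<or>
    c \<sim> b \<or> f \<sim> d"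
proof (rule ccontr)
  assume non: "\<not> ?thesis"
  have "distinct [a, c, f, d, b, e]" using assms non irrefl by (auto simp: adj_commute)
  moreover have "set [a, c, f, d, b, e] \<subseteq> verts G" using assms adj_verts[OF simple] by simp
  ultimately show False
    by (rule induced_listE[OF free_split(3) RS_simple(4), where xs = "[0, 1, 2, 3, 4, 5]"])
      (use assms non in \<open>simp_all add: B_edge_graph RS_defs small_adj all_less_Suc lessThan_list adj_commute\<close>)
qed


end

section \<open>Maximal cores\<close>

text \<open>In other words, \<open>R\<close> induces a disjoint union of copies of
  \<open>K\<^sub>2\<close>.\<close>

definition matched :: "'a graph \<Rightarrow> 'a set \<Rightarrow> bool" where
  "matched G R \<longleftrightarrow> (\<forall>r\<in>R. \<exists>!q. q \<in> R \<and> adj G r q)"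

lemma matchedE:
  assumes "matched G R" "r \<in> R"
  obtains q where "q \<in> R" "adj G r q" "\<And>p. p \<in> R \<Longrightarrow> adj G r p \<Longrightarrow> p = q"
  using assms unfolding matched_def by blast

lemma matched_unique:
  "matched G R \<Longrightarrow> r \<in> R \<Longrightarrow> p \<in> R \<Longrightarrow> q \<in> R \<Longrightarrow> adj G r p
    \<Longrightarrow> adj G r q \<Longrightarrow> p = q"
  unfolding matched_def by blast

lemma matched_pair:
  assumes "simple_graph G" "adj G a b"
  shows "matched G {a, b}"
  using assms adj_irrefl[OF assms(1)] adj_symD[OF assms(2)] unfolding matched_def by auto

lemma matched_Un:
  assumes "matched G R" "matched G S" "\<And>r s. r \<in> R \<Longrightarrow> s \<in> S \<Longrightarrow> \<not> adj G r s"
  shows "matched G (R \<union> S)"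
proof -
  have "\<not> adj G s r" if "r \<in> R" "s \<in> S" for r s using assms(3)[OF that] by (simp add: adj_commute)
  then show ?thesis using assms unfolding matched_def by (metis Un_iff)
qed

lemma matched_remove:
  assumes "simple_graph G" "matched G R" "a \<in> R" "b \<in> R" "adj G a b"
  shows "matched G (R - {a, b})"
  unfolding matched_def
proof
  fix r assume r: "r \<in> R - {a, b}"
  then obtain q where q: "q \<in> R" "adj G r q" "\<And>p. p \<in> R \<Longrightarrow> adj G r p \<Longrightarrow> p = q"
    using matchedE[OF assms(2), of r] by blast
  have "q \<noteq> a" "q \<noteq> b"
    using matched_unique[OF assms(2,3), of b r] matched_unique[OF assms(2,4), of a r] r q(2) assms(3-5)
    by (auto simp: adj_commute)
  then show "\<exists>!q. q \<in> R - {a, b} \<and> adj G r q" using q by blast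
qed

text \<open>An induced \<open>2K\<^sub>2\<close> is the smallest star matching. A vertex adjacent to three of the four
  vertices of a \<open>2K\<^sub>2\<close> produces a windmill, and a further vertex can extend a windmill to something
  other than a windmill only by producing a bipod with two vertices in \<open>P \<union> Q\<close>.\<close>

definition star_matching :: "'a graph \<Rightarrow> 'a \<Rightarrow> 'a set \<Rightarrow> 'a set \<Rightarrow> bool" where
  "star_matching G s L R \<longleftrightarrow> L \<noteq> {} \<and> R \<noteq> {} \<and> matched G R \<and>
     (\<forall>l\<in>L. adj G s l) \<and> (\<forall>r\<in>R. \<not> adj G s r) \<and> (\<forall>l\<in>L. \<forall>u\<in>L \<union>
       R. \<not> adj G l u) \<and>
     s \<notin> R \<and> L \<inter> R = {}"

text \<open>The centre \<open>x\<close> carries triangles (one for each edge inside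
  \<open>R\<close>), pendant vertices \<open>L\<close> and a single pendant path \<open>x\<close>,
  \<open>c\<close>, \<open>d\<close>.\<close>

definition windmill ::
  "'a graph \<Rightarrow> 'a \<Rightarrow> 'a \<Rightarrow> 'a \<Rightarrow> 'a set \<Rightarrow> 'a set \<Rightarrow> bool" where
  "windmill G x c d L R \<longleftrightarrow> R \<noteq> {} \<and> matched G R \<and>
     adj G x c \<and> adj G c d \<and> \<not> adj G x d \<and> x \<noteq> d \<and>
     (\<forall>u\<in>L \<union> R. adj G x u \<and> \<not> adj G c u \<and> \<not> adj G d u) \<and> (\<forall>l\<in>L.
       \<forall>u\<in>L \<union> R. \<not> adj G l u) \<and>
     {c, d} \<inter> (L \<union> R) = {} \<and> L \<inter> R = {}"

lemma windmillD:
  assumes "windmill G x c d L R"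
  shows "R \<noteq> {}" "matched G R" "adj G x c" "adj G c d" "\<not> adj G x d" "x \<noteq> d" "L \<inter> R = {}"
    "{c, d} \<inter> (L \<union> R) = {}" "u \<in> L \<union> R \<Longrightarrow> adj G x u" "u \<in> L \<union> R
      \<Longrightarrow> \<not> adj G c u"
    "u \<in> L \<union> R \<Longrightarrow> \<not> adj G d u" "l \<in> L \<Longrightarrow> u \<in> L \<union> R
      \<Longrightarrow> \<not> adj G l u"
  using assms by (simp_all add: windmill_def)

lemma star_matchingD:
  assumes "star_matching G s L R"
  shows "L \<noteq> {}" "R \<noteq> {}" "matched G R" "s \<notin> R" "L \<inter> R = {}" "l \<in> L \<Longrightarrow> adj G s l"
    "r \<in> R \<Longrightarrow> \<not> adj G s r" "l \<in> L \<Longrightarrow> u \<in> L \<union> R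
      \<Longrightarrow> \<not> adj G l u"
  using assms by (simp_all add: star_matching_def)

text \<open>The edges \<open>ys\<close> and \<open>zt\<close> form an induced
  \<open>2K\<^sub>2\<close>, and every vertex of the clique \<open>P \<union> Q\<close> misses
  exactly one of the four ends: \<open>t\<close> if it lies in \<open>P\<close>, \<open>s\<close> if
  it lies in \<open>Q\<close>. With a one-element clique this is a triangle with a pendant path of
  two edges, the smallest windmill.\<close>

definition bipod :: "'a graph \<Rightarrow> 'a \<Rightarrow> 'a \<Rightarrow> 'a \<Rightarrow> 'a \<Rightarrow> 'a set \<Rightarrow> 'a set \<Rightarrow> bool" where
  "bipod G y z s t P Q \<longleftrightarrow> adj G y s \<and> adj G z t \<and>
     \<not> adj G y z \<and> \<not> adj G y t \<and> \<not> adj G z s \<and> \<not> adj G s t \<and>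
     (\<forall>a\<in>P \<union> Q. \<forall>b\<in>P \<union> Q. a \<noteq> b \<longrightarrow> adj G a b) \<and> (\<forall>a\<in>P
       \<union> Q. adj G y a \<and> adj G z a) \<and>
     (\<forall>a\<in>P. adj G s a \<and> \<not> adj G t a) \<and> (\<forall>a\<in>Q. adj G t a \<and> \<not> adj G s a) \<and>
     distinct [y, z, s, t] \<and> {s, t} \<inter> (P \<union> Q) = {}"

lemma bipod_sym: "bipod G y z s t P Q \<Longrightarrow> bipod G z y t s Q P"
  unfolding bipod_def by (auto simp: adj_commute)

lemma bipod_disjoint: "bipod G y z s t P Q \<Longrightarrow> P \<inter> Q = {}"
  unfolding bipod_def by auto

lemma bipod_insert:
  assumes "bipod G y z s t P Q" "adj G v y" "adj G v z" "adj G v s" "\<not> adj G v t"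
    and "\<And>u. u \<in> P \<union> Q \<Longrightarrow> adj G v u" "v \<noteq> s" "v \<noteq> t"
  shows "bipod G y z s t (insert v P) Q"
  using assms assms(2-4)[THEN adj_symD] assms(5)[THEN not_adj_symD] assms(6)[THEN adj_symD]
  unfolding bipod_def by auto

section \<open>How a vertex outside a core attaches to it\<close>

context forbidden_free
begin

text \<open>Of the 32 conceivable neighbourhoods of \<open>v\<close> in the smallest windmill, six
  survive: the empty one, \<open>x\<close> alone, everything, and three that omit exactly one of
  \<open>d\<close>, \<open>e\<close>, \<open>f\<close>. The listed instances of forbidden graphs
  exclude the others; once the known adjacencies are inserted, each instance is a clause over the
  unknown adjacencies of \<open>v\<close>, and \<open>argo\<close> settles the propositional
  rest.\<close>

lemma kite_trace:
  assumes p: "x \<sim> c" "x \<sim> e" "x \<sim> f" "c \<sim> d" "e \<sim> f"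
    and n: "\<not> x \<sim> d" "\<not> c \<sim> e" "\<not> c \<sim> f" "\<not> d \<sim> e" "\<not> d \<sim> f"
    and d: "v \<notin> {x, c, d, e, f}"
  shows "\<not> v \<sim> c \<and> \<not> v \<sim> d \<and> \<not> v \<sim> e \<and> \<not> v \<sim> f \<or>
    v \<sim> x \<and> (v \<sim> c \<and> v \<sim> d \<and> (v \<sim> e \<or> v \<sim> f) \<or> v \<sim> c \<and> v \<sim> e \<and>
      v \<sim> f)"
proof -
  have c: "a \<sim> v \<longleftrightarrow> v \<sim> a" for a by (rule adj_commute)
  have d': "x \<noteq> d" "c \<noteq> e" "c \<noteq> f" "d \<noteq> e" "d \<noteq> f" using p n by (auto simp: adj_commute)
  have d'': "v \<noteq> x" "v \<noteq> c" "v \<noteq> d" "v \<noteq> e" "v \<noteq> f" using d by auto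
  note base = p n p[THEN adj_symD] n[THEN not_adj_symD] c d' d'[symmetric] d'' d''[symmetric]
  show ?thesis
    using no_C4[of x c d v] no_C4[of x c v e] no_C4[of x c v f] no_C5[of x c d v e]
      no_P5[of d c x e v] no_P5[of e x c d v] no_K3_K2[of c d v e f] no_P5[of d c x f v]
      no_P5[of d c v e f] no_P5[of d c v f e] no_K3_K2[of e f v c d] no_B1[of x c v e f d]
      no_B2[of x e f v c d] no_B2[of x f e v c d] no_B3[of x e f c d v]
    by (simp (no_asm_use) only: base simp_thms True_implies_equals) (atomize, argo)
qed

text \<open>Here one clique vertex lies on each side. As in \<open>kite_trace\<close>, forbidden
  instances reduce the claim to propositional logic. The surviving nonempty traces omit at most one
  of \<open>s\<close> and \<open>t\<close>, so they fit a vertex complete to the bipod or a new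
  clique vertex.\<close>

lemma bipod_trace_cross:
  assumes p: "y \<sim> s" "y \<sim> a" "y \<sim> b" "z \<sim> t" "z \<sim> a" "z \<sim> b" "s \<sim> a" "t \<sim> b" "a \<sim> b"
    and n: "\<not> y \<sim> z" "\<not> y \<sim> t" "\<not> z \<sim> s" "\<not> s \<sim> t" "\<not> s \<sim> b" "\<not> t \<sim> a"
    and d: "v \<notin> {y, z, s, t, a, b}" "y \<noteq> z"
  shows "\<not> v \<sim> y \<and> \<not> v \<sim> z \<and> \<not> v \<sim> s \<and> \<not> v \<sim> t \<and> \<not> v \<sim> a \<and>
    \<not> v \<sim> b \<or>
    v \<sim> y \<and> v \<sim> z \<and> (v \<sim> s \<or> v \<sim> t) \<and> v \<sim> a \<and> v \<sim> b"
proof -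
  have c: "u \<sim> v \<longleftrightarrow> v \<sim> u" for u by (rule adj_commute)
  have d': "y \<noteq> t" "z \<noteq> s" "s \<noteq> t" "s \<noteq> b" "t \<noteq> a" using p n by (auto simp: adj_commute)
  have d'': "v \<noteq> y" "v \<noteq> z" "v \<noteq> s" "v \<noteq> t" "v \<noteq> a" "v \<noteq> b" using d by auto
  note base = p n p[THEN adj_symD] n[THEN not_adj_symD] c d' d'[symmetric] d'' d''[symmetric] d(2) d(2)[symmetric]
  show ?thesis
    using no_C4[of y s v b] no_C4[of y a z v] no_C5[of y a z t v] no_P5[of t z a y v]
      no_P5[of t b y s v] no_K3_K2[of y s a t v] no_C4[of z t v a] no_C4[of y b z v]
      no_C5[of y s v t b] no_P5[of s y b z v] no_K3_K2[of y s v z t] no_B2[of a y s v z t]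
      no_B2[of b z t v y s] no_P5[of s y v z t] no_K3_K2[of z t v y s] no_R2[of s a v b t z]
      no_R2[of t b v a s y] no_S2[of s a t z b v]
    by (simp (no_asm_use) only: base simp_thms True_implies_equals) (atomize, argo)
qed

text \<open>With \<open>a\<close> and \<open>b\<close> both on the \<open>P\<close> side, exchanging
  \<open>y\<close> and \<open>s\<close> is a symmetry of the configuration. It turns the trace that
  omits only \<open>s\<close> into the additional trace that omits only \<open>y\<close>.\<close>

lemma bipod_trace_same:
  assumes p: "y \<sim> s" "y \<sim> a" "y \<sim> b" "z \<sim> t" "z \<sim> a" "z \<sim> b" "s \<sim> a" "s \<sim> b" "a \<sim> b"
    and n: "\<not> y \<sim> z" "\<not> y \<sim> t" "\<not> z \<sim> s" "\<not> s \<sim> t" "\<not> t \<sim> a" "\<not> t \<sim> b"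
    and d: "v \<notin> {y, z, s, t, a, b}" "y \<noteq> z"
  shows "\<not> v \<sim> y \<and> \<not> v \<sim> z \<and> \<not> v \<sim> s \<and> \<not> v \<sim> t \<and> \<not> v \<sim> a \<and>
    \<not> v \<sim> b \<or>
    v \<sim> z \<and> (v \<sim> y \<and> (v \<sim> s \<or> v \<sim> t) \<or> v \<sim> s \<and> v \<sim> t) \<and> v \<sim> a \<and>
      v \<sim> b"
proof -
  have c: "u \<sim> v \<longleftrightarrow> v \<sim> u" for u by (rule adj_commute)
  have d': "y \<noteq> t" "z \<noteq> s" "s \<noteq> t" "t \<noteq> a" "t \<noteq> b" using p n by (auto simp: adj_commute)
  have d'': "v \<noteq> y" "v \<noteq> z" "v \<noteq> s" "v \<noteq> t" "v \<noteq> a" "v \<noteq> b" using d by auto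
  note base = p n p[THEN adj_symD] n[THEN not_adj_symD] c d' d'[symmetric] d'' d''[symmetric] d(2) d(2)[symmetric]
  show ?thesis
    using no_C4[of y a z v] no_C4[of z t v a] no_C4[of z b s v] no_P5[of t z a y v]
      no_K3_K2[of z t v y s] no_P5[of t z b s v] no_C4[of y b z v] no_C4[of z a s v]
      no_C5[of y a z t v] no_P5[of y a z t v] no_B1[of a z v y s t] no_B2[of a y s v z t]
      no_B3[of a y s z t v] no_P5[of y s v z t] no_P5[of s y v z t] no_K3_K2[of y s v z t]
      no_R2[of t z v b y a] no_R2[of t z v a y b] no_S1[of t z y a b v]
    by (simp (no_asm_use) only: base simp_thms True_implies_equals) (atomize, argo)
qed

lemma bipod_trace:
  assumes B: "bipod G y z s t P Q" and ab: "a \<in> P \<union> Q" "b \<in> P \<union> Q" "a \<noteq> b"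
    and v: "v \<notin> {y, z, s, t} \<union> P \<union> Q"
  shows "\<not> v \<sim> y \<and> \<not> v \<sim> z \<and> \<not> v \<sim> s \<and> \<not> v \<sim> t \<and> \<not> v \<sim> a \<and>
    \<not> v \<sim> b \<or>
    v \<sim> a \<and> v \<sim> b \<and> (v \<sim> y \<and> v \<sim> z \<and> (v \<sim> s \<or> v \<sim> t) \<or>
      \<not> v \<sim> y \<and> v \<sim> z \<and> v \<sim> s \<and> v \<sim> t \<and> a \<in> P \<and> b \<in> P \<or>
      v \<sim> y \<and> \<not> v \<sim> z \<and> v \<sim> s \<and> v \<sim> t \<and> a \<in> Q \<and> b \<in> Q)"
proof -
  have same: "\<not> v \<sim> y \<and> \<not> v \<sim> z \<and> \<not> v \<sim> s \<and> \<not> v \<sim> t \<and> \<not> v \<sim> a \<and>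
    \<not> v \<sim> b \<or>
    v \<sim> z \<and> (v \<sim> y \<and> (v \<sim> s \<or> v \<sim> t) \<or> v \<sim> s \<and> v \<sim> t) \<and> v \<sim> a \<and>
      v \<sim> b"
    if "bipod G y z s t P Q" "a \<in> P" "b \<in> P" "a \<noteq> b" "v \<notin> {y, z, s, t} \<union> P \<union> Q"
      for y z s t P Q a b
    using that by (intro bipod_trace_same) (auto simp: bipod_def)
  have cross: "\<not> v \<sim> y \<and> \<not> v \<sim> z \<and> \<not> v \<sim> s \<and> \<not> v \<sim> t \<and>
    \<not> v \<sim> a \<and> \<not> v \<sim> b \<or>
    v \<sim> y \<and> v \<sim> z \<and> (v \<sim> s \<or> v \<sim> t) \<and> v \<sim> a \<and> v \<sim> b"
    if "a \<in> P" "b \<in> Q" "a \<noteq> b" for a b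
    using that B v by (intro bipod_trace_cross) (auto simp: bipod_def)
  have v': "v \<notin> {z, y, t, s} \<union> Q \<union> P" using v by auto
  consider "a \<in> P" "b \<in> P" | "a \<in> P" "b \<in> Q" | "a \<in> Q" "b \<in> P" | "a \<in> Q" "b \<in> Q" using ab by blast
  then show ?thesis
  proof cases
    case 1 then show ?thesis using same[OF B _ _ ab(3) v] by argo
  next
    case 2 then show ?thesis using cross[OF _ _ ab(3)] by argo
  next
    case 3 then show ?thesis using cross[of b a] ab(3) by argo
  next
    case 4 then show ?thesis using same[OF bipod_sym[OF B] _ _ ab(3) v'] by argo
  qed
qed

text \<open>Two clique vertices make the traces rigid enough. A vertex that is neither complete nor
  anticomplete misses exactly one of the four ends and becomes a clique vertex of a larger bipod,
  possibly after a change of roles.\<close>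

lemma bipod_outside:
  assumes B: "bipod G y z s t P Q" and ab: "a \<in> P \<union> Q" "b \<in> P \<union> Q" "a \<noteq> b"
    and v: "v \<notin> {y, z, s, t} \<union> P \<union> Q"
  shows "(\<forall>u\<in>{y, z, s, t} \<union> P \<union> Q. v \<sim> u) \<or> (\<forall>u\<in>{y, z, s, t} \<union> P
    \<union> Q. \<not> v \<sim> u) \<or>
    (\<exists>y' z' s' t' P' Q'. bipod G y' z' s' t' P' Q' \<and>
      P \<union> Q \<subseteq> P' \<union> Q' \<and> {y', z', s', t'} \<union> P' \<union> Q' = insert v ({y, z, s, t} \<union> P
        \<union> Q))"
proof -
  have tr: "\<not> v \<sim> y \<and> \<not> v \<sim> z \<and> \<not> v \<sim> s \<and> \<not> v \<sim> t \<and>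
    \<not> v \<sim> u \<or>
    v \<sim> u \<and> (v \<sim> y \<and> v \<sim> z \<and> (v \<sim> s \<or> v \<sim> t) \<or>
      \<not> v \<sim> y \<and> v \<sim> z \<and> v \<sim> s \<and> v \<sim> t \<and> u \<in> P \<or>
      v \<sim> y \<and> \<not> v \<sim> z \<and> v \<sim> s \<and> v \<sim> t \<and> u \<in> Q)" if "u \<in> P \<union> Q" for u
  proof (cases "u = a")
    case True
    then show ?thesis using bipod_trace[OF B ab v] by blast
  next
    case False
    then show ?thesis using bipod_trace[OF B that ab(1) _ v] by argo
  qed
  have v': "v \<noteq> y" "v \<noteq> z" "v \<noteq> s" "v \<noteq> t" "v \<notin> P" "v \<notin> Q" using v by auto
  consider "\<not> v \<sim> y" "\<not> v \<sim> z" "\<not> v \<sim> s" "\<not> v \<sim> t" | "v \<sim> y" "v \<sim> z" "v \<sim> s"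
    "v \<sim> t"
    | "v \<sim> y" "v \<sim> z" "v \<sim> s" "\<not> v \<sim> t" | "v \<sim> y" "v \<sim> z" "\<not> v \<sim> s" "v \<sim> t"
    | "\<not> v \<sim> y" "v \<sim> z" "v \<sim> s" "v \<sim> t" | "v \<sim> y" "\<not> v \<sim> z" "v \<sim> s" "v \<sim> t"
    using tr[OF ab(1)] by argo
  then show ?thesis
  proof cases
    case 1
    then have "\<not> v \<sim> u" if "u \<in> P \<union> Q" for u using tr[OF that] by argo
    then show ?thesis using 1 by simp
  next
    case 2
    then have "v \<sim> u" if "u \<in> P \<union> Q" for u using tr[OF that] by argo
    then show ?thesis using 2 by simp
  next
    case 3
    then have "v \<sim> u" if "u \<in> P \<union> Q" for u using tr[OF that] by argo
    then have "bipod G y z s t (insert v P) Q" using B 3 v' by (intro bipod_insert)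
    then show ?thesis
      by (intro disjI2 exI[of _ y] exI[of _ z] exI[of _ s] exI[of _ t] exI[of _ "insert v P"] exI[of _ Q]) auto
  next
    case 4
    then have "v \<sim> u" if "u \<in> P \<union> Q" for u using tr[OF that] by argo
    then have "bipod G y z s t P (insert v Q)"
      by (intro bipod_sym[OF bipod_insert[OF bipod_sym[OF B]]]) (use 4 v' in auto)
    then show ?thesis
      by (intro disjI2 exI[of _ y] exI[of _ z] exI[of _ s] exI[of _ t] exI[of _ P] exI[of _ "insert v Q"]) auto
  next
    case 5
    then have *: "v \<sim> u \<and> u \<in> P" if "u \<in> P \<union> Q" for u using tr[OF that] by argo
    \<comment> \<open>With \<open>Q\<close> empty, \<open>y\<close> and \<open>s\<close> have the
      same neighbours in the clique and may exchange roles. Afterwards \<open>v\<close> misses the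
      new \<open>s\<close> and fills the empty side.\<close>
    then have "Q = {}" using bipod_disjoint[OF B] by blast
    then have "bipod G s z y t P {}" using B unfolding bipod_def by (auto simp: adj_commute)
    then have "bipod G s z y t P {v}"
      by (intro bipod_sym[OF bipod_insert[OF bipod_sym]]) (use * 5 v' in auto)
    then show ?thesis using \<open>Q = {}\<close>
      by (intro disjI2 exI[of _ s] exI[of _ z] exI[of _ y] exI[of _ t] exI[of _ P] exI[of _ "{v}"]) auto
  next
    case 6
    then have *: "v \<sim> u \<and> u \<in> Q" if "u \<in> P \<union> Q" for u using tr[OF that] by argo
    then have "P = {}" using bipod_disjoint[OF B] by blast
    then have "bipod G y t s z {} Q" using B unfolding bipod_def by (auto simp: adj_commute)
    then have "bipod G y t s z {v} Q" using * 6 v' by (intro bipod_insert) auto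
    then show ?thesis using \<open>P = {}\<close>
      by (intro disjI2 exI[of _ y] exI[of _ t] exI[of _ s] exI[of _ z] exI[of _ "{v}"] exI[of _ Q]) auto
  qed
qed

text \<open>Of the six traces of \<open>kite_trace\<close>, those omitting one of \<open>d\<close>,
  \<open>e\<close>, \<open>f\<close> would create a bipod with clique vertices \<open>x\<close> and
  \<open>v\<close>. What remains is none, all, or the centre alone; in the last case
  \<open>v\<close> is absorbed as a new pendant vertex or as half of a new triangle.\<close>

lemma windmill_outside:
  assumes W: "windmill G x c d L R"
    and nb: "\<And>y z s t P Q a b. bipod G y z s t P Q \<Longrightarrow> a \<in> P \<union> Q \<Longrightarrow> b \<in> P
      \<union> Q \<Longrightarrow> a = b"
    and v: "v \<notin> {x, c, d} \<union> L \<union> R"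
  shows "(\<forall>u\<in>{x, c, d} \<union> L \<union> R. v \<sim> u) \<or> (\<forall>u\<in>{x, c, d} \<union> L
    \<union> R. \<not> v \<sim> u) \<or>
    (\<exists>L' R'. windmill G x c d L' R' \<and> L' \<union> R' = insert v (L \<union> R))"
proof -
  note w = windmillD(1-8)[OF W] and u = windmillD(9-11)[OF W] and l = windmillD(12)[OF W]
  have v': "v \<noteq> x" "v \<noteq> c" "v \<noteq> d" "v \<notin> L" "v \<notin> R" using v by auto
  have excl: "\<not> (v \<sim> c \<and> v \<sim> e \<and> v \<sim> d \<and> \<not> v \<sim> f)" "\<not> (v \<sim> c \<and>
    v \<sim> e \<and> v \<sim> f \<and> \<not> v \<sim> d)"
    if ef: "e \<in> R" "f \<in> R" "e \<sim> f" "v \<sim> x" for e f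
  proof -
    note p = w(3,4) ef(3,4) u(1)[of e] u(1)[of f]
    note n = w(5) u(2)[of e] u(2)[of f] u(3)[of e] u(3)[of f]
    have ne: "e \<noteq> f" "c \<noteq> d" "e \<noteq> x" "f \<noteq> x" using p ef irrefl by auto
    \<comment> \<open>The edges \<open>ef\<close> and \<open>cd\<close> form the
      \<open>2K\<^sub>2\<close>; \<open>x\<close> misses only \<open>d\<close>, and \<open>v\<close>
      misses only \<open>f\<close>.\<close>
    have "bipod G e c f d {x} {v}" if "v \<sim> c" "v \<sim> e" "v \<sim> d" "\<not> v \<sim> f"
      unfolding bipod_def
      using p p[THEN adj_symD] n n[THEN not_adj_symD] that that(1-3)[THEN adj_symD]
        that(4)[THEN not_adj_symD] ef w(6,8) v' ne by auto
    then show "\<not> (v \<sim> c \<and> v \<sim> e \<and> v \<sim> d \<and> \<not> v \<sim> f)"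
      using nb[of e c f d "{x}" "{v}" x v] v'(1) by auto
    have "bipod G e c f d {x, v} {}" if "v \<sim> c" "v \<sim> e" "v \<sim> f" "\<not> v \<sim> d"
      unfolding bipod_def
      using p p[THEN adj_symD] n n[THEN not_adj_symD] that that(1-3)[THEN adj_symD]
        that(4)[THEN not_adj_symD] ef w(6,8) v' ne by auto
    then show "\<not> (v \<sim> c \<and> v \<sim> e \<and> v \<sim> f \<and> \<not> v \<sim> d)"
      using nb[of e c f d "{x, v}" "{}" x v] v'(1) by auto
  qed
  have tr: "\<not> v \<sim> x \<and> \<not> v \<sim> c \<and> \<not> v \<sim> d \<and> \<not> v \<sim> e \<or> v \<sim> x \<and>
    v \<sim> c \<and> v \<sim> d \<and> v \<sim> e \<or>
      v \<sim> x \<and> \<not> v \<sim> c \<and> \<not> v \<sim> d \<and> \<not> v \<sim> e" if e: "e \<in> R" for e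
  proof -
    obtain f where f: "f \<in> R" "e \<sim> f" using matchedE[OF w(2) e] by blast
    have "v \<notin> {x, c, d, e, f}" using v' e f by auto
    moreover have "e \<in> L \<union> R" "f \<in> L \<union> R" using e f by auto
    ultimately have "\<not> v \<sim> c \<and> \<not> v \<sim> d \<and> \<not> v \<sim> e \<and> \<not> v \<sim> f \<or>
      v \<sim> x \<and> (v \<sim> c \<and> v \<sim> d \<and> (v \<sim> e \<or> v \<sim> f) \<or> v \<sim> c \<and> v \<sim> e \<and>
        v \<sim> f)"
      using kite_trace[OF w(3) u(1) u(1) w(4) f(2) w(5) u(2) u(2) u(3) u(3)] by blast
    then show ?thesis
      using excl[OF e f] excl[OF f(1) e adj_symD[OF f(2)]] by (atomize, argo)
  qed
  obtain e where e: "e \<in> R" using w(1) by blast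
  consider "\<not> v \<sim> x" "\<not> v \<sim> c" "\<not> v \<sim> d" "\<not> v \<sim> e" | "v \<sim> x" "v \<sim> c" "v \<sim> d"
    "v \<sim> e"
    | "v \<sim> x" "\<not> v \<sim> c" "\<not> v \<sim> d" "\<not> v \<sim> e" using tr[OF e] by argo
  then show ?thesis
  proof cases
    case 1
    then have "\<not> v \<sim> r" if "r \<in> R" for r using tr[OF that] by argo
    \<comment> \<open>If \<open>v\<close> were adjacent to \<open>k\<close>, then \<open>d\<close>,
      \<open>c\<close>, \<open>x\<close>, \<open>k\<close>, \<open>v\<close> would induce a path on
      five vertices.\<close>
    moreover have "\<not> v \<sim> k" if k: "k \<in> L" for k
      using no_P5[of d c x k v] 1 w(3-5) u[of k] k by (auto simp: adj_commute)
    ultimately show ?thesis using 1 by auto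
  next
    case 2
    then have "v \<sim> r" if "r \<in> R" for r using tr[OF that] by argo
    \<comment> \<open>A missed \<open>k\<close> would hang at the triangle \<open>x\<close>,
      \<open>c\<close>, \<open>v\<close> together with \<open>d\<close> and \<open>e\<close>, a copy
      of \<open>S2\<close>.\<close>
    moreover have "v \<sim> k" if k: "k \<in> L" for k
      using no_S2[of k x d c v e] 2 w(3-5) u[of k] u[of e] l[of k e] k e by (auto simp: adj_commute)
    ultimately show ?thesis using 2 by auto
  next
    case 3
    then have r: "\<not> v \<sim> r" if "r \<in> R" for r using tr[OF that] by argo
    show ?thesis
    proof (cases "\<exists>k\<in>L. v \<sim> k")
      case False
      have "windmill G x c d (insert v L) R"
        unfolding windmill_def
        using w u l 3 v' False r irrefl[of v] by (auto simp: adj_commute)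
      then show ?thesis by (intro disjI2 exI[of _ "insert v L"] exI[of _ R]) auto
    next
      case True
      then obtain k where k: "k \<in> L" "v \<sim> k" by blast
      \<comment> \<open>Two pendant neighbours of \<open>v\<close> would give two triangles on the
        edge \<open>xv\<close> besides the pendant path, a copy of \<open>B2\<close>. Hence
        \<open>v\<close> and \<open>k\<close> form one new triangle with \<open>x\<close>, and
        \<open>k\<close> moves from \<open>L\<close> to \<open>R\<close>.\<close>
      have uniq: "j = k" if "j \<in> L" "v \<sim> j" for j
        using no_B2[of x v j k c d] 3 k that w(3-5) u[of j] u[of k] l[of j k]
        by (auto simp: adj_commute)
      have "matched G (R \<union> {v, k})"
        using w(2) matched_pair[OF simple k(2)] r l[OF k(1)]
        by (intro matched_Un) (auto simp: adj_commute)
      moreover have "k \<notin> R" using w(7) k by auto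
      moreover have "\<not> v \<sim> j" "\<not> j \<sim> v" if "j \<in> L - {k}" for j using uniq[of j] that
        by (auto simp: adj_commute)
      ultimately have "windmill G x c d (L - {k}) (R \<union> {v, k})"
        unfolding windmill_def
        using w u u[of k] l 3 v' k by (auto simp: adj_commute)
      then show ?thesis using k by (intro disjI2 exI[of _ "L - {k}"] exI[of _ "R \<union> {v, k}"]) auto
    qed
  qed
qed

text \<open>Without windmills a vertex sees all of an induced \<open>2K\<^sub>2\<close> or at most
  one of its vertices: three neighbours give a windmill centred at \<open>v\<close>, two on one edge
  give a triangle plus an edge, and two on different edges give a path on five vertices.\<close>

lemma two_K2_trace:
  assumes p: "a \<sim> b" "c \<sim> d" and n: "\<not> a \<sim> c" "\<not> a \<sim> d" "\<not> b \<sim> c" "\<not> b \<sim> d"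
    and v: "v \<notin> {a, b, c, d}"
    and nw: "\<And>x c d L R. \<not> windmill G x c d L R"
  shows "v \<sim> a \<and> v \<sim> b \<and> v \<sim> c \<and> v \<sim> d \<or> \<not> v \<sim> a \<and> \<not> v \<sim> b \<and>
    \<not> v \<sim> c \<or>
    \<not> v \<sim> a \<and> \<not> v \<sim> b \<and> \<not> v \<sim> d \<or> \<not> v \<sim> a \<and> \<not> v \<sim> c \<and>
      \<not> v \<sim> d \<or> \<not> v \<sim> b \<and> \<not> v \<sim> c \<and> \<not> v \<sim> d"
proof -
  have w: "\<not> (v \<sim> a \<and> v \<sim> b \<and> v \<sim> c \<and> \<not> v \<sim> d)"
    if p: "a \<sim> b" "c \<sim> d" and n: "\<not> a \<sim> c" "\<not> a \<sim> d" "\<not> b \<sim> c" "\<not> b \<sim> d"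
      and v: "v \<notin> {a, b, c, d}" for a b c d
  proof
    assume a: "v \<sim> a \<and> v \<sim> b \<and> v \<sim> c \<and> \<not> v \<sim> d"
    have "c \<noteq> a" "c \<noteq> b" "d \<noteq> a" "d \<noteq> b" using p n by (auto simp: adj_commute)
    then have "windmill G v c d {} {a, b}"
      unfolding windmill_def using matched_pair[OF simple p(1)] a p n v by (auto simp: adj_commute)
    then show False using nw by blast
  qed
  have c: "u \<sim> v \<longleftrightarrow> v \<sim> u" for u by (rule adj_commute)
  have "\<not> (v \<sim> a \<and> v \<sim> b \<and> v \<sim> c \<and> \<not> v \<sim> d)" "\<not> (v \<sim> a \<and> v \<sim> b \<and>
    v \<sim> d \<and> \<not> v \<sim> c)"
    "\<not> (v \<sim> c \<and> v \<sim> d \<and> v \<sim> a \<and> \<not> v \<sim> b)" "\<not> (v \<sim> c \<and> v \<sim> d \<and>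
      v \<sim> b \<and> \<not> v \<sim> a)"
    by (rule w; use p n v in \<open>auto simp: adj_commute\<close>)+
  then show ?thesis
    using no_K3_K2[of a b v c d] no_K3_K2[of c d v a b] no_P5[of a b v c d] no_P5[of a b v d c]
      no_P5[of b a v c d] no_P5[of b a v d c]
    by (simp (no_asm_use) only: p n p[THEN adj_symD] n[THEN not_adj_symD] c simp_thms True_implies_equals)
      (atomize, argo)
qed

text \<open>Every leaf edge together with every edge of \<open>R\<close> is an induced
  \<open>2K\<^sub>2\<close>, so \<open>two_K2_trace\<close> applies throughout. The cases differ in
  where the single core neighbour of \<open>v\<close> lies.\<close>

lemma star_matching_outside:
  assumes S: "star_matching G s L R"
    and nw: "\<And>x c d L R. \<not> windmill G x c d L R"
    and v: "v \<notin> {s} \<union> L \<union> R"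
  shows "(\<forall>u\<in>{s} \<union> L \<union> R. v \<sim> u) \<or> (\<forall>u\<in>{s} \<union> L
    \<union> R. \<not> v \<sim> u) \<or>
    (\<exists>s' L' R'. star_matching G s' L' R' \<and> {s'} \<union> L' \<union> R' = insert v ({s} \<union> L \<union> R))"
proof -
  note S' = star_matchingD(1-5)[OF S] and sl = star_matchingD(6)[OF S]
    and sr = star_matchingD(7)[OF S] and lu = star_matchingD(8)[OF S]
  have sL: "s \<notin> L" using sl irrefl by blast
  have v': "v \<noteq> s" "v \<notin> L" "v \<notin> R" using v by auto
  obtain l0 where l0: "l0 \<in> L" using S'(1) by blast
  obtain e0 where e0: "e0 \<in> R" using S'(2) by blast
  have tr: "v \<sim> s \<and> v \<sim> l \<and> v \<sim> e \<and> v \<sim> f \<or> \<not> v \<sim> s \<and> \<not> v \<sim> l \<and>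
    \<not> v \<sim> e \<or>
      \<not> v \<sim> s \<and> \<not> v \<sim> l \<and> \<not> v \<sim> f \<or> \<not> v \<sim> s \<and> \<not> v \<sim> e \<and>
        \<not> v \<sim> f \<or> \<not> v \<sim> l \<and> \<not> v \<sim> e \<and> \<not> v \<sim> f"
    if "l \<in> L" "e \<in> R" "f \<in> R" "e \<sim> f" for l e f
  proof (rule two_K2_trace[OF sl[OF that(1)] that(4) _ _ _ _ _ nw])
    show "v \<notin> {s, l, e, f}" using v' that by auto
  qed (use that sr lu in auto)
  have ex: "\<exists>f\<in>R. e \<sim> f" if "e \<in> R" for e using matchedE[OF S'(3) that] by blast
  have tr': "v \<sim> s \<and> v \<sim> l \<and> v \<sim> e \<or> \<not> v \<sim> s \<and> \<not> v \<sim> l \<or>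
    \<not> v \<sim> s \<and> \<not> v \<sim> e \<or> \<not> v \<sim> l \<and> \<not> v \<sim> e"
    if le: "l \<in> L" "e \<in> R" for l e
  proof -
    obtain f where "f \<in> R" "e \<sim> f" using ex[OF le(2)] by blast
    then show ?thesis using tr[OF le, of f] by argo
  qed
  consider (all) "v \<sim> s" "v \<sim> l0" | (centre) "v \<sim> s" "\<not> v \<sim> l0"
    | (leaf) l where "\<not> v \<sim> s" "l \<in> L" "v \<sim> l" | (edge) e where "\<not> v \<sim> s" "e \<in> R" "v \<sim> e"
    | (none) "\<not> v \<sim> s" "\<And>l. l \<in> L \<Longrightarrow> \<not> v \<sim> l" "\<And>e. e \<in> R
      \<Longrightarrow> \<not> v \<sim> e"
    by blast
  then show ?thesis
  proof cases
    case all
    then have e: "v \<sim> e" if "e \<in> R" for e using tr'[OF l0 that] by argo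
    then have "v \<sim> l" if "l \<in> L" for l using tr'[OF that e0] e[OF e0] all by argo
    then show ?thesis using all e by auto
  next
    case centre
    then have e: "\<not> v \<sim> e" if "e \<in> R" for e using tr'[OF l0 that] by argo
    then have "\<not> v \<sim> l" if "l \<in> L" for l using tr'[OF that e0] e[OF e0] centre by argo
    then have "star_matching G s (insert v L) R"
      unfolding star_matching_def using S' sl sr lu centre e v' irrefl[of v] by (auto simp: adj_commute)
    then show ?thesis by (intro disjI2 exI[of _ s] exI[of _ "insert v L"] exI[of _ R]) auto
  next
    \<comment> \<open>A second leaf \<open>k\<close> would produce an induced 4-cycle or a path on
      four vertices beside an edge of \<open>R\<close>. So the star is the single edge
      \<open>sl\<close>, and it is recentred at \<open>l\<close> with leaves \<open>s\<close> and
      \<open>v\<close>.\<close>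
    case leaf
    then have e: "\<not> v \<sim> e" if "e \<in> R" for e using tr'[OF leaf(2) that] by argo
    have "k = l" if k: "k \<in> L" for k
    proof (rule ccontr)
      assume "k \<noteq> l"
      obtain f0 where f0: "f0 \<in> R" "e0 \<sim> f0" using ex[OF e0] by blast
      show False
        using no_C4[of s l v k] no_P4_K2[of v l s k e0 f0] sl[of l] sl[of k] sr[of e0] sr[of f0]
          lu[of l e0] lu[of l f0] lu[of k e0] lu[of k f0] lu[of l k]
          leaf k \<open>k \<noteq> l\<close> v' e0 f0 e[of e0] e[of f0] by (auto simp: adj_commute)
    qed
    then have L: "L = {l}" using leaf(2) by blast
    have "star_matching G l {s, v} R"
      unfolding star_matching_def using S' sl[of l] sr lu[of l] leaf e v' irrefl L
      by (auto simp: adj_commute)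
    then show ?thesis using L by (intro disjI2 exI[of _ l] exI[of _ "{s, v}"] exI[of _ R]) auto
  next
    \<comment> \<open>A second leaf would give a path through \<open>s\<close> disjoint from the
      path \<open>v\<close>, \<open>e\<close>, \<open>f\<close>, hence two copies of the path on
      three vertices. So the star is a single edge: it joins the matching, and \<open>e\<close>
      becomes the centre with leaves \<open>f\<close> and \<open>v\<close>.\<close>
    case edge
    have l: "\<not> v \<sim> l" if "l \<in> L" for l using tr'[OF that edge(2)] edge by argo
    obtain f where f: "f \<in> R" "e \<sim> f" "\<And>p. p \<in> R \<Longrightarrow> e \<sim> p \<Longrightarrow> p = f"
      using matchedE[OF S'(3) edge(2)] by blast
    have vf: "\<not> v \<sim> f" using tr[OF l0 edge(2) f(1,2)] edge by argo
    have ef: "e \<noteq> f" using f(2) irrefl by auto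
    have ne: "\<not> e \<sim> r" "\<not> f \<sim> r" "\<not> r \<sim> e" "\<not> r \<sim> f" if "r \<in> R - {e, f}" for r
    proof -
      show "\<not> e \<sim> r" "\<not> r \<sim> e" using f(3)[of r] that by (auto simp: adj_commute)
      show "\<not> f \<sim> r" "\<not> r \<sim> f"
        using matched_unique[OF S'(3) f(1) edge(2), of r] that adj_symD[OF f(2)] by (auto simp: adj_commute)
    qed
    have R': "matched G (R - {e, f})" using matched_remove[OF simple S'(3) edge(2) f(1,2)] .
    have r: "\<not> v \<sim> r" if r: "r \<in> R - {e, f}" for r
    proof -
      obtain q where q: "q \<in> R - {e, f}" "r \<sim> q" using matchedE[OF R' r] by blast
      have vn: "v \<notin> {e, f, r, q}" using v' edge(2) f(1) r q(1) by auto
      show ?thesis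
        using two_K2_trace[OF f(2) q(2) ne(1)[OF r] ne(1)[OF q(1)] ne(2)[OF r] ne(2)[OF q(1)] vn nw]
          edge vf by argo
    qed
    have "k = l0" if k: "k \<in> L" for k
    proof (rule ccontr)
      assume "k \<noteq> l0"
      then have "k \<sim> l0 \<or> k \<sim> v \<or> k \<sim> e \<or> k \<sim> f \<or> s \<sim> v \<or> s \<sim> e \<or>
        s \<sim> f \<or>
          l0 \<sim> v \<or> l0 \<sim> e \<or> l0 \<sim> f \<or> v \<sim> f"
        using no_P3_P3[of k s l0 v e f] adj_symD[OF sl[OF k]] sl[OF l0] edge(3) f(1,2) v' by auto
      then show False
        using lu[OF k] lu[OF l0] l[OF k] l[OF l0] sr edge f(1) vf k l0 by (auto simp: adj_commute)
    qed
    then have L: "L = {l0}" using l0 by blast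
    have "matched G ((R - {e, f}) \<union> {s, l0})"
      using R' matched_pair[OF simple sl[OF l0]] sr lu[OF l0]
      by (intro matched_Un) (auto simp: adj_commute)
    moreover have "\<not> e \<sim> s" "\<not> f \<sim> s" using sr edge(2) f(1) by (simp_all add: adj_commute[of _ _ s])
    moreover have "\<not> e \<sim> l0" "\<not> f \<sim> l0"
      using lu[OF l0] edge(2) f(1) by (simp_all add: adj_commute[of _ _ l0])
    moreover have "e \<sim> v" "\<not> f \<sim> v" using edge(3) vf by (simp_all add: adj_commute[of _ _ v])
    moreover have "e \<noteq> s" "f \<noteq> s" "e \<noteq> l0" "f \<noteq> l0" "l0 \<noteq> v" using S'(4,5) edge(2) f(1) l0 v'
      by auto
    ultimately have "star_matching G e {f, v} ((R - {e, f}) \<union> {s, l0})"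
      unfolding star_matching_def
      using f(2) edge(1) vf ne(1,2) r l[OF l0] v' irrefl by auto
    moreover have "{e} \<union> {f, v} \<union> ((R - {e, f}) \<union> {s, l0}) = insert v ({s} \<union> L \<union> R)"
      using L f(1) edge(2) by auto
    ultimately show ?thesis by (intro disjI2 exI conjI)
  next
    case none
    then show ?thesis by blast
  qed
qed

text \<open>Induced cycles of length at least 6 contain an induced path on five vertices; lengths 4
  and 5 are forbidden directly.\<close>

lemma chordal: "chordal G"
  unfolding chordal_def
proof (intro allI impI notI)
  fix n :: nat assume n: "4 \<le> n" and c: "contains_induced G (cycle_graph n)"
  consider "n = 4" | "n = 5" | "6 \<le> n" using n by linarith
  then show False
  proof cases
    case 3
    have "adj (path_graph 5) i j \<longleftrightarrow> adj (cycle_graph n) i j" if "i < 5" "j < 5" for i j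
      using 3 that by (auto simp: adj_path_graph adj_cycle_graph mod_Suc)
    then have "contains_induced (cycle_graph n) (path_graph 5)"
      unfolding contains_induced_iff using 3 by (intro exI[of _ id]) auto
    then show False using contains_induced_trans[OF c] free_P5 by blast
  qed (use c free_C4 free_C5 in simp_all)
qed

end

section \<open>Cores are determined by their degrees\<close>

text \<open>Stated for vertex sets inside fixed graphs, so that maps on disjoint parts can be glued
  once the cross adjacencies agree.\<close>

definition iso_on :: "'a graph \<Rightarrow> 'b graph \<Rightarrow> ('a \<Rightarrow> 'b) \<Rightarrow> 'a set \<Rightarrow> 'b set \<Rightarrow> bool" where
  "iso_on G H f A B \<longleftrightarrow> bij_betw f A B \<and> (\<forall>x\<in>A. \<forall>y\<in>A. adj G x y
    \<longleftrightarrow> adj H (f x) (f y))"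

lemma iso_on_glue:
  assumes f: "iso_on G H f A A'" and g: "iso_on G H g B B'" and d: "A \<inter> B = {}" "A' \<inter> B' = {}"
    and cross: "\<And>x y. x \<in> A \<Longrightarrow> y \<in> B \<Longrightarrow> adj G x y
      \<longleftrightarrow> adj H (f x) (g y)"
  shows "iso_on G H (\<lambda>x. if x \<in> A then f x else g x) (A \<union> B) (A' \<union> B')"
proof -
  have "bij_betw (\<lambda>x. if x \<in> A then f x else g x) (A \<union> B) (A' \<union> B')"
    using bij_betw_disjoint_Un[of f A A' g B B'] f g d by (simp add: iso_on_def)
  moreover have "adj G y x \<longleftrightarrow> adj H (g y) (f x)" if "x \<in> A" "y \<in> B" for x y
    using cross[OF that] by (simp add: adj_commute)
  ultimately show ?thesis using f g d cross by (auto simp: iso_on_def)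
qed

lemma iso_on_stable:
  assumes "finite A" "finite B" "card A = card B"
    and "\<And>x y. x \<in> A \<Longrightarrow> y \<in> A \<Longrightarrow> \<not> adj G x y" "\<And>x y. x \<in> B
      \<Longrightarrow> y \<in> B \<Longrightarrow> \<not> adj H x y"
  obtains f where "iso_on G H f A B"
proof -
  obtain f where f: "bij_betw f A B" using finite_same_card_bij[OF assms(1-3)] by blast
  then have "iso_on G H f A B" using assms(4,5) by (auto simp: iso_on_def bij_betw_def)
  then show ?thesis using that by blast
qed

lemma iso_on_clique:
  assumes "finite A" "finite B" "card A = card B" "simple_graph G" "simple_graph H"
    and "\<And>x y. x \<in> A \<Longrightarrow> y \<in> A \<Longrightarrow> x \<noteq> y \<Longrightarrow> adj G x y"
    and "\<And>x y. x \<in> B \<Longrightarrow> y \<in> B \<Longrightarrow> x \<noteq> y \<Longrightarrow> adj H x y"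
  obtains f where "iso_on G H f A B"
proof -
  obtain f where f: "bij_betw f A B" using finite_same_card_bij[OF assms(1-3)] by blast
  have "adj G x y \<longleftrightarrow> adj H (f x) (f y)" if "x \<in> A" "y \<in> A" for x y
  proof (cases "x = y")
    case False
    then have "f x \<noteq> f y" "f x \<in> B" "f y \<in> B" using f that by (auto simp: bij_betw_def inj_on_def)
    then show ?thesis using assms(6,7) that False by auto
  qed (use adj_irrefl[OF assms(4)] adj_irrefl[OF assms(5)] in auto)
  then show ?thesis using that f by (auto simp: iso_on_def)
qed

text \<open>Peel off one matching edge on each side and glue; no adjacency crosses between the
  removed edge and the rest.\<close>

lemma matched_iso:
  assumes "simple_graph G" "simple_graph H" "finite R" "finite S" "card R = card S" "matched G R" "matched H S"
  shows "\<exists>f. iso_on G H f R S"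
  using assms(3-7)
proof (induction "card R" arbitrary: R S rule: less_induct)
  case less
  show ?case
  proof (cases "R = {}")
    case True
    then have "S = {}" using less.prems by auto
    then show ?thesis using True by (auto simp: iso_on_def bij_betw_def)
  next
    case False
    then obtain a where a: "a \<in> R" by blast
    obtain b where b: "b \<in> R" "adj G a b" "\<And>p. p \<in> R \<Longrightarrow> adj G a p \<Longrightarrow> p = b"
      using matchedE[OF less.prems(4) a] by blast
    have "S \<noteq> {}" using less.prems False by auto
    then obtain c where c: "c \<in> S" by blast
    obtain d where d: "d \<in> S" "adj H c d" "\<And>p. p \<in> S \<Longrightarrow> adj H c p \<Longrightarrow> p = d"
      using matchedE[OF less.prems(5) c] by blast
    have ab: "a \<noteq> b" and cd: "c \<noteq> d" using b d adj_irrefl assms(1,2) by metis+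
    have "card (R - {a, b}) < card R" using less.prems(1) a by (intro psubset_card_mono) auto
    moreover have "card (R - {a, b}) = card (S - {c, d})"
      using less.prems(1-3) a b(1) c d(1) ab cd by (simp add: card_Diff_subset)
    ultimately obtain f where f: "iso_on G H f (R - {a, b}) (S - {c, d})"
      using less.hyps[of "R - {a, b}" "S - {c, d}"] less.prems(1,2)
        matched_remove[OF assms(1) less.prems(4) a b(1,2)] matched_remove[OF assms(2) less.prems(5) c d(1,2)]
      by auto
    let ?g = "\<lambda>x. if x = a then c else d"
    have g: "iso_on G H ?g {a, b} {c, d}"
      using ab cd b(2) d(2) adj_irrefl[OF assms(1)] adj_irrefl[OF assms(2)]
      by (auto simp: iso_on_def bij_betw_def adj_commute[of _ b a] adj_commute[of _ d c])
    have na: "\<not> adj G a y" "\<not> adj G b y" if "y \<in> R - {a, b}" for y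
      using b(3)[of y] matched_unique[OF less.prems(4) b(1) a, of y] adj_symD[OF b(2)] that by auto
    have nc: "\<not> adj H c y" "\<not> adj H d y" if "y \<in> S - {c, d}" for y
      using d(3)[of y] matched_unique[OF less.prems(5) d(1) c, of y] adj_symD[OF d(2)] that by auto
    have "f y \<in> S - {c, d}" if "y \<in> R - {a, b}" for y using f that by (auto simp: iso_on_def bij_betw_def)
    then have "iso_on G H (\<lambda>x. if x \<in> {a, b} then ?g x else f x)
        ({a, b} \<union> (R - {a, b})) ({c, d} \<union> (S - {c, d}))"
      by (intro iso_on_glue[OF g f]) (use na nc in auto)
    moreover have "{a, b} \<union> (R - {a, b}) = R" "{c, d} \<union> (S - {c, d}) = S" using a b(1) c d(1) by blast+
    ultimately show ?thesis by metis
  qed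
qed

lemma iso_on_induced:
  assumes "iso_on G H f C (verts H)"
  shows "H \<simeq> induced_subgraph G C"
  by (rule graph_iso_sym, rule graph_isoI[of f]) (use assms in \<open>auto simp: iso_on_def\<close>)

lemma degree_one_neighbour:
  assumes "simple_graph H" "degree H u = 1"
  obtains w where "adj H u w" "\<And>x. adj H u x \<Longrightarrow> x = w"
proof -
  obtain w where "{w \<in> verts H. adj H u w} = {w}"
    using assms by (auto simp: degree_eq_card card_1_singleton_iff)
  then show ?thesis using that[of w] adj_verts[OF assms(1)] by blast
qed

lemma degree_one_unique:
  "simple_graph H \<Longrightarrow> degree H u = 1 \<Longrightarrow> adj H u x \<Longrightarrow> adj H u y \<Longrightarrow> x = y"
  using degree_one_neighbour by metis

lemma degree_two_neighbours:
  assumes "simple_graph H" "degree H u = 2"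
  obtains a b where "adj H u a" "adj H u b" "a \<noteq> b" "\<And>x. adj H u x \<Longrightarrow> x = a \<or> x = b"
proof -
  obtain a b where "{w \<in> verts H. adj H u w} = {a, b}" "a \<noteq> b"
    using assms by (auto simp: degree_eq_card card_2_iff)
  then show ?thesis using that[of a b] adj_verts[OF assms(1)] by blast
qed

section \<open>Star matchings are determined by their degrees\<close>

lemma star_matching_iso:
  assumes "simple_graph G" "simple_graph H" "star_matching G s L R" "star_matching H s' L' R'"
    and fin: "finite L" "finite R" "finite L'" "finite R'" and card: "card L = card L'" "card R = card R'"
  obtains f where "iso_on G H f ({s} \<union> L \<union> R) ({s'} \<union> L' \<union> R')"
proof -
  obtain f where f: "iso_on G H f L L'"
    using iso_on_stable[OF fin(1,3) card(1)] assms(3,4) unfolding star_matching_def by (metis UnI1)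
  obtain g where g: "iso_on G H g R R'"
    using matched_iso[OF assms(1,2) fin(2,4) card(2)] assms(3,4) by (auto simp: star_matching_def)
  have im: "f l \<in> L'" "g r \<in> R'" if "l \<in> L" "r \<in> R" for l r
    using f g that by (auto simp: iso_on_def bij_betw_def)
  have s: "iso_on G H (\<lambda>_. s') {s} {s'}"
    using adj_irrefl[OF assms(1)] adj_irrefl[OF assms(2)] by (auto simp: iso_on_def bij_betw_def)
  have "iso_on G H (\<lambda>x. if x \<in> {s} then s' else f x) ({s} \<union> L) ({s'} \<union> L')"
    using assms(3,4) adj_irrefl[OF assms(1)] adj_irrefl[OF assms(2)] f
    by (intro iso_on_glue[OF s f]) (auto simp: star_matching_def iso_on_def bij_betw_def)
  from iso_on_glue[OF this g] show ?thesis
  proof (rule that)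
    show "({s} \<union> L) \<inter> R = {}" "({s'} \<union> L') \<inter> R' = {}" using assms(3,4) by (auto simp: star_matching_def)
    show "adj G x y \<longleftrightarrow> adj H (if x \<in> {s} then s' else f x) (g y)" if "x \<in> {s} \<union> L" "y \<in> R"
      for x y
      using that im[of x y] im[of _ y] assms(3,4) by (auto simp: star_matching_def)
  qed
qed

text \<open>All vertices except the centre have degree 1. In a competitor with
  \<open>s' = \<phi> s\<close>, each neighbour of \<open>s'\<close> has spent its only edge on
  \<open>s'\<close>, so the remaining vertices can only be matched among themselves.\<close>

lemma star_matching_unigraph:
  assumes G: "simple_graph G" and S: "star_matching G s L R" and C: "C = {s} \<union> L \<union> R" "C \<subseteq> verts G"
    and ch: "chordal (induced_subgraph G C)"
  shows "chordal_unigraph (induced_subgraph G C)"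
  unfolding chordal_unigraph_def
proof (intro conjI ch allI impI)
  fix H :: "nat graph"
  assume H: "simple_graph H \<and> chordal H \<and> degree_sequence H = degree_sequence (induced_subgraph G C)"
  let ?K = "induced_subgraph G C"
  have K: "simple_graph ?K" using simple_induced[OF G C(2)] .
  obtain \<phi> where \<phi>: "bij_betw \<phi> C (verts H)" "\<And>x. x \<in> C \<Longrightarrow> degree H (\<phi> x) = degree ?K x"
    using degree_sequence_bijE[of ?K H] H K by auto
  have fin: "finite L" "finite R" using C finite_verts[OF G] finite_subset by blast+
  note S' = star_matchingD(1-5)[OF S] and sl = star_matchingD(6)[OF S]
    and sr = star_matchingD(7)[OF S] and lu = star_matchingD(8)[OF S]
  have sL: "s \<notin> L" using sl adj_irrefl[OF G] by blast
  have deg: "degree ?K x = card {u \<in> C. adj G x u}" if "x \<in> C" for x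
    using degree_induced[OF G C(2) that] .
  have ds: "degree ?K s = card L"
  proof -
    have "{u \<in> C. adj G s u} = L" using C sl sr adj_irrefl[OF G] by auto
    then show ?thesis using deg C by simp
  qed
  have d1: "degree ?K u = 1" if u: "u \<in> C" "u \<noteq> s" for u
  proof (cases "u \<in> L")
    case True
    have "{w \<in> C. adj G u w} = {s}" using C lu[OF True] adj_symD[OF sl[OF True]] by auto
    then show ?thesis using deg u by simp
  next
    case False
    then have uR: "u \<in> R" using C u by auto
    obtain q where q: "q \<in> R" "adj G u q" "\<And>p. p \<in> R \<Longrightarrow> adj G u p \<Longrightarrow> p = q"
      using matchedE[OF S'(3) uR] by blast
    have "\<not> adj G u s" using sr[OF uR] by (simp add: adj_commute)
    moreover have "\<not> adj G u l" if "l \<in> L" for l using lu[OF that] uR by (auto simp: adj_commute[of _ u])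
    ultimately have "w \<in> R" if "w \<in> C" "adj G u w" for w using that C(1) by blast
    then have "{w \<in> C. adj G u w} = {q}" using C(1) q by blast
    then show ?thesis using deg u by simp
  qed
  define s' where "s' = \<phi> s"
  define L' where "L' = {u \<in> verts H. adj H s' u}"
  define R' where "R' = verts H - {s'} - L'"
  have hs: "s' \<in> verts H" using \<phi>(1) C by (auto simp: bij_betw_def s'_def)
  have hd: "degree H u = 1" if u: "u \<in> verts H" "u \<noteq> s'" for u
  proof -
    obtain x where "x \<in> C" "u = \<phi> x" using \<phi>(1) u by (auto simp: bij_betw_def)
    then show ?thesis using \<phi>(2) d1 u by (auto simp: s'_def)
  qed
  have irr: "\<not> adj H u u" for u using H adj_irrefl[of H u] by simp
  have finH: "finite (verts H)" using H finite_verts by blast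
  have L': "u \<in> L' \<longleftrightarrow> adj H s' u" for u using adj_verts(2)[of H s' u] H by (auto simp: L'_def)
  have R': "u \<in> R' \<longleftrightarrow> u \<in> verts H \<and> u \<noteq> s' \<and> \<not> adj H s' u" for u
    by (auto simp: R'_def L'_def)
  have V: "{s'} \<union> L' \<union> R' = verts H" using hs by (auto simp: L'_def R'_def)
  have finLR: "finite L'" "finite R'" using finH by (auto simp: L'_def R'_def)
  have disj: "s' \<notin> R'" "s' \<notin> L'" "L' \<inter> R' = {}" using irr by (auto simp: L'_def R'_def)
  have cL: "card L' = card L" using \<phi>(2)[of s] ds C H by (simp add: degree_eq_card L'_def s'_def)
  have cR: "card R' = card R"
  proof -
    have "card C = 1 + card L + card R"
      using C fin S'(4,5) sL by (simp add: card_Un_disjoint)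
    moreover have "card (verts H) = 1 + card L' + card R'"
      unfolding V[symmetric] using finLR disj by (simp add: card_Un_disjoint)
    ultimately show ?thesis using bij_betw_same_card[OF \<phi>(1)] cL by simp
  qed
  have lL: "x = s'" if "l \<in> L'" "adj H l x" for l x
  proof -
    have l: "adj H s' l" using that(1) L' by blast
    then have "l \<noteq> s'" "l \<in> verts H" using irr that(1) by (auto simp: L'_def)
    then show ?thesis using degree_one_unique[of H l x s'] hd[of l] that(2) H adj_symD[OF l] by simp
  qed
  have mR: "matched H R'"
    unfolding matched_def
  proof
    fix r assume r: "r \<in> R'"
    then obtain w where w: "adj H r w" "\<And>x. adj H r x \<Longrightarrow> x = w"
      using degree_one_neighbour[of H r] hd[of r] H R' by auto
    have "w \<in> verts H" using adj_verts(2)[of H r w] w(1) H by simp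
    moreover have "w \<noteq> s'" using r R' adj_symD[OF w(1)] by auto
    moreover have "w \<notin> L'" using lL[of w r] adj_symD[OF w(1)] r R' by auto
    ultimately have "w \<in> R'" using V by blast
    then show "\<exists>!q. q \<in> R' \<and> adj H r q" using w by blast
  qed
  have "L' \<noteq> {}" "R' \<noteq> {}" using cL cR S'(1,2) fin by auto
  moreover have "\<not> adj H l u" if "l \<in> L'" "u \<in> L' \<union> R'" for l u
    using lL[OF that(1), of u] that(2) disj by auto
  ultimately have "star_matching H s' L' R'"
    unfolding star_matching_def using mR disj L' R' by simp
  then obtain f where "iso_on G H f ({s} \<union> L \<union> R) ({s'} \<union> L' \<union> R')"
    using star_matching_iso[OF G _ S _ fin finLR cL[symmetric] cR[symmetric]] H by blast
  then show "H \<simeq> ?K" using iso_on_induced[of G H f C] V C(1) by simp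
qed

section \<open>Windmills are determined by their degrees\<close>

lemma windmill_iso:
  assumes "simple_graph G" "simple_graph H" "windmill G x c d L R" "windmill H x' c' d' L' R'"
    and fin: "finite L" "finite R" "finite L'" "finite R'" and card: "card L = card L'" "card R = card R'"
  obtains f where "iso_on G H f ({x, c, d} \<union> (L \<union> R)) ({x', c', d'} \<union> (L' \<union> R'))"
proof -
  note irr = adj_irrefl[OF assms(1)] adj_irrefl[OF assms(2)]
  obtain f where f: "iso_on G H f L L'"
    using iso_on_stable[OF fin(1,3) card(1)] assms(3,4) unfolding windmill_def by (metis UnI1)
  obtain g where g: "iso_on G H g R R'"
    using matched_iso[OF assms(1,2) fin(2,4) card(2)] assms(3,4) by (auto simp: windmill_def)
  have im: "l \<in> L \<Longrightarrow> f l \<in> L'" "r \<in> R \<Longrightarrow> g r \<in> R'" for l r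
    using f g by (auto simp: iso_on_def bij_betw_def)
  let ?h = "\<lambda>u. if u \<in> L then f u else g u"
  have h: "iso_on G H ?h (L \<union> R) (L' \<union> R')"
    using iso_on_glue[OF f g] assms(3,4) im by (auto simp: windmill_def)
  have imh: "?h u \<in> L' \<union> R'" if "u \<in> L \<union> R" for u using im that by auto
  let ?k = "\<lambda>u. if u = x then x' else if u = c then c' else d'"
  have ne: "x \<noteq> c" "c \<noteq> d" "x \<noteq> d" "x' \<noteq> c'" "c' \<noteq> d'" "x' \<noteq> d'"
    using assms(3,4) irr by (auto simp: windmill_def)
  have "adj G x c" "adj G c x" "adj G c d" "adj G d c" "\<not> adj G x d" "\<not> adj G d x"
    "adj H x' c'" "adj H c' x'" "adj H c' d'" "adj H d' c'" "\<not> adj H x' d'" "\<not> adj H d' x'"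
    using assms(3,4) by (auto simp: windmill_def adj_commute)
  then have k: "iso_on G H ?k {x, c, d} {x', c', d'}"
    using ne irr by (auto simp: iso_on_def bij_betw_def)
  show ?thesis
  proof (rule that, rule iso_on_glue[OF k h])
    have "x \<notin> L \<union> R" "x' \<notin> L' \<union> R'" using assms(3,4) irr by (auto simp: windmill_def)
    then show "{x, c, d} \<inter> (L \<union> R) = {}" "{x', c', d'} \<inter> (L' \<union> R') = {}"
      using assms(3,4) by (auto simp: windmill_def)
    show "adj G u v \<longleftrightarrow> adj H (?k u) (?h v)" if "u \<in> {x, c, d}" "v \<in> L \<union> R" for u v
    proof -
      have "adj G x v" "\<not> adj G c v" "\<not> adj G d v" using assms(3) that(2) by (simp_all add: windmill_def)
      moreover have "adj H x' w" "\<not> adj H c' w" "\<not> adj H d' w" if "w \<in> L' \<union> R'" for w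
        using assms(4) that by (simp_all add: windmill_def)
      ultimately show ?thesis using that(1) imh[OF that(2)] ne by auto
    qed
  qed
qed

text \<open>The image \<open>x'\<close> of the centre misses exactly one vertex \<open>d'\<close>,
  and all vertices but \<open>x'\<close> have degree 1 or 2. Absence of an induced 4-cycle gives
  \<open>d'\<close> degree 1; its neighbour is \<open>c'\<close>, and the other vertices are sorted
  by degree. The vertices \<open>c'\<close> and \<open>d'\<close> need not be images of
  \<open>c\<close> and \<open>d\<close>.\<close>

lemma windmill_unigraph:
  assumes G: "simple_graph G" and W: "windmill G x c d L R"
    and C: "C = {x, c, d} \<union> (L \<union> R)" "C \<subseteq> verts G" and ch: "chordal (induced_subgraph G C)"
  shows "chordal_unigraph (induced_subgraph G C)"
  unfolding chordal_unigraph_def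
proof (intro conjI ch allI impI)
  fix H :: "nat graph"
  let ?K = "induced_subgraph G C"
  assume asm: "simple_graph H \<and> chordal H \<and> degree_sequence H = degree_sequence ?K"
  then have H: "simple_graph H" and noC4: "\<not> contains_induced H (cycle_graph 4)"
    by (auto simp: chordal_def)
  have K: "simple_graph ?K" using simple_induced[OF G C(2)] .
  obtain \<phi> where \<phi>: "bij_betw \<phi> C (verts H)" "\<And>x. x \<in> C \<Longrightarrow> degree H (\<phi> x) = degree ?K x"
    using degree_sequence_bijE[of ?K H] asm K by auto
  have fin: "finite L" "finite R" using C finite_verts[OF G] finite_subset by blast+
  note w = windmillD(1-8)[OF W] and u = windmillD(9-11)[OF W] and l = windmillD(12)[OF W]
  note irr = adj_irrefl[OF G]
  have ne: "x \<noteq> c" "c \<noteq> d" "x \<notin> L \<union> R" using w(3,4) u(1) irr by auto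
  have deg: "degree ?K x = card {u \<in> C. adj G x u}" if "x \<in> C" for x
    using degree_induced[OF G C(2) that] .
  have dc: "degree ?K c = 2"
  proof -
    have "{v \<in> C. adj G c v} = {x, d}" using C w(3,4) u(2) irr by (auto simp: adj_commute)
    then show ?thesis using deg[of c] C w(6) by simp
  qed
  have dd: "degree ?K d = 1"
  proof -
    have "{v \<in> C. adj G d v} = {c}" using C w(4,5) u(3) irr by (auto simp: adj_commute)
    then show ?thesis using deg[of d] C by simp
  qed
  have dl: "degree ?K k = 1" if k: "k \<in> L" for k
  proof -
    have "adj G k x" "\<not> adj G k c" "\<not> adj G k d" using u[of k] k by (simp_all add: adj_commute)
    then have "{v \<in> C. adj G k v} = {x}" using C l[OF k] by auto
    then show ?thesis using deg[of k] C k by simp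
  qed
  have dr: "degree ?K r = 2" if r: "r \<in> R" for r
  proof -
    obtain q where q: "q \<in> R" "adj G r q" "\<And>p. p \<in> R \<Longrightarrow> adj G r p \<Longrightarrow> p = q"
      using matchedE[OF w(2) r] by blast
    have "adj G r x" "\<not> adj G r c" "\<not> adj G r d" using u[of r] r by (simp_all add: adj_commute)
    moreover have "\<not> adj G r k" if "k \<in> L" for k using l[OF that, of r] r by (simp add: adj_commute)
    ultimately have "v = x \<or> v \<in> R" if "v \<in> C" "adj G r v" for v using that C(1) by blast
    then have "{v \<in> C. adj G r v} = {x, q}" using C(1) q \<open>adj G r x\<close> by blast
    moreover have "x \<noteq> q" using q(1) ne(3) by auto
    ultimately show ?thesis using deg[of r] C r by simp
  qed
  have cC: "card C = 3 + card L + card R"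
  proof -
    have "card {x, c, d} = 3" using ne w(6) by simp
    then show ?thesis using C fin w(7,8) ne(3) by (subst C(1), subst card_Un_disjoint) (auto simp: card_Un_disjoint)
  qed
  have dx: "degree ?K x = 1 + card L + card R"
  proof -
    have "{v \<in> C. adj G x v} = insert c (L \<union> R)" using C w(3,5) u(1) irr by auto
    then show ?thesis using deg[of x] C w(7,8) fin by (simp add: card_Un_disjoint)
  qed
  obtain e where e: "e \<in> R" using w(1) by blast
  obtain f where f: "f \<in> R" "adj G e f" using matchedE[OF w(2) e] by blast
  \<comment> \<open>This gives the centre degree at least 3, which separates it from all other
    vertices when degree-1 vertices are counted.\<close>
  have cR2: "2 \<le> card R"
  proof -
    have "e \<noteq> f" using f irr by auto
    then show ?thesis using card_mono[of R "{e, f}"] e f fin by simp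
  qed
  note irH = adj_irrefl[OF H]
  have finH: "finite (verts H)" using finite_verts[OF H] .
  have cV: "card (verts H) = 3 + card L + card R" using bij_betw_same_card[OF \<phi>(1)] cC by simp
  define x' where "x' = \<phi> x"
  have x': "x' \<in> verts H" "degree H x' = 1 + card L + card R"
    using \<phi> C dx by (auto simp: x'_def bij_betw_def)
  have d12: "degree H v = 1 \<or> degree H v = 2" if v: "v \<in> verts H" "v \<noteq> x'" for v
  proof -
    obtain y where y: "y \<in> C" "v = \<phi> y" using \<phi>(1) v by (auto simp: bij_betw_def)
    then have "y \<noteq> x" using v by (auto simp: x'_def)
    then have "degree ?K y = 1 \<or> degree ?K y = 2" using y(1) C(1) dc dd dl dr by auto
    then show ?thesis using \<phi>(2) y by simp
  qed
  \<comment> \<open>The centre has degree \<open>card C - 2\<close>, which leaves one vertex besides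
    itself.\<close>
  have "card {v \<in> verts H. v \<noteq> x' \<and> \<not> adj H x' v} = 1"
  proof -
    have "{v \<in> verts H. v \<noteq> x' \<and> \<not> adj H x' v} = verts H - insert x' {v \<in> verts H. adj H x' v}" by auto
    moreover have "card (insert x' {v \<in> verts H. adj H x' v}) = 2 + card L + card R"
      using x' H irH finH by (simp add: degree_eq_card)
    ultimately show ?thesis using cV finH x'(1) by (simp add: card_Diff_subset)
  qed
  then obtain d' where "{v \<in> verts H. v \<noteq> x' \<and> \<not> adj H x' v} = {d'}" by (auto simp: card_1_singleton_iff)
  then have d': "d' \<in> verts H" "d' \<noteq> x'" "\<not> adj H x' d'"
    and xadj: "\<And>v. v \<in> verts H \<Longrightarrow> v \<noteq> x' \<Longrightarrow> v \<noteq> d'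
      \<Longrightarrow> adj H x' v" by blast+
  have two: "z \<in> {p, q}"
    if "degree H v = 1 \<or> degree H v = 2" "adj H v p" "adj H v q" "p \<noteq> q" "adj H v z" for v p q z
  proof (rule ccontr)
    assume "z \<notin> {p, q}"
    then have "card {p, q, z} = 3" using that(4) by auto
    moreover have "{p, q, z} \<subseteq> {w \<in> verts H. adj H v w}" using that adj_verts[OF H] by auto
    then have "card {p, q, z} \<le> degree H v"
      unfolding degree_eq_card[OF H] using finH by (intro card_mono) auto
    ultimately show False using that(1) by auto
  qed
  \<comment> \<open>If \<open>d'\<close> had two neighbours, both would also be adjacent to
    \<open>x'\<close> and thus have no further neighbour. Being nonadjacent, they would close an
    induced 4-cycle with \<open>x'\<close> and \<open>d'\<close>.\<close>
  have dd': "degree H d' = 1"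
  proof (rule ccontr)
    assume "degree H d' \<noteq> 1"
    then have "degree H d' = 2" using d12 d' by blast
    then obtain a b where ab: "adj H d' a" "adj H d' b" "a \<noteq> b" using degree_two_neighbours[OF H] by blast
    have nx: "a \<noteq> x'" "b \<noteq> x'" using ab d'(3) by (auto simp: adj_commute)
    have nd: "a \<noteq> d'" "b \<noteq> d'" using ab irH by auto
    have V: "a \<in> verts H" "b \<in> verts H" using ab adj_verts[OF H] by auto
    have x: "adj H x' a" "adj H x' b" using xadj V nx nd by auto
    have "\<not> adj H a b"
      using two[OF d12[OF V(1) nx(1)] adj_symD[OF x(1)] adj_symD[OF ab(1)], of b] d'(2) nx nd ab(3) by auto
    then show False
      using C4_chord[OF H noC4 x(1) adj_symD[OF ab(1)] ab(2) x(2)] d' ab(3) by auto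
  qed
  then obtain c' where c': "adj H d' c'" "\<And>v. adj H d' v \<Longrightarrow> v = c'" using degree_one_neighbour[OF H] by blast
  have c'V: "c' \<in> verts H" using adj_verts[OF H c'(1)] by blast
  have c'ne: "c' \<noteq> x'" "c' \<noteq> d'" using c'(1) d'(3) irH by (auto simp: adj_commute)
  have xc': "adj H x' c'" using xadj c'V c'ne by auto
  have c'n: "v = x' \<or> v = d'" if "adj H c' v" for v
    using two[OF d12[OF c'V c'ne(1)] adj_symD[OF xc'] adj_symD[OF c'(1)] _ that] d'(2) by auto
  have dc': "degree H c' = 2"
  proof -
    have "{v \<in> verts H. adj H c' v} = {x', d'}"
      using c'n adj_symD[OF xc'] adj_symD[OF c'(1)] x'(1) d'(1) by auto
    then show ?thesis using d'(2) by (simp add: degree_eq_card[OF H])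
  qed
  define L' where "L' = {v \<in> verts H - {x', c', d'}. degree H v = 1}"
  define R' where "R' = {v \<in> verts H - {x', c', d'}. degree H v = 2}"
  have V: "verts H = {x', c', d'} \<union> (L' \<union> R')"
    using x'(1) c'V d'(1) d12 by (auto simp: L'_def R'_def)
  have finLR: "finite L'" "finite R'" using finH by (auto simp: L'_def R'_def)
  have u': "adj H x' v" "\<not> adj H c' v" "\<not> adj H d' v" if "v \<in> L' \<union> R'" for v
    using that xadj[of v] c'n[of v] c'(2)[of v] by (auto simp: L'_def R'_def)
  have l': "\<not> adj H k v" if "k \<in> L'" "v \<in> L' \<union> R'" for k v
    using degree_one_unique[OF H, of k v x'] u'(1)[of k] that adj_symD[of H x' k]
    by (auto simp: L'_def R'_def)
  have mR': "matched H R'"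
    unfolding matched_def
  proof
    fix r assume r: "r \<in> R'"
    then have "degree H r = 2" by (simp add: R'_def)
    then obtain a b where ab: "adj H r a" "adj H r b" "a \<noteq> b" "\<And>v. adj H r v \<Longrightarrow> v = a \<or> v = b"
      using degree_two_neighbours[OF H] by blast
    have rx: "adj H r x'" using u'(1)[of r] r by (auto simp: adj_commute)
    then obtain q where q: "adj H r q" "q \<noteq> x'" "\<And>v. adj H r v \<Longrightarrow> v \<noteq> x' \<Longrightarrow> v = q"
      using ab by metis
    have "q \<noteq> c'" "q \<noteq> d'" using u'(2,3)[of r] r q(1) by (auto simp: adj_commute)
    moreover have "q \<in> verts H" using q(1) adj_verts[OF H] by blast
    moreover have "q \<notin> L'" using l'[of q r] r adj_symD[OF q(1)] by auto
    ultimately have qR: "q \<in> R'" using V q(2) by auto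
    have "x' \<notin> R'" by (simp add: R'_def)
    then show "\<exists>!q. q \<in> R' \<and> adj H r q" using q qR by metis
  qed
  have cL: "card L' = card L"
  proof -
    \<comment> \<open>The degree-1 vertices are the pendant vertices and the end of the pendant
      path. Equating their numbers in both graphs gives the size of \<open>L'\<close>, and the total
      then gives that of \<open>R'\<close>.\<close>
    have "{v \<in> verts H. degree H v = 1} = \<phi> ` {v \<in> C. degree ?K v = 1}"
      using \<phi>(2) by (auto simp: bij_betw_imp_surj_on[OF \<phi>(1), symmetric])
    moreover have "inj_on \<phi> {v \<in> C. degree ?K v = 1}"
      using \<phi>(1) by (auto simp: bij_betw_def intro: inj_on_subset)
    ultimately have "card {v \<in> verts H. degree H v = 1} = card {v \<in> C. degree ?K v = 1}"
      by (simp add: card_image)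
    moreover have "{v \<in> C. degree ?K v = 1} = insert d L" using C(1) dc dd dl dr dx cR2 by auto
    moreover have "{v \<in> verts H. degree H v = 1} = insert d' L'"
      using x' cR2 dc' dd' d'(1) by (auto simp: L'_def)
    moreover have "d \<notin> L" using w(8) by auto
    moreover have "d' \<notin> L'" by (simp add: L'_def)
    ultimately show ?thesis using fin finLR by simp
  qed
  have cR: "card R' = card R"
  proof -
    have "L' \<inter> R' = {}" "{x', c', d'} \<inter> (L' \<union> R') = {}" by (auto simp: L'_def R'_def)
    then have "card (verts H) = card {x', c', d'} + (card L' + card R')"
      unfolding V using finLR card_Un_disjoint[of "{x', c', d'}" "L' \<union> R'"] card_Un_disjoint[of L' R']
      by (simp only: finite_Un finite_insert finite.emptyI simp_thms)
    moreover have "card {x', c', d'} = 3" using c'ne d'(2) by simp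
    ultimately show ?thesis using cV cL by simp
  qed
  have "R' \<noteq> {}" using cR cR2 by auto
  moreover have "{c', d'} \<inter> (L' \<union> R') = {}" "L' \<inter> R' = {}" by (auto simp: L'_def R'_def)
  ultimately have "windmill H x' c' d' L' R'"
    unfolding windmill_def using mR' u' l' xc' adj_symD[OF c'(1)] d'(2,3) by simp
  then obtain h where "iso_on G H h ({x, c, d} \<union> (L \<union> R)) ({x', c', d'} \<union> (L' \<union> R'))"
    using windmill_iso[OF G H W _ fin finLR cL[symmetric] cR[symmetric]] by blast
  then show "H \<simeq> ?K" using iso_on_induced[of G H h C] V C(1) by simp
qed

section \<open>Bipods are determined by their degrees\<close>

lemma bipod_notin:
  assumes "simple_graph G" "bipod G y z s t P Q"
  shows "y \<notin> P \<union> Q" "z \<notin> P \<union> Q"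
proof -
  have "adj G y y" if "y \<in> P \<union> Q" using assms(2) that by (simp add: bipod_def)
  moreover have "adj G z z" if "z \<in> P \<union> Q" using assms(2) that by (simp add: bipod_def)
  ultimately show "y \<notin> P \<union> Q" "z \<notin> P \<union> Q" using adj_irrefl[OF assms(1)] by blast+
qed

lemma bipod_iso:
  assumes "simple_graph G" "simple_graph H" "bipod G y z s t P Q" "bipod H y' z' s' t' P' Q'"
    and fin: "finite P" "finite Q" "finite P'" "finite Q'" and card: "card P = card P'" "card Q = card Q'"
  obtains f where "iso_on G H f ({y, z, s, t} \<union> (P \<union> Q)) ({y', z', s', t'} \<union> (P' \<union> Q'))"
proof -
  note irr = adj_irrefl[OF assms(1)] adj_irrefl[OF assms(2)]
  obtain f where f: "iso_on G H f P P'"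
    using iso_on_clique[OF fin(1,3) card(1) assms(1,2)] assms(3,4) unfolding bipod_def by (metis UnI1)
  obtain g where g: "iso_on G H g Q Q'"
    using iso_on_clique[OF fin(2,4) card(2) assms(1,2)] assms(3,4) unfolding bipod_def by (metis UnI2)
  have im: "l \<in> P \<Longrightarrow> f l \<in> P'" "r \<in> Q \<Longrightarrow> g r \<in> Q'" for l r
    using f g by (auto simp: iso_on_def bij_betw_def)
  note disj = bipod_disjoint[OF assms(3)] bipod_disjoint[OF assms(4)]
  let ?h = "\<lambda>u. if u \<in> P then f u else g u"
  have h: "iso_on G H ?h (P \<union> Q) (P' \<union> Q')"
  proof (rule iso_on_glue[OF f g disj])
    show "adj G u v \<longleftrightarrow> adj H (f u) (g v)" if "u \<in> P" "v \<in> Q" for u v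
    proof -
      have i: "f u \<in> P'" "g v \<in> Q'" using im that by auto
      then have "u \<noteq> v" "f u \<noteq> g v" using disj that by auto
      then have "adj G u v" "adj H (f u) (g v)" using assms(3,4) that i by (simp_all add: bipod_def)
      then show ?thesis by blast
    qed
  qed
  let ?k = "\<lambda>u. if u = y then y' else if u = z then z' else if u = s then s' else t'"
  have ne: "distinct [y, z, s, t]" "distinct [y', z', s', t']" using assms(3,4) by (simp_all add: bipod_def)
  have p: "adj G y s" "adj G z t" "adj H y' s'" "adj H z' t'"
    and n: "\<not> adj G y z" "\<not> adj G y t" "\<not> adj G z s" "\<not> adj G s t"
     "\<not> adj H y' z'" "\<not> adj H y' t'" "\<not> adj H z' s'" "\<not> adj H s' t'"
    using assms(3,4) by (simp_all add: bipod_def)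
  have k: "iso_on G H ?k {y, z, s, t} {y', z', s', t'}"
    using ne irr p p(1,2)[THEN adj_symD] p(3,4)[THEN adj_symD] n n(1-4)[THEN not_adj_symD] n(5-8)[THEN not_adj_symD]
    by (auto simp: iso_on_def bij_betw_def)
  show ?thesis
  proof (rule that, rule iso_on_glue[OF k h])
    show "{y, z, s, t} \<inter> (P \<union> Q) = {}" "{y', z', s', t'} \<inter> (P' \<union> Q') = {}"
      using assms(3,4) bipod_notin[OF assms(1,3)] bipod_notin[OF assms(2,4)] by (simp_all add: bipod_def)
    show "adj G u v \<longleftrightarrow> adj H (?k u) (?h v)" if "u \<in> {y, z, s, t}" "v \<in> P \<union> Q" for u v
    proof -
      have a: "adj G y v" "adj G z v" "v \<in> P \<Longrightarrow> adj G s v \<and> \<not> adj G t v" "v \<in> Q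
        \<Longrightarrow> adj G t v \<and> \<not> adj G s v"
        using assms(3) that(2) by (simp_all add: bipod_def)
      have b: "w \<in> P' \<Longrightarrow> adj H y' w \<and> adj H z' w \<and> adj H s' w \<and> \<not> adj H t' w"
        "w \<in> Q' \<Longrightarrow> adj H y' w \<and> adj H z' w \<and> adj H t' w \<and> \<not> adj H s' w" for w
        using assms(4) by (simp_all add: bipod_def)
      show ?thesis
      proof (cases "v \<in> P")
        case True
        then show ?thesis using that(1) a b(1)[OF im(1)[OF True]] ne by auto
      next
        case False
        then have "v \<in> Q" using that(2) by auto
        then show ?thesis using that(1) False a b(2)[OF im(2)] ne by auto
      qed
    qed
  qed
qed

text \<open>The non-neighbours determine the graph: each vertex of \<open>A\<close> has exactly one of them, and it lies
  among the other four vertices; counting then leaves exactly four non-edges there, and these form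
  a 4-cycle because the only other possibility, a triangle with a pendant edge, gives an
  induced \<open>C\<^sub>4\<close>.\<close>

lemma bipod_from_codegrees:
  assumes H: "simple_graph H" and noC4: "\<not> contains_induced H (cycle_graph 4)"
    and V: "verts H = {y, z, s, t} \<union> A" "distinct [y, z, s, t]" "{y, z, s, t} \<inter> A = {}"
    and co: "\<And>a. a \<in> A \<Longrightarrow> card {w \<in> verts H. w \<noteq> a \<and> \<not> adj H a w} = 1"
      "card {w \<in> verts H. w \<noteq> y \<and> \<not> adj H y w} = 2" "card {w \<in> verts H. w \<noteq> z \<and>
        \<not> adj H z w} = 2"
      "card {w \<in> verts H. w \<noteq> s \<and> \<not> adj H s w} = q + 2" "card {w \<in> verts H. w \<noteq> t \<and>
        \<not> adj H t w} = p + 2"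
    and pq: "card A = p + q"
  obtains y' z' s' t' P Q where "bipod H y' z' s' t' P Q" "{y', z', s', t'} = {y, z, s, t}" "P \<union> Q = A"
    "card P = p" "card Q = q"
proof -
  note result = that
  have finA: "finite A" using finite_verts[OF H] V(1) by simp
  note irr = adj_irrefl[OF H]
  let ?D = "{y, z, s, t}"
  have c: "adj H z y = adj H y z" "adj H s y = adj H y s" "adj H t y = adj H y t"
    "adj H s z = adj H z s" "adj H t z = adj H z t" "adj H t s = adj H s t" by (rule adj_commute)+
  have mem: "y \<in> ?D" "z \<in> ?D" "s \<in> ?D" "t \<in> ?D" by auto
  \<comment> \<open>\<open>m u\<close> is the number of vertices of \<open>A\<close> that
    \<open>u\<close> misses. Double counting with these numbers recovers the adjacencies among the
    four ends.\<close>
  define m where "m u = card {a \<in> A. \<not> adj H u a}" for u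
  have uniq: "v = w" if a: "a \<in> A"
    and vw: "v \<in> verts H" "w \<in> verts H" "v \<noteq> a" "w \<noteq> a" "\<not> adj H a v" "\<not> adj H a w" for a v w
  proof -
    obtain b where b: "{w \<in> verts H. w \<noteq> a \<and> \<not> adj H a w} = {b}" using co(1)[OF a]
      by (auto simp: card_1_singleton_iff)
    have "v \<in> {b}" "w \<in> {b}" unfolding b[symmetric] using vw by auto
    then show ?thesis by simp
  qed
  have ex: "\<exists>w\<in>verts H. w \<noteq> a \<and> \<not> adj H a w" if a: "a \<in> A" for a
  proof -
    obtain b where b: "{w \<in> verts H. w \<noteq> a \<and> \<not> adj H a w} = {b}" using co(1)[OF a]
      by (auto simp: card_1_singleton_iff)
    have "b \<in> {w \<in> verts H. w \<noteq> a \<and> \<not> adj H a w}" unfolding b by simp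
    then show ?thesis by auto
  qed
  \<comment> \<open>Nonadjacent \<open>a\<close> and \<open>b\<close> would be each other's only
    non-neighbour, hence both adjacent to \<open>y\<close> and to a non-neighbour \<open>u\<close>
    of \<open>y\<close>: an induced 4-cycle.\<close>
  have clique: "adj H a b" if ab: "a \<in> A" "b \<in> A" "a \<noteq> b" for a b
  proof (rule ccontr)
    assume n: "\<not> adj H a b"
    have "{w \<in> verts H. w \<noteq> y \<and> \<not> adj H y w} \<noteq> {}"
      using co(2) by (metis card.empty zero_neq_numeral)
    then obtain u where u: "u \<in> verts H" "u \<noteq> y" "\<not> adj H y u" by auto
    have y: "y \<in> verts H" "y \<noteq> a" "y \<noteq> b" using V ab by auto
    have V': "a \<in> verts H" "b \<in> verts H" using V ab by auto
    have ay: "adj H a y" using uniq[OF ab(1) y(1) V'(2)] y ab(3) n by auto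
    have bY: "adj H b y" using uniq[OF ab(2) y(1) V'(1)] y ab(3) n by (auto simp: adj_commute)
    have une: "u \<noteq> a" "u \<noteq> b" using u(3) ay bY by (auto simp: adj_commute)
    have au: "adj H a u" using uniq[OF ab(1) u(1) V'(2)] une ab(3) n by auto
    have bu: "adj H b u" using uniq[OF ab(2) u(1) V'(1)] une ab(3) n by (auto simp: adj_commute)
    show False using C4_chord[OF H noC4 ay adj_symD[OF bY] bu au] ab(3) u n by auto
  qed
  have one: "\<exists>w\<in>?D. \<not> adj H a w" if "a \<in> A" for a
    using ex[OF that] clique[OF that] V(1) by blast
  have only: "v = w" if "a \<in> A" "v \<in> ?D" "w \<in> ?D" "\<not> adj H a v" "\<not> adj H a w" for a v w
    using uniq[OF that(1), of v w] that V by auto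
  \<comment> \<open>A vertex \<open>a\<close> that misses \<open>l\<close> is adjacent to all other
    ends. With two nonadjacent neighbours \<open>j\<close>, \<open>k\<close> of \<open>l\<close> it
    would form an induced 4-cycle.\<close>
  have m0: "m l = 0" if ljk: "l \<in> ?D" "j \<in> ?D" "k \<in> ?D" "adj H l j" "adj H l k" "\<not> adj H j k" "j \<noteq> k"
    for l j k
  proof -
    have False if a: "a \<in> A" "\<not> adj H l a" for a
    proof -
      have al: "\<not> adj H a l" using a(2) by (simp add: adj_commute)
      have "l \<noteq> j" "l \<noteq> k" using ljk irr by auto
      then have "adj H a j" "adj H a k" using only[OF a(1) ljk(1) _ al] ljk(2,3) by blast+
      then show False
        using C4_chord[OF H noC4, of a j l k] ljk al adj_symD[OF ljk(4)] a(1) V(3) by blast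
    qed
    then have "{a \<in> A. \<not> adj H l a} = {}" by blast
    then show ?thesis unfolding m_def by (simp only: card.empty)
  qed
  have msum: "m y + m z + m s + m t = p + q"
  proof -
    have "A = {a \<in> A. \<not> adj H y a} \<union> {a \<in> A. \<not> adj H z a} \<union> {a \<in> A. \<not> adj H s a}
      \<union> {a \<in> A. \<not> adj H t a}"
      using one by (auto simp: adj_commute)
    moreover have d: "{a \<in> A. \<not> adj H v a} \<inter> {a \<in> A. \<not> adj H w a} = {}"
      if "v \<in> ?D" "w \<in> ?D" "v \<noteq> w" for v w
      using only that by (auto simp: adj_commute)
    have "card ({a \<in> A. \<not> adj H y a} \<union> {a \<in> A. \<not> adj H z a} \<union> {a \<in> A. \<not> adj H s a}
      \<union> {a \<in> A. \<not> adj H t a})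
        = m y + m z + m s + m t"
      unfolding m_def using finA d[of y z] d[of y s] d[of y t] d[of z s] d[of z t] d[of s t] V(2)
      by (simp add: card_Un_disjoint Int_Un_distrib2)
    ultimately show ?thesis using pq by simp
  qed
  have cnt: "card {w \<in> verts H. w \<noteq> u \<and> \<not> adj H u w} = m u + card {w \<in> ?D - {u}. \<not> adj H u w}"
    if "u \<in> ?D" for u
  proof -
    have "{w \<in> verts H. w \<noteq> u \<and> \<not> adj H u w} = {a \<in> A. \<not> adj H u a}
      \<union> {w \<in> ?D - {u}. \<not> adj H u w}"
      using V that by auto
    moreover have "{a \<in> A. \<not> adj H u a} \<inter> {w \<in> ?D - {u}. \<not> adj H u w} = {}" using V(3) by auto
    ultimately show ?thesis unfolding m_def using finA by (simp add: card_Un_disjoint)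
  qed
  have c3: "card {w \<in> {a, b, c}. \<not> adj H u w} = of_bool (\<not> adj H u a) + of_bool (\<not> adj H u b) + of_bool (\<not> adj H u c)"
    if "distinct [a, b, c]" for u a b c
  proof -
    have "card {w \<in> {a, b, c}. \<not> adj H u w} = (\<Sum>w\<in>{a, b, c}. of_bool (\<not> adj H u w))"
      by (simp add: sum.If_cases of_bool_def Int_def conj_commute)
    also have "\<dots> = of_bool (\<not> adj H u a) + of_bool (\<not> adj H u b) + of_bool (\<not> adj H u c)"
      using that by simp
    finally show ?thesis .
  qed
  let ?n = "\<lambda>u w. of_bool (\<not> adj H u w) :: nat"
  have D: "?D - {y} = {z, s, t}" "?D - {z} = {y, s, t}" "?D - {s} = {y, z, t}" "?D - {t} = {y, z, s}"
    using V(2) by auto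
  have eqs: "m y + ?n y z + ?n y s + ?n y t = 2" "m z + ?n y z + ?n z s + ?n z t = 2"
    "m s + ?n y s + ?n z s + ?n s t = q + 2" "m t + ?n y t + ?n z t + ?n s t = p + 2"
  proof -
    have d: "distinct [z, s, t]" "distinct [y, s, t]" "distinct [y, z, t]" "distinct [y, z, s]" using V(2) by auto
    note count = cnt[OF mem(1)] cnt[OF mem(2)] cnt[OF mem(3)] cnt[OF mem(4)]
    note count' = count[unfolded D co c3[OF d(1)] c3[OF d(2)] c3[OF d(3)] c3[OF d(4)] c]
    show "m y + ?n y z + ?n y s + ?n y t = 2" "m z + ?n y z + ?n z s + ?n z t = 2"
      "m s + ?n y s + ?n z s + ?n s t = q + 2" "m t + ?n y t + ?n z t + ?n s t = p + 2"
      using count' by linarith+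
  qed
  have fin: thesis
    if l: "{y', z', s', t'} = ?D" "distinct [y', z', s', t']" "adj H y' s'" "adj H z' t'"
      "\<not> adj H y' z'" "\<not> adj H y' t'" "\<not> adj H z' s'" "\<not> adj H s' t'"
      "m y' = 0" "m z' = 0" "m s' = q" "m t' = p" for y' z' s' t'
  proof -
    let ?P = "{a \<in> A. \<not> adj H t' a}" and ?Q = "{a \<in> A. \<not> adj H s' a}"
    have yz: "adj H y' a" "adj H z' a" if "a \<in> A" for a using l(9,10) that finA by (auto simp: m_def)
    have mem': "y' \<in> ?D" "z' \<in> ?D" "s' \<in> ?D" "t' \<in> ?D" using l(1) by blast+
    have st: "adj H s' a \<longleftrightarrow> \<not> adj H t' a" if a: "a \<in> A" for a
    proof -
      obtain w where "w \<in> {y', z', s', t'}" "\<not> adj H a w" using one[OF a] l(1) by blast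
      then have "\<not> adj H a s' \<or> \<not> adj H a t'" using yz[OF a] by (auto simp: adj_commute)
      moreover have "adj H a s' \<or> adj H a t'" using only[OF a mem'(3,4)] l(2) by auto
      ultimately show ?thesis by (auto simp: adj_commute)
    qed
    have "bipod H y' z' s' t' ?P ?Q"
      unfolding bipod_def using l(2-8) clique yz st mem' V(3) by auto
    moreover have "?P \<union> ?Q = A" using st by auto
    ultimately show thesis using result[of y' z' s' t' ?P ?Q] l(1,11,12) by (simp add: m_def)
  qed
  have cases: "adj H y s \<and> adj H z t \<and> \<not> adj H y z \<and> \<not> adj H y t \<and> \<not> adj H z s \<and>
    \<not> adj H s t \<or>
    adj H y t \<and> adj H z s \<and> \<not> adj H y z \<and> \<not> adj H y s \<and> \<not> adj H z t \<and> \<not> adj H s t \<or>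
    adj H y z \<and> adj H s t \<and> \<not> adj H y s \<and> \<not> adj H y t \<and> \<not> adj H z s \<and> \<not> adj H z t"
  proof -
    have ne: "y \<noteq> z" "y \<noteq> s" "y \<noteq> t" "z \<noteq> s" "z \<noteq> t" "s \<noteq> t" using V(2) by auto
    \<comment> \<open>Adding the four equations counts each of the six pairs twice:
      \<open>p + q\<close> plus twice the number of non-edges equals
      \<open>p + q + 8\<close>.\<close>
    have S: "?n y z + ?n y s + ?n y t + ?n z s + ?n z t + ?n s t = 4" using eqs msum by linarith
    \<comment> \<open>If the non-edges were a triangle with a pendant edge, the end \<open>l\<close>
      outside the triangle would have two nonadjacent neighbours. Then \<open>m l = 0\<close>, and
      \<open>l\<close> would have one non-neighbour instead of at least two.\<close>
    have tri: False if mem: "l \<in> ?D" "i \<in> ?D" "j \<in> ?D" "k \<in> ?D" and d: "i \<noteq> j" "i \<noteq> k" "j \<noteq> k"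
      and non: "\<not> adj H i j \<and> \<not> adj H i k \<and> \<not> adj H j k"
      and one: "?n l i + ?n l j + ?n l k = 1" and ge: "2 \<le> m l + (?n l i + ?n l j + ?n l k)" for l i j k
    proof -
      have "m l = 0"
        using m0[OF mem(1-3)] m0[OF mem(1,2,4)] m0[OF mem(1,3,4)] d non one
        by (cases "adj H l i"; cases "adj H l j"; cases "adj H l k") simp_all
      then show False using one ge by simp
    qed
    have "\<not> (\<not> adj H z s \<and> \<not> adj H z t \<and> \<not> adj H s t)"
      using tri[OF mem(1,2,3,4)] ne S eqs(1) by fastforce
    moreover have "\<not> (\<not> adj H y s \<and> \<not> adj H y t \<and> \<not> adj H s t)"
      using tri[OF mem(2,1,3,4)] ne S eqs(2) c by fastforce
    moreover have "\<not> (\<not> adj H y z \<and> \<not> adj H y t \<and> \<not> adj H z t)"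
      using tri[OF mem(3,1,2,4)] ne S eqs(3) c by fastforce
    moreover have "\<not> (\<not> adj H y z \<and> \<not> adj H y s \<and> \<not> adj H z s)"
      using tri[OF mem(4,1,2,3)] ne S eqs(4) c by fastforce
    ultimately show ?thesis using S
      by (cases "adj H y z"; cases "adj H y s"; cases "adj H y t"; cases "adj H z s"; cases "adj H z t"; cases "adj H s t")
        simp_all
  qed
  have ne: "distinct [y, z, s, t]" "distinct [z, y, s, t]" "distinct [y, s, z, t]" "distinct [t, z, s, y]"
    using V(2) by auto
  from cases show thesis
  proof (elim disjE)
    assume "adj H y s \<and> adj H z t \<and> \<not> adj H y z \<and> \<not> adj H y t \<and> \<not> adj H z s \<and>
      \<not> adj H s t"
    then show thesis using fin[OF refl ne(1)] eqs by simp
  next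
    assume "adj H y t \<and> adj H z s \<and> \<not> adj H y z \<and> \<not> adj H y s \<and> \<not> adj H z t \<and>
      \<not> adj H s t"
    then show thesis using fin[OF _ ne(2)] eqs c by auto
  next
    assume a: "adj H y z \<and> adj H s t \<and> \<not> adj H y s \<and> \<not> adj H y t \<and> \<not> adj H z s \<and>
      \<not> adj H z t"
    then have m: "m y = 0" "m z = 0" "m s = q" "m t = p" using eqs by simp_all
    \<comment> \<open>In this pairing \<open>s\<close> and \<open>t\<close> are adjacent. A vertex
      missing \<open>s\<close> and a vertex missing \<open>t\<close> would close an induced 4-cycle
      with them, so one side is empty; then \<open>s\<close> or \<open>t\<close> has codegree 2,
      just as \<open>y\<close> and \<open>z\<close>, and a relabelling gives the bipod.\<close>
    have "p = 0 \<or> q = 0"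
    proof (rule ccontr)
      assume "\<not> ?thesis"
      then have "m s \<noteq> 0" "m t \<noteq> 0" using m(3,4) by auto
      then have "{a \<in> A. \<not> adj H s a} \<noteq> {}" "{a \<in> A. \<not> adj H t a} \<noteq> {}"
        unfolding m_def by (metis card.empty)+
      then obtain a b where ab: "a \<in> A" "\<not> adj H s a" "b \<in> A" "\<not> adj H t b" by blast
      have "adj H a t" "adj H b s"
        using only[OF ab(1), of s t] only[OF ab(3), of s t] ab V(2) by (auto simp: adj_commute)
      moreover from this have "a \<noteq> b" using ab by (auto simp: adj_commute)
      ultimately show False
        using C4_chord[OF H noC4, of a b s t] clique[OF ab(1,3)] a ab V(3) by (auto simp: adj_commute)
    qed
    then show thesis
    proof
      assume "q = 0"
      then show thesis using fin[OF _ ne(3)] m a c by auto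
    next
      assume "p = 0"
      then show thesis using fin[OF _ ne(4)] m a c by auto
    qed
  qed
qed

lemma codegree:
  assumes "simple_graph H" "x \<in> verts H"
  shows "card {u \<in> verts H. u \<noteq> x \<and> \<not> adj H x u} + degree H x + 1 = card (verts H)"
proof -
  let ?N = "{u \<in> verts H. adj H x u}"
  have fin: "finite (verts H)" using finite_verts[OF assms(1)] .
  have "{u \<in> verts H. u \<noteq> x \<and> \<not> adj H x u} = verts H - insert x ?N" by auto
  moreover have "card (insert x ?N) = degree H x + 1"
    using assms(1) adj_irrefl[OF assms(1)] fin by (simp add: degree_eq_card)
  moreover have "insert x ?N \<subseteq> verts H" using assms(2) by auto
  ultimately show ?thesis
    using fin card_mono[of "verts H" "insert x ?N"] by (simp add: card_Diff_subset)
qed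

text \<open>Equal orders let non-neighbours be counted instead of neighbours: 1 for a clique vertex,
  2 for \<open>y\<close> and \<open>z\<close>, \<open>card Q + 2\<close> for \<open>s\<close> and
  \<open>card P + 2\<close> for \<open>t\<close>. The four ends of the competitor are the images of
  the old ones in some order.\<close>

lemma bipod_unigraph:
  assumes G: "simple_graph G" and B: "bipod G y z s t P Q"
    and C: "C = {y, z, s, t} \<union> (P \<union> Q)" "C \<subseteq> verts G" and ch: "chordal (induced_subgraph G C)"
  shows "chordal_unigraph (induced_subgraph G C)"
  unfolding chordal_unigraph_def
proof (intro conjI ch allI impI)
  fix H :: "nat graph"
  let ?K = "induced_subgraph G C"
  assume asm: "simple_graph H \<and> chordal H \<and> degree_sequence H = degree_sequence ?K"
  then have H: "simple_graph H" and noC4: "\<not> contains_induced H (cycle_graph 4)"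
    by (auto simp: chordal_def)
  have K: "simple_graph ?K" using simple_induced[OF G C(2)] .
  obtain \<phi> where \<phi>: "bij_betw \<phi> C (verts H)" "\<And>x. x \<in> C \<Longrightarrow> degree H (\<phi> x) = degree ?K x"
    using degree_sequence_bijE[of ?K H] asm K by auto
  have fin: "finite P" "finite Q" using C finite_verts[OF G] finite_subset by blast+
  note disj = bipod_disjoint[OF B] and notin = bipod_notin[OF G B]
  note irr = adj_irrefl[OF G]
  have ne: "distinct [y, z, s, t]" "{s, t} \<inter> (P \<union> Q) = {}" using B by (simp_all add: bipod_def)
  have codegH: "card {u \<in> verts H. u \<noteq> \<phi> x \<and> \<not> adj H (\<phi> x) u} = card {u \<in> C. u \<noteq> x \<and>
    \<not> adj G x u}"
    if x: "x \<in> C" for x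
  proof -
    have "\<phi> x \<in> verts H" using \<phi>(1) x by (auto simp: bij_betw_def)
    moreover have "{u \<in> verts ?K. u \<noteq> x \<and> \<not> adj ?K x u} = {u \<in> C. u \<noteq> x \<and> \<not> adj G x u}"
      using x by auto
    ultimately show ?thesis
      using codegree[OF H, of "\<phi> x"] codegree[OF K, of x] \<phi>(2)[OF x] bij_betw_same_card[OF \<phi>(1)] x by simp
  qed
  have adjs: "adj G y s" "adj G z t" "\<not> adj G y z" "\<not> adj G y t" "\<not> adj G z s" "\<not> adj G s t"
    "adj G s y" "adj G t z" "\<not> adj G z y" "\<not> adj G t y" "\<not> adj G s z" "\<not> adj G t s"
    using B by (auto simp: bipod_def adj_commute)
  have adjA: "adj G y a" "adj G z a" "adj G a y" "adj G a z" if "a \<in> P \<union> Q" for a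
    using B that by (auto simp: bipod_def adj_commute[of _ a])
  have adjP: "adj G s a" "\<not> adj G t a" "adj G a s" "\<not> adj G a t" if "a \<in> P" for a
    using B that by (auto simp: bipod_def adj_commute[of _ a])
  have adjQ: "adj G t a" "\<not> adj G s a" "adj G a t" "\<not> adj G a s" if "a \<in> Q" for a
    using B that by (auto simp: bipod_def adj_commute[of _ a])
  have clique: "adj G a b" if "a \<in> P \<union> Q" "b \<in> P \<union> Q" "a \<noteq> b" for a b
    using B that by (simp add: bipod_def)
  have "{u \<in> C. u \<noteq> y \<and> \<not> adj G y u} = {z, t}" using C(1) adjs adjA ne by auto
  then have cy: "card {u \<in> C. u \<noteq> y \<and> \<not> adj G y u} = 2" using ne(1) by simp
  have "{u \<in> C. u \<noteq> z \<and> \<not> adj G z u} = {y, s}" using C(1) adjs adjA ne by auto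
  then have cz: "card {u \<in> C. u \<noteq> z \<and> \<not> adj G z u} = 2" using ne(1) by simp
  have "{u \<in> C. u \<noteq> s \<and> \<not> adj G s u} = {z, t} \<union> Q" using C(1) adjs adjP adjQ ne by auto
  then have cs: "card {u \<in> C. u \<noteq> s \<and> \<not> adj G s u} = card Q + 2"
    using ne notin fin by (simp add: card_insert_if)
  have "{u \<in> C. u \<noteq> t \<and> \<not> adj G t u} = {y, s} \<union> P" using C(1) adjs adjP adjQ ne by auto
  then have ct: "card {u \<in> C. u \<noteq> t \<and> \<not> adj G t u} = card P + 2"
    using ne notin fin by (simp add: card_insert_if)
  have ca: "card {u \<in> C. u \<noteq> a \<and> \<not> adj G a u} = 1" if a: "a \<in> P \<union> Q" for a
  proof (cases "a \<in> P")
    case True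
    then have "{u \<in> C. u \<noteq> a \<and> \<not> adj G a u} = {t}"
      using C(1) adjP(3,4)[OF True] adjA(3,4)[OF a] clique[OF a] ne(2) by auto
    then show ?thesis by simp
  next
    case False
    then have aQ: "a \<in> Q" using a by auto
    then have "{u \<in> C. u \<noteq> a \<and> \<not> adj G a u} = {s}"
      using C(1) adjQ(3,4)[OF aQ] adjA(3,4)[OF a] clique[OF a] ne(2) by auto
    then show ?thesis by simp
  qed
  have inj: "inj_on \<phi> ({y, z, s, t} \<union> (P \<union> Q))"
    and im: "verts H = \<phi> ` ({y, z, s, t} \<union> (P \<union> Q))"
    using \<phi>(1) C(1) by (auto simp: bij_betw_def)
  have mem: "y \<in> C" "z \<in> C" "s \<in> C" "t \<in> C" "\<And>a. a \<in> P \<union> Q \<Longrightarrow> a \<in> C" using C(1)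
    by auto
  obtain y' z' s' t' P' Q' where B': "bipod H y' z' s' t' P' Q'"
    and V': "{y', z', s', t'} = {\<phi> y, \<phi> z, \<phi> s, \<phi> t}" "P' \<union> Q' = \<phi> ` (P \<union> Q)"
    and card': "card P' = card P" "card Q' = card Q"
  proof (rule bipod_from_codegrees[OF H noC4, of "\<phi> y" "\<phi> z" "\<phi> s" "\<phi> t" "\<phi> ` (P \<union> Q)" "card Q"
    "card P"])
    show "verts H = {\<phi> y, \<phi> z, \<phi> s, \<phi> t} \<union> \<phi> ` (P \<union> Q)" unfolding im by simp
    show "distinct [\<phi> y, \<phi> z, \<phi> s, \<phi> t]" using inj ne(1) by (auto simp: inj_on_def)
    have "\<phi> ` {y, z, s, t} \<inter> \<phi> ` (P \<union> Q) = \<phi> ` ({y, z, s, t} \<inter> (P \<union> Q))"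
      using inj_on_image_Int[OF inj, of "{y, z, s, t}" "P \<union> Q"] by auto
    then show "{\<phi> y, \<phi> z, \<phi> s, \<phi> t} \<inter> \<phi> ` (P \<union> Q) = {}" using ne(2) notin by auto
    show "card (\<phi> ` (P \<union> Q)) = card P + card Q"
      using inj card_Un_disjoint[OF fin disj] by (subst card_image) (auto intro: inj_on_subset)
    show "card {w \<in> verts H. w \<noteq> a \<and> \<not> adj H a w} = 1" if a: "a \<in> \<phi> ` (P \<union> Q)" for a
    proof -
      obtain b where b: "b \<in> P \<union> Q" "a = \<phi> b" using a by blast
      then show ?thesis using codegH[OF mem(5)[OF b(1)]] ca[OF b(1)] by simp
    qed
  qed (use codegH[OF mem(1)] codegH[OF mem(2)] codegH[OF mem(3)] codegH[OF mem(4)] cy cz cs ct in simp_all)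
  have V: "{y', z', s', t'} \<union> (P' \<union> Q') = verts H" using V' im by simp
  then have "finite P'" "finite Q'" using finite_verts[OF H] by (metis finite_Un)+
  then obtain h where "iso_on G H h ({y, z, s, t} \<union> (P \<union> Q)) ({y', z', s', t'} \<union> (P' \<union> Q'))"
    using bipod_iso[OF G H B B' fin _ _ card'(1)[symmetric] card'(2)[symmetric]] by blast
  then show "H \<simeq> ?K" using iso_on_induced[of G H h C] V C(1) by simp
qed

section \<open>Gluing a core to its split part\<close>

text \<open>Removes \<open>c\<close> and \<open>c'\<close> from a bijection that need not match
  them: the preimage of \<open>c'\<close> is redirected to \<open>f c\<close>. The second condition
  on \<open>Q\<close> says that \<open>f c\<close> suits every element that \<open>c'\<close>
  suits.\<close>

lemma bij_betw_cancel:
  assumes f: "bij_betw f (insert c X) (insert c' Y)" "c \<notin> X" "c' \<notin> Y"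
    and Q: "\<And>x. x \<in> insert c X \<Longrightarrow> Q x (f x)" "\<And>x. x \<in> X \<Longrightarrow> Q x c'
      \<Longrightarrow> Q x (f c)"
  obtains g where "bij_betw g X Y" "\<And>x. x \<in> X \<Longrightarrow> Q x (g x)"
proof -
  have inj: "inj_on f (insert c X)" and im: "f ` insert c X = insert c' Y" using f(1) by (auto simp: bij_betw_def)
  let ?g = "\<lambda>x. if f x = c' then f c else f x"
  have fc: "f x \<noteq> f c" if "x \<in> X" for x using inj that f(2) by (auto simp: inj_on_def)
  have "inj_on ?g X"
  proof (rule inj_onI)
    fix x y assume xy: "x \<in> X" "y \<in> X" "?g x = ?g y"
    then have "f x = f y" using fc[OF xy(1)] fc[OF xy(2)] by (auto split: if_splits)
    then show "x = y" using inj xy by (auto simp: inj_on_def)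
  qed
  moreover have "?g ` X = Y"
  proof (intro equalityI subsetI)
    fix v assume "v \<in> ?g ` X"
    then obtain x where x: "x \<in> X" "v = ?g x" by blast
    have "f x \<in> insert c' Y" "f c \<in> insert c' Y" using im x by auto
    then show "v \<in> Y" using x fc[OF x(1)] by (auto split: if_splits)
  next
    fix v assume v: "v \<in> Y"
    then obtain x where x: "x \<in> insert c X" "f x = v" using im by (metis image_iff insertI2)
    have vc: "v \<noteq> c'" using v f(3) by auto
    show "v \<in> ?g ` X"
    proof (cases "x = c")
      case False
      then show ?thesis using x vc by (intro image_eqI[of _ _ x]) auto
    next
      case True
      obtain w where w: "w \<in> insert c X" "f w = c'" using im by (metis image_iff insertI1)
      then have "w \<in> X" using True x vc by auto
      then show ?thesis using True x w by (intro image_eqI[of _ _ w]) auto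
    qed
  qed
  ultimately have "bij_betw ?g X Y" by (simp add: bij_betw_def)
  moreover have "Q x (?g x)" if "x \<in> X" for x using Q(1)[of x] Q(2)[OF that] that by auto
  ultimately show ?thesis using that by blast
qed

lemma composition_degree_core:
  assumes "simple_graph G" "verts G = A \<union> B \<union> C" "A \<inter> C = {}" "B \<inter> C = {}"
    and A: "\<And>x y. x \<in> A \<Longrightarrow> y \<in> A \<union> C \<Longrightarrow> x \<noteq> y \<Longrightarrow> adj G x y"
    and B: "\<And>x y. x \<in> B \<Longrightarrow> y \<in> B \<union> C \<Longrightarrow> \<not> adj G x y" and x: "x \<in> C"
  shows "degree G x = card A + degree (induced_subgraph G C) x"
proof -
  have "finite A" "finite C" using assms(2) finite_verts[OF assms(1)] by auto
  have "adj G x a" if "a \<in> A" for a using A[OF that, of x] that x assms(3) by (auto simp: adj_commute)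
  moreover have "\<not> adj G x b" if "b \<in> B" for b using B[OF that, of x] x by (auto simp: adj_commute)
  ultimately have "{u \<in> verts G. adj G x u} = A \<union> {u \<in> C. adj G x u}" using assms(2) by auto
  moreover have "card (A \<union> {u \<in> C. adj G x u}) = card A + card {u \<in> C. adj G x u}"
    using \<open>finite A\<close> \<open>finite C\<close> assms(3) by (intro card_Un_disjoint) auto
  ultimately show ?thesis
    using degree_induced[OF assms(1), of C x] assms(2) x degree_eq_card[OF assms(1), of x] by auto
qed

text \<open>Shrinking the core to a stable set \<open>D\<close> changes the degrees by amounts that
  depend only on the part. The last two bounds separate \<open>A\<close> from the other vertices as
  soon as \<open>D\<close> has two elements.\<close>

lemma composition_degree_split:
  assumes G: "simple_graph G" "verts G = A \<union> B \<union> C" "A \<inter> B = {}" "A \<inter> C = {}" "B \<inter> C = {}"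
    and AC: "\<forall>x\<in>A. \<forall>y\<in>A \<union> C. x \<noteq> y \<longrightarrow> adj G x y"
    and BC: "\<forall>x\<in>B. \<forall>y\<in>B \<union> C. \<not> adj G x y"
    and D: "D \<subseteq> C" and K: "K = induced_subgraph G (A \<union> B \<union> D)"
    and stD: "\<forall>x\<in>D. \<forall>y\<in>D. \<not> adj G x y"
  shows "\<And>x. x \<in> A \<Longrightarrow> degree G x + card D = degree K x + card C"
    and "\<And>x. x \<in> B \<Longrightarrow> degree K x = degree G x"
    and "\<And>x. x \<in> D \<Longrightarrow> degree K x = card A"
    and "\<And>x. x \<in> A \<Longrightarrow> card A + card D \<le> degree K x + 1"
    and "\<And>x. x \<in> B \<Longrightarrow> degree K x \<le> card A"
proof -
  note A = AC[rule_format] and B = BC[rule_format] and st = stD[rule_format]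
  have fin: "finite A" "finite B" "finite C" "finite D"
    using G(2) finite_verts[OF G(1)] D finite_subset by auto
  have W: "A \<union> B \<union> D \<subseteq> verts G" using G(2) D by auto
  have dK: "degree K x = card {u \<in> A \<union> B \<union> D. adj G x u}" if "x \<in> A \<union> B \<union> D" for x
    unfolding K using degree_induced[OF G(1) W that] .
  have dG: "degree G x = card {u \<in> A \<union> B \<union> C. adj G x u}" for x
    using degree_eq_card[OF G(1), of x] G(2) by simp
  note irr = adj_irrefl[OF G(1)]
  have aC: "adj G x u" if "x \<in> A" "u \<in> C" for x u using A[OF that(1)] that G(4) by auto
  show "degree G x + card D = degree K x + card C" if x: "x \<in> A" for x
  proof -
    have "{u \<in> A \<union> B \<union> C. adj G x u} = {u \<in> A \<union> B. adj G x u} \<union> C" using aC[OF x] by auto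
    moreover have "{u \<in> A \<union> B \<union> D. adj G x u} = {u \<in> A \<union> B. adj G x u} \<union> D" using aC[OF x] D
      by auto
    moreover have "card ({u \<in> A \<union> B. adj G x u} \<union> C) = card {u \<in> A \<union> B. adj G x u} + card C"
      using fin G(4,5) by (intro card_Un_disjoint) auto
    moreover have "card ({u \<in> A \<union> B. adj G x u} \<union> D) = card {u \<in> A \<union> B. adj G x u} + card D"
      using fin G(4,5) D by (intro card_Un_disjoint) auto
    ultimately show ?thesis using dG[of x] dK[of x] x by simp
  qed
  show "degree K x = degree G x" if x: "x \<in> B" for x
  proof -
    have "{u \<in> A \<union> B \<union> C. adj G x u} = {u \<in> A \<union> B \<union> D. adj G x u}" using B[OF x] D by auto
    then show ?thesis using dG[of x] dK[of x] x by simp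
  qed
  show "degree K x = card A" if x: "x \<in> D" for x
  proof -
    have "adj G x a" if "a \<in> A" for a using aC[OF that, of x] D x by (auto simp: adj_commute)
    moreover have "\<not> adj G x b" if "b \<in> B" for b using B[OF that, of x] D x by (auto simp: adj_commute)
    ultimately have "{u \<in> A \<union> B \<union> D. adj G x u} = A" using st[OF x] by auto
    then show ?thesis using dK[of x] x by simp
  qed
  show "card A + card D \<le> degree K x + 1" if x: "x \<in> A" for x
  proof -
    have "(A - {x}) \<union> D \<subseteq> {u \<in> A \<union> B \<union> D. adj G x u}" using A[OF x] D G(4) x by auto
    then have "card ((A - {x}) \<union> D) \<le> degree K x"
      using dK[of x] x fin card_mono[of "{u \<in> A \<union> B \<union> D. adj G x u}" "(A - {x}) \<union> D"] by simp
    moreover have "card ((A - {x}) \<union> D) = card (A - {x}) + card D"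
      using fin G(4) D by (intro card_Un_disjoint) auto
    moreover have "card A = Suc (card (A - {x}))" using card.remove[OF fin(1) x] by simp
    ultimately show ?thesis by simp
  qed
  show "degree K x \<le> card A" if x: "x \<in> B" for x
  proof -
    have "{u \<in> A \<union> B \<union> D. adj G x u} \<subseteq> A" using B[OF x] D by auto
    then show ?thesis using dK[of x] x card_mono[OF fin(1), of "{u \<in> A \<union> B \<union> D. adj G x u}"] by simp
  qed
qed

text \<open>A competitor decomposes in the same way by \<open>composition_transfer\<close>. Its core
  is isomorphic to \<open>C\<close> by \<open>core\<close>, and its split part, with two nonadjacent
  core vertices, is isomorphic by \<open>split\<close>. The second isomorphism may mix the core pair
  with \<open>B\<close>; it is repaired before the two maps are glued.\<close>

lemma composition_iso:
  assumes G: "simple_graph G" "verts G = A \<union> B \<union> C" "A \<inter> B = {}" "A \<inter> C = {}" "B \<inter> C = {}"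
    and A: "\<And>x y. x \<in> A \<Longrightarrow> y \<in> A \<union> C \<Longrightarrow> x \<noteq> y \<Longrightarrow> adj G x y"
    and B: "\<And>x y. x \<in> B \<Longrightarrow> y \<in> B \<union> C \<Longrightarrow> \<not> adj G x y"
    and c: "c1 \<in> C" "c2 \<in> C" "c1 \<noteq> c2" "\<not> adj G c1 c2"
    and core: "chordal_unigraph (induced_subgraph G C)"
    and split: "unigraph (induced_subgraph G (A \<union> B \<union> {c1, c2}))"
    and H: "simple_graph (H :: nat graph)" "chordal H" "degree_sequence H = degree_sequence G"
  shows "H \<simeq> G"
proof -
  obtain \<phi> where \<phi>: "bij_betw \<phi> (verts G) (verts H)"
    "\<And>x. x \<in> verts G \<Longrightarrow> degree H (\<phi> x) = degree G x"
    using degree_sequence_bijE[OF H(3)[symmetric] G(1) H(1)] by blast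
  define A' B' C' where "A' = \<phi> ` A" and "B' = \<phi> ` B" and "C' = \<phi> ` C"
  note tr = composition_transfer[OF G A B H(1) \<phi>]
  have A': "adj H x y" if "x \<in> A'" "y \<in> A' \<union> C'" "x \<noteq> y" for x y
    using tr(1) that unfolding A'_def C'_def by blast
  have B': "\<not> adj H x y" if "x \<in> B'" "y \<in> B' \<union> C'" for x y
    using tr(2) that unfolding B'_def C'_def by blast
  have inj: "inj_on \<phi> (A \<union> B \<union> C)" using \<phi>(1) G(2) by (simp add: bij_betw_def)
  have VH: "verts H = A' \<union> B' \<union> C'"
    using \<phi>(1) G(2) by (simp add: bij_betw_def image_Un A'_def B'_def C'_def)
  have dis: "A' \<inter> B' = {}" "A' \<inter> C' = {}" "B' \<inter> C' = {}"
    unfolding A'_def B'_def C'_def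
    by (subst inj_on_image_Int[OF inj, symmetric]; use G(3-5) in auto)+
  have bij: "bij_betw \<phi> A A'" "bij_betw \<phi> C C'" "bij_betw \<phi> (A \<union> B) (A' \<union> B')"
    using inj by (auto simp: bij_betw_def A'_def B'_def C'_def image_Un intro: inj_on_subset)
  have cA: "card A' = card A" "card C' = card C"
    using bij_betw_same_card[OF bij(1)] bij_betw_same_card[OF bij(2)] by simp_all
  have subC: "C \<subseteq> verts G" "C' \<subseteq> verts H" using G(2) VH by auto
  have sC: "simple_graph (induced_subgraph G C)" "simple_graph (induced_subgraph H C')"
    using simple_induced G(1) H(1) subC by blast+
  have "degree_sequence (induced_subgraph G C) = degree_sequence (induced_subgraph H C')"
  proof (rule degree_sequence_bijI)
    show "bij_betw \<phi> (verts (induced_subgraph G C)) (verts (induced_subgraph H C'))" using bij(2) by simp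
    show "degree (induced_subgraph H C') (\<phi> x) = degree (induced_subgraph G C) x"
      if "x \<in> verts (induced_subgraph G C)" for x
      using that composition_degree_core[OF G(1,2,4,5) A B, of x]
        composition_degree_core[OF H(1) VH dis(2,3) A' B', of "\<phi> x"] \<phi>(2)[of x] G(2) cA by (auto simp: C'_def)
  qed (rule sC)
  moreover have "chordal (induced_subgraph H C')"
    using chordal_mono[OF H(2) contains_induced_induced[OF subC(2)]] .
  ultimately have "induced_subgraph G C \<simeq> induced_subgraph H C'"
    using core sC(2) graph_iso_sym by (auto simp: chordal_unigraph_def)
  then obtain g where "bij_betw g C C'"
    "\<And>x y. x \<in> C \<Longrightarrow> y \<in> C \<Longrightarrow> adj G x y \<longleftrightarrow> g x \<in> C' \<and>
      g y \<in> C' \<and> adj H (g x) (g y)"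
    by (auto simp: graph_iso_iff)
  then have g: "iso_on G H g C C'" and gC: "\<And>x. x \<in> C \<Longrightarrow> g x \<in> C'"
    by (auto simp: iso_on_def bij_betw_def)
  \<comment> \<open>Taking images under the core isomorphism guarantees a nonadjacent pair in the
    core of \<open>H\<close>.\<close>
  define d1 d2 where "d1 = g c1" and "d2 = g c2"
  have d: "d1 \<in> C'" "d2 \<in> C'" "d1 \<noteq> d2" "\<not> adj H d1 d2"
    using g gC c by (auto simp: d1_def d2_def iso_on_def bij_betw_def inj_on_def)
  have stG: "\<forall>x\<in>{c1, c2}. \<forall>y\<in>{c1, c2}. \<not> adj G x y"
    using c(4) adj_irrefl[OF G(1)] by (auto simp: adj_commute)
  have stH: "\<forall>x\<in>{d1, d2}. \<forall>y\<in>{d1, d2}. \<not> adj H x y"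
    using d(4) adj_irrefl[OF H(1)] by (auto simp: adj_commute)
  define G1 where "G1 = induced_subgraph G (A \<union> B \<union> {c1, c2})"
  define H1 where "H1 = induced_subgraph H (A' \<union> B' \<union> {d1, d2})"
  have s1: "simple_graph G1" "simple_graph H1"
    unfolding G1_def H1_def using c d G(2) VH by (intro simple_induced G(1) H(1); auto)+
  have cs: "{c1, c2} \<subseteq> C" "{d1, d2} \<subseteq> C'" using c d by auto
  have AB: "\<forall>x\<in>A. \<forall>y\<in>A \<union> C. x \<noteq> y \<longrightarrow> adj G x y"
    "\<forall>x\<in>B. \<forall>y\<in>B \<union> C. \<not> adj G x y"
    "\<forall>x\<in>A'. \<forall>y\<in>A' \<union> C'. x \<noteq> y \<longrightarrow> adj H x y"
      "\<forall>x\<in>B'. \<forall>y\<in>B' \<union> C'. \<not> adj H x y"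
    using A B A' B' by blast+
  note dG = composition_degree_split[OF G AB(1,2) cs(1) G1_def stG]
  note dH = composition_degree_split[OF H(1) VH dis AB(3,4) cs(2) H1_def stH]
  have card2: "card {c1, c2} = 2" "card {d1, d2} = 2" using c d by auto
  have deg1: "degree_sequence H1 = degree_sequence G1"
  proof -
    let ?k = "\<lambda>x. if x = c1 then d1 else d2"
    have "bij_betw ?k {c1, c2} {d1, d2}" using c(3) d(3) by (auto simp: bij_betw_def)
    then have "bij_betw (\<lambda>x. if x \<in> A \<union> B then \<phi> x else ?k x) (A \<union> B \<union> {c1, c2}) (A'
      \<union> B' \<union> {d1, d2})"
      using c d G(4,5) dis by (intro bij_betw_disjoint_Un bij(3)) auto
    then have "degree_sequence G1 = degree_sequence H1"
    proof (intro degree_sequence_bijI s1)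
      show "degree H1 (if x \<in> A \<union> B then \<phi> x else ?k x) = degree G1 x" if x: "x \<in> verts G1" for x
      proof -
        consider "x \<in> A" | "x \<in> B" | "x \<notin> A" "x \<notin> B" "x \<in> {c1, c2}" using x by (auto simp: G1_def)
        then show ?thesis
        proof cases
          case 1
          then have "\<phi> x \<in> A'" by (simp add: A'_def)
          then show ?thesis using dG(1)[OF 1] dH(1)[of "\<phi> x"] \<phi>(2)[of x] 1 G(2) cA card2 by simp
        next
          case 2
          then have "\<phi> x \<in> B'" by (simp add: B'_def)
          then show ?thesis using dG(2)[OF 2] dH(2)[of "\<phi> x"] \<phi>(2)[of x] 2 G(2) by simp
        next
          case 3
          then show ?thesis using dG(3)[OF 3(3)] dH(3)[of "?k x"] cA by simp
        qed
      qed
    qed (simp add: G1_def H1_def)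
    then show ?thesis by simp
  qed
  then have "G1 \<simeq> H1"
    using split s1(2) graph_iso_sym unfolding unigraph_def G1_def[symmetric] by blast
  then obtain f where f: "bij_betw f (verts G1) (verts H1)"
    "\<And>x y. x \<in> verts G1 \<Longrightarrow> y \<in> verts G1 \<Longrightarrow> adj G1 x y
      \<longleftrightarrow> adj H1 (f x) (f y)"
    by (auto simp: graph_iso_iff)
  have V1: "verts G1 = A \<union> B \<union> {c1, c2}" "verts H1 = A' \<union> B' \<union> {d1, d2}"
    by (simp_all add: G1_def H1_def)
  have fV: "f x \<in> verts H1" if "x \<in> verts G1" for x using f(1) that by (auto simp: bij_betw_def)
  have fadj: "adj G x y \<longleftrightarrow> adj H (f x) (f y)" if "x \<in> verts G1" "y \<in> verts G1" for x y
    using f(2)[OF that] fV that by (simp add: G1_def H1_def)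
  \<comment> \<open>The core pair raises every degree in \<open>A\<close> to at least
    \<open>card A + 1\<close>, while all other vertices have degree at most \<open>card A\<close>.
    Hence \<open>f\<close> respects \<open>A\<close>.\<close>
  have inA: "x \<in> A \<longleftrightarrow> card A < degree G1 x" if "x \<in> verts G1" for x
    using that dG(3,5)[of x] dG(4)[of x] card2 G(3,4) c unfolding V1 by fastforce
  have inA': "x \<in> A' \<longleftrightarrow> card A < degree H1 x" if "x \<in> verts H1" for x
    using that dH(3,5)[of x] dH(4)[of x] card2 dis d cA unfolding V1 by fastforce
  have fA: "f x \<in> A' \<longleftrightarrow> x \<in> A" if "x \<in> verts G1" for x
    using inA[OF that] inA'[OF fV[OF that]] degree_iso[OF s1 f that] by simp
  have injf: "inj_on f (verts G1)" and imf: "f ` verts G1 = verts H1" using f(1) by (auto simp: bij_betw_def)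
  have bA: "bij_betw f A A'"
  proof -
    have "f ` A = A'"
    proof (intro equalityI subsetI)
      fix v assume "v \<in> A'"
      then have "v \<in> f ` verts G1" using imf V1 by auto
      then show "v \<in> f ` A" using fA \<open>v \<in> A'\<close> by auto
    qed (use fA V1 in auto)
    then show ?thesis using injf V1 by (auto simp: bij_betw_def intro: inj_on_subset)
  qed
  have bB: "bij_betw f (insert c2 (insert c1 B)) (insert d2 (insert d1 B'))"
  proof -
    have e: "insert c2 (insert c1 B) = verts G1 - A" "insert d2 (insert d1 B') = verts H1 - A'"
      using V1 G(3,4) dis c d by auto
    have "f ` (verts G1 - A) = verts H1 - A'"
    proof (intro equalityI subsetI)
      fix v assume v: "v \<in> verts H1 - A'"
      then have "v \<in> f ` verts G1" using imf by auto
      then show "v \<in> f ` (verts G1 - A)" using fA v by auto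
    qed (use fA fV in auto)
    then show ?thesis unfolding e using injf by (auto simp: bij_betw_def intro: inj_on_subset)
  qed
  have fa: "f a \<in> A'" if "a \<in> A" for a using bA that by (auto simp: bij_betw_def)
  \<comment> \<open>Outside \<open>A\<close> the split part is stable, so only the neighbourhoods in
    \<open>A\<close>, compared along \<open>f\<close>, have to match.\<close>
  define Q where "Q x y \<longleftrightarrow> (\<forall>a\<in>A. adj G a x \<longleftrightarrow> adj H (f a) y)" for x y
  have Qf: "Q x (f x)" if "x \<in> verts G1" for x using fadj[OF _ that] V1 by (auto simp: Q_def)
  have full: "adj G a x" if "a \<in> A" "x \<in> {c1, c2}" for a x using A[OF that(1), of x] that c G(4) by auto
  have full': "adj H (f a) x" if "a \<in> A" "x \<in> {d1, d2}" for a x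
    using A'[OF fa[OF that(1)], of x] that d dis fa[OF that(1)] by auto
  \<comment> \<open>Core vertices are adjacent to all of \<open>A\<close>, and so are their images
    under \<open>f\<close>. They are therefore interchangeable for \<open>Q\<close>, which permits
    cancelling first \<open>c2\<close> and \<open>d2\<close>, then \<open>c1\<close> and
    \<open>d1\<close>.\<close>
  have Qd: "Q x (f e)" if "Q x v" "v \<in> {d1, d2}" "e \<in> {c1, c2}" for x v e
    using that full full' Qf[of e] V1 by (auto simp: Q_def)
  obtain g1 where g1: "bij_betw g1 (insert c1 B) (insert d1 B')" "\<And>x. x \<in> insert c1 B \<Longrightarrow> Q x (g1 x)"
    by (rule bij_betw_cancel[OF bB, of Q]) (use Qf Qd V1 c d G(5) dis in auto)
  have Qg: "Q x (g1 c1)" if "Q x d1" for x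
    using that full full' g1(2)[of c1] by (auto simp: Q_def)
  obtain g2 where g2: "bij_betw g2 B B'" "\<And>x. x \<in> B \<Longrightarrow> Q x (g2 x)"
    by (rule bij_betw_cancel[OF g1(1), of Q]) (use g1(2) Qg c d G(5) dis in auto)
  have iA: "iso_on G H f A A'" using bA fadj V1 by (auto simp: iso_on_def)
  have g2B: "g2 x \<in> B'" if "x \<in> B" for x using g2(1) that by (auto simp: bij_betw_def)
  have iB: "iso_on G H g2 B B'" using g2(1) g2B B B' by (auto simp: iso_on_def)
  have iAB: "iso_on G H (\<lambda>x. if x \<in> A then f x else g2 x) (A \<union> B) (A' \<union> B')"
    using g2(2) by (intro iso_on_glue[OF iA iB G(3) dis(1)]) (auto simp: Q_def)
  have "iso_on G H (\<lambda>x. if x \<in> A \<union> B then (if x \<in> A then f x else g2 x) else g x) (A \<union> B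
    \<union> C) (A' \<union> B' \<union> C')"
  proof (rule iso_on_glue[OF iAB g])
    show "(A \<union> B) \<inter> C = {}" "(A' \<union> B') \<inter> C' = {}" using G(4,5) dis by auto
    show "adj G x y \<longleftrightarrow> adj H (if x \<in> A then f x else g2 x) (g y)" if xy: "x \<in> A \<union> B" "y \<in> C"
      for x y
    proof (cases "x \<in> A")
      case True
      have "x \<noteq> y" "f x \<noteq> g y" using True xy G(4) dis(2) fa[OF True] gC[OF xy(2)] by auto
      then show ?thesis using A[OF True, of y] A'[OF fa[OF True], of "g y"] xy gC[OF xy(2)] True by auto
    next
      case False
      then have "x \<in> B" using xy by auto
      then show ?thesis using B[of x y] B'[OF g2B, of x "g y"] xy gC[OF xy(2)] False by auto
    qed
  qed
  then have "H \<simeq> induced_subgraph G (A \<union> B \<union> C)" unfolding VH[symmetric] by (rule iso_on_induced)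
  then show ?thesis using induced_verts[OF G(1)] G(2) by simp
qed

section \<open>The characterisation\<close>

context forbidden_free
begin

text \<open>The claim is that no edge \<open>xy\<close> lies outside the chosen clique
  \<open>K\<close>. Comparable non-neighbourhoods of \<open>x\<close> and \<open>y\<close> in
  \<open>K\<close> contradict maximality, the minimal number of outside edges, or the absence of
  induced 4-cycles and 5-cycles; incomparable ones give an induced 4-cycle at once.\<close>

lemma split_if_no_2K2:
  assumes no2K2: "\<And>a b c d. a \<sim> b \<Longrightarrow> c \<sim> d \<Longrightarrow> a \<sim> c \<or> a \<sim> d \<or>
    b \<sim> c \<or> b \<sim> d"
  shows "split_graph G"
proof -
  define clique where "clique K \<longleftrightarrow> K \<subseteq> verts G \<and>
    (\<forall>x\<in>K. \<forall>y\<in>K. x \<noteq> y \<longrightarrow> x \<sim> y)" for K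
  \<comment> \<open>The edges outside \<open>K\<close>, as ordered pairs, so each is counted
    twice.\<close>
  define M where "M K = {(x, y). x \<in> verts G - K \<and> y \<in> verts G - K \<and> x \<sim> y}" for K
  have fin: "finite (verts G)" using finite_verts[OF simple] .
  have finK: "finite K" if "clique K" for K using that fin finite_subset by (auto simp: clique_def)
  have cliqueD: "x \<sim> y" if "clique K" "x \<in> K" "y \<in> K" "x \<noteq> y" for K x y using that by (auto simp: clique_def)
  have "clique {}" by (simp add: clique_def)
  moreover have "\<forall>K. clique K \<longrightarrow> card K < Suc (card (verts G))"
    using card_mono[OF fin] by (auto simp: clique_def less_Suc_eq_le)
  ultimately obtain K0 where K0: "clique K0" "\<And>K. clique K \<Longrightarrow> card K \<le> card K0"
    using ex_has_greatest_nat[of clique "{}" card] by blast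
  \<comment> \<open>among the maximum cliques, one that leaves as few edges as possible outside\<close>
  obtain K where K: "clique K" "card K = card K0"
    and min: "\<And>L. clique L \<Longrightarrow> card L = card K0 \<Longrightarrow> card (M K) \<le> card (M L)"
    using ex_has_least_nat[of "\<lambda>K. clique K \<and> card K = card K0" K0 "\<lambda>K. card (M K)"] K0(1) by blast
  have max: "card L \<le> card K" if "clique L" for L using K0(2) that K(2) by simp
  have KV: "K \<subseteq> verts G" using K(1) by (simp add: clique_def)
  have nonempty: "\<exists>k\<in>K. \<not> u \<sim> k" if u: "u \<in> verts G - K" for u
  proof (rule ccontr)
    assume "\<not> ?thesis"
    then have "clique (insert u K)" using K(1) u by (auto simp: clique_def adj_commute)
    then show False using max u finK[OF K(1)] by fastforce
  qed
  have main: False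
    if xy: "x \<in> verts G - K" "y \<in> verts G - K" "x \<sim> y"
      and sub: "\<And>k. k \<in> K \<Longrightarrow> \<not> x \<sim> k \<Longrightarrow> \<not> y \<sim> k" for x y
  proof -
    obtain u where u: "u \<in> K" "\<not> x \<sim> u" using nonempty[OF xy(1)] by blast
    have yu: "\<not> y \<sim> u" using sub u by blast
    \<comment> \<open>A second vertex of \<open>K\<close> missed by \<open>x\<close> is missed by
      \<open>y\<close> too, and together with \<open>u\<close> it would give an edge of
      \<open>K\<close> forming a \<open>2K\<^sub>2\<close> with \<open>xy\<close>. So
      \<open>u\<close> is the only vertex of \<open>K\<close> missed by \<open>x\<close>.\<close>
    have x1: "x \<sim> w" if "w \<in> K" "w \<noteq> u" for w
      using no2K2[OF xy(3) cliqueD[OF K(1) that(1) u(1) that(2)]] sub[OF that(1)] u yu by blast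
    have une: "u \<noteq> x" "u \<noteq> y" "x \<noteq> y" using u xy irrefl by auto
    \<comment> \<open>Otherwise replacing \<open>u\<close> by both \<open>x\<close> and
      \<open>y\<close> would enlarge the clique.\<close>
    have "\<exists>w\<in>K. w \<noteq> u \<and> \<not> y \<sim> w"
    proof (rule ccontr)
      assume "\<not> ?thesis"
      then have "clique (insert x (insert y (K - {u})))"
        using K(1) xy x1 by (auto simp: clique_def adj_commute)
      moreover have "card (insert x (insert y (K - {u}))) = Suc (card K)"
        using xy une finK[OF K(1)] u(1) card_Suc_Diff1[OF finK[OF K(1)] u(1)] by simp
      ultimately show False using max by fastforce
    qed
    then obtain w where w: "w \<in> K" "w \<noteq> u" "\<not> y \<sim> w" by blast
    \<comment> \<open>Exchanging \<open>u\<close> for \<open>x\<close> gives another maximum clique.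
      If every outside neighbour of \<open>u\<close> other than \<open>x\<close> were also adjacent
      to \<open>x\<close>, this exchange would leave fewer outside edges.\<close>
    have "\<exists>z\<in>verts G - K. z \<noteq> x \<and> z \<sim> u \<and> \<not> z \<sim> x"
    proof (rule ccontr)
      assume n: "\<not> ?thesis"
      let ?L = "insert x (K - {u})"
      have "clique ?L" using K(1) xy(1) x1 by (auto simp: clique_def adj_commute)
      moreover have "card ?L = card K0" using xy(1) u(1) finK[OF K(1)] K(2) card_Suc_Diff1[OF finK[OF K(1)] u(1)] by simp
      ultimately have le: "card (M K) \<le> card (M ?L)" using min by blast
      have finM: "finite (M K)" unfolding M_def by (rule finite_subset[of _ "verts G \<times> verts G"]) (use fin in auto)
      \<comment> \<open>Renaming \<open>u\<close> to \<open>x\<close> maps the edges outside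
        \<open>?L\<close> injectively to edges outside \<open>K\<close> and never hits
        \<open>(x, y)\<close>, because \<open>y\<close> misses \<open>u\<close>.\<close>
      let ?f = "\<lambda>v. if v = u then x else v"
      have mem: "v \<in> verts G - ?L \<longleftrightarrow> v = u \<or> v \<in> verts G - K \<and> v \<noteq> x" for v
        using u(1) KV une by auto
      have "inj_on (map_prod ?f ?f) (M ?L)"
        unfolding M_def mem by (rule inj_onI) (auto split: if_splits)
      moreover have "map_prod ?f ?f ` M ?L \<subseteq> M K - {(x, y)}"
      proof
        fix p assume "p \<in> map_prod ?f ?f ` M ?L"
        then obtain a b where ab: "p = (?f a, ?f b)" "a \<in> verts G - ?L" "b \<in> verts G - ?L" "a \<sim> b"
          by (auto simp: M_def)
        have "?f a \<in> verts G - K" "?f b \<in> verts G - K" using ab(2,3) xy(1) unfolding mem by auto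
        moreover have "?f a \<sim> ?f b"
          using ab(2-4) n irrefl unfolding mem by (auto simp: adj_commute)
        moreover have "(?f a, ?f b) \<noteq> (x, y)"
          using ab(2-4) yu une unfolding mem by (auto simp: adj_commute split: if_splits)
        ultimately show "p \<in> M K - {(x, y)}" using ab(1) by (auto simp: M_def)
      qed
      ultimately have "card (M ?L) \<le> card (M K - {(x, y)})"
        using card_inj_on_le[of _ "M ?L" "M K - {(x, y)}"] finM by blast
      moreover have "(x, y) \<in> M K" using xy by (simp add: M_def)
      ultimately have "card (M ?L) < card (M K)"
        using finM by (metis card_Diff1_less le_less_trans)
      then show False using le by simp
    qed
    then obtain z where z: "z \<in> verts G - K" "z \<noteq> x" "z \<sim> u" "\<not> z \<sim> x" by blast
    have zy: "z \<sim> y" using no2K2[OF z(3) xy(3)] z(4) u(2) yu by (auto simp: adj_commute)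
    have wu: "u \<sim> w" and wx: "x \<sim> w" using cliqueD[OF K(1) u(1) w(1)] w(2) x1[OF w(1,2)] by auto
    have yw: "y \<noteq> w" "z \<noteq> w" using xy z w by auto
    show False
    \<comment> \<open>Either \<open>x\<close>, \<open>y\<close>, \<open>z\<close>, \<open>w\<close>
      is an induced 4-cycle or \<open>u\<close>, \<open>w\<close>, \<open>x\<close>,
      \<open>y\<close>, \<open>z\<close> is an induced 5-cycle.\<close>
    proof (cases "z \<sim> w")
      case True
      then show False
        using no_C4[of x y z w] xy(3) zy wx z(2,4) yw w(3) by (auto simp: adj_commute)
    next
      case False
      then show False
        using no_C5[of u w x y z] xy(3) zy wx wu z(3,4) w(3) u(2) yu by (auto simp: adj_commute)
    qed
  qed
  have "\<not> x \<sim> y" if xy: "x \<in> verts G - K" "y \<in> verts G - K" for x y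
  proof
    assume a: "x \<sim> y"
    \<comment> \<open>Using \<open>main\<close> in both directions yields \<open>k\<close> and
      \<open>l\<close>, each seen by exactly one end of \<open>xy\<close>; then \<open>x\<close>,
      \<open>l\<close>, \<open>k\<close>, \<open>y\<close> is an induced 4-cycle.\<close>
    obtain k where k: "k \<in> K" "\<not> x \<sim> k" "y \<sim> k" using main[OF xy a] by blast
    obtain l where l: "l \<in> K" "\<not> y \<sim> l" "x \<sim> l" using main[OF xy(2,1) adj_symD[OF a]] by blast
    have "k \<noteq> l" using k l by auto
    then have "l \<sim> k" using cliqueD[OF K(1) l(1) k(1)] by auto
    then show False
      using no_C4[of x l k y] a k l xy by (auto simp: adj_commute)
  qed
  then show ?thesis
    unfolding split_graph_iff using K(1) KV cliqueD
    by (intro exI[of _ K] exI[of _ "verts G - K"]) auto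
qed

section \<open>Choosing the core and concluding\<close>

lemma maximal_family:
  assumes "Fam C0" "\<And>C. Fam C \<Longrightarrow> C \<subseteq> verts G"
  obtains C where "Fam C" "\<And>C'. Fam C' \<Longrightarrow> \<not> C \<subset> C'"
proof -
  have fin: "finite (verts G)" using finite_verts[OF simple] .
  have "\<forall>C. Fam C \<longrightarrow> card C < Suc (card (verts G))"
    using card_mono[OF fin] assms(2) by (auto simp: less_Suc_eq_le)
  then obtain C where C: "Fam C" "\<And>C'. Fam C' \<Longrightarrow> card C' \<le> card C"
    using ex_has_greatest_nat[of Fam C0 card] assms(1) by blast
  have "\<not> C \<subset> C'" if "Fam C'" for C'
    using psubset_card_mono[of C' C] C(2)[OF that] finite_subset[OF assms(2)[OF that] fin] by fastforce
  then show ?thesis using that C(1) by blast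
qed

lemma matched_verts: "matched G R \<Longrightarrow> R \<subseteq> verts G"
  using adj_verts[OF simple] by (fastforce simp: matched_def)

text \<open>The case order supplies the exclusions assumed by \<open>windmill_outside\<close> and
  \<open>star_matching_outside\<close>. \<open>Fam\<close> speaks of vertex sets and leaves the
  parameters existential, since extending a core may replace them. In the first two cases the core
  has a triangle, so an edge anticomplete to it would give \<open>K3_K2\<close>; in the last case
  such an edge extends the matching.\<close>

lemma core_exists:
  assumes ab: "a \<sim> b" "c \<sim> d" "\<not> a \<sim> c" "\<not> a \<sim> d" "\<not> b \<sim> c" "\<not> b \<sim> d"
  obtains C c1 c2 where "C \<subseteq> verts G" "chordal_unigraph (induced_subgraph G C)"
    "c1 \<in> C" "c2 \<in> C" "c1 \<noteq> c2" "\<not> c1 \<sim> c2"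
    "\<And>v. v \<notin> C \<Longrightarrow> (\<forall>u\<in>C. v \<sim> u) \<or> (\<forall>u\<in>C. \<not> v \<sim> u)"
    "\<And>v w. \<forall>u\<in>C. \<not> v \<sim> u \<Longrightarrow> \<forall>u\<in>C. \<not> w \<sim> u
      \<Longrightarrow> \<not> v \<sim> w"
proof -
  have chord: "chordal (induced_subgraph G C)" if "C \<subseteq> verts G" for C
    using chordal_mono[OF chordal contains_induced_induced[OF that]] .
  consider (bipod) y z s t P Q e f where "bipod G y z s t P Q" "e \<in> P \<union> Q" "f \<in> P \<union> Q" "e \<noteq> f"
    | (windmill) x c d L R where "windmill G x c d L R"
        "\<And>y z s t P Q e f. bipod G y z s t P Q \<Longrightarrow> e \<in> P \<union> Q \<Longrightarrow> f \<in> P \<union> Q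
          \<Longrightarrow> e = f"
    | (star) "\<And>x c d L R. \<not> windmill G x c d L R" by metis
  then show ?thesis
  proof cases
    case bipod
    define Fam where "Fam C \<longleftrightarrow> (\<exists>y z s t P Q e f. bipod G y z s t P Q \<and> e \<in> P \<union> Q \<and>
      f \<in> P \<union> Q \<and> e \<noteq> f \<and>
      C = {y, z, s, t} \<union> P \<union> Q)" for C
    have verts: "{y, z, s, t} \<union> P \<union> Q \<subseteq> verts G" if "bipod G y z s t P Q" for y z s t P Q
      using that adj_verts[OF simple] by (auto simp: bipod_def)
    obtain C where C: "Fam C" "\<And>C'. Fam C' \<Longrightarrow> \<not> C \<subset> C'"
    proof (rule maximal_family[of Fam])
      show "Fam ({y, z, s, t} \<union> P \<union> Q)" using bipod unfolding Fam_def by blast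
      show "C \<subseteq> verts G" if "Fam C" for C using that verts unfolding Fam_def by blast
    qed blast
    then obtain y z s t P Q e f where B: "bipod G y z s t P Q" and ef: "e \<in> P \<union> Q" "f \<in> P \<union> Q" "e \<noteq> f"
      and Ceq: "C = {y, z, s, t} \<union> P \<union> Q" unfolding Fam_def by blast
    have CV: "C \<subseteq> verts G" using verts[OF B] Ceq by simp
    show ?thesis
    proof (rule that[of C y z])
      show "chordal_unigraph (induced_subgraph G C)"
        using bipod_unigraph[OF simple B _ CV chord[OF CV]] Ceq by (simp add: Un_assoc)
      show "y \<in> C" "z \<in> C" "y \<noteq> z" "\<not> y \<sim> z" using B Ceq by (auto simp: bipod_def)
      show "(\<forall>u\<in>C. v \<sim> u) \<or> (\<forall>u\<in>C. \<not> v \<sim> u)" if v: "v \<notin> C" for v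
      proof (rule ccontr)
        assume n: "\<not> ?thesis"
        then obtain y' z' s' t' P' Q' where B': "bipod G y' z' s' t' P' Q'" "P \<union> Q \<subseteq> P' \<union> Q'"
          "{y', z', s', t'} \<union> P' \<union> Q' = insert v C"
          using bipod_outside[OF B ef, of v] v unfolding Ceq by blast
        then have "Fam (insert v C)" unfolding Fam_def using ef by blast
        then show False using C(2) v by blast
      qed
      show "\<not> v \<sim> w" if vw: "\<forall>u\<in>C. \<not> v \<sim> u" "\<forall>u\<in>C. \<not> w \<sim> u" for v w
      proof
        assume "v \<sim> w"
        moreover have "y \<sim> e" "y \<sim> f" "e \<sim> f" using B ef by (auto simp: bipod_def)
        moreover have "y \<in> C" "e \<in> C" "f \<in> C" using Ceq ef by auto
        ultimately show False using no_K3_K2[of y e f v w] vw by (auto simp: adj_commute)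
      qed
    qed (rule CV)
  next
    case windmill
    define Fam where "Fam C \<longleftrightarrow> (\<exists>x c d L R. windmill G x c d L R \<and> C = {x, c, d} \<union> L
      \<union> R)" for C
    have verts: "{x, c, d} \<union> L \<union> R \<subseteq> verts G" if "windmill G x c d L R" for x c d L R
    proof -
      have "x \<sim> c" "c \<sim> d" "\<And>u. u \<in> L \<union> R \<Longrightarrow> x \<sim> u" using that
        by (auto simp: windmill_def)
      then show ?thesis using adj_verts[OF simple] by blast
    qed
    obtain C where C: "Fam C" "\<And>C'. Fam C' \<Longrightarrow> \<not> C \<subset> C'"
    proof (rule maximal_family[of Fam])
      show "Fam ({x, c, d} \<union> L \<union> R)" using windmill(1) unfolding Fam_def by blast
      show "C \<subseteq> verts G" if "Fam C" for C using that verts unfolding Fam_def by blast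
    qed blast
    then obtain x c d L R where W: "windmill G x c d L R" and Ceq: "C = {x, c, d} \<union> L \<union> R"
      unfolding Fam_def by blast
    have CV: "C \<subseteq> verts G" using verts[OF W] Ceq by simp
    have w: "R \<noteq> {}" "matched G R" "\<And>u. u \<in> R \<Longrightarrow> x \<sim> u" using W by (auto simp: windmill_def)
    show ?thesis
    proof (rule that[of C x d])
      show "chordal_unigraph (induced_subgraph G C)"
        using windmill_unigraph[OF simple W _ CV chord[OF CV]] Ceq by (simp add: Un_assoc)
      show "x \<in> C" "d \<in> C" "x \<noteq> d" "\<not> x \<sim> d" using W Ceq by (auto simp: windmill_def)
      show "(\<forall>u\<in>C. v \<sim> u) \<or> (\<forall>u\<in>C. \<not> v \<sim> u)" if v: "v \<notin> C" for v
      proof (rule ccontr)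
        assume n: "\<not> ?thesis"
        have "(\<forall>u\<in>C. v \<sim> u) \<or> (\<forall>u\<in>C. \<not> v \<sim> u) \<or>
            (\<exists>L' R'. windmill G x c d L' R' \<and> L' \<union> R' = insert v (L \<union> R))"
          unfolding Ceq by (rule windmill_outside[OF W], erule (2) windmill(2)) (use v Ceq in simp)
        then obtain L' R' where W': "windmill G x c d L' R'" "L' \<union> R' = insert v (L \<union> R)"
          using n by blast
        then have "{x, c, d} \<union> L' \<union> R' = insert v C" using Ceq by (auto simp: Un_assoc)
        then have "Fam (insert v C)" unfolding Fam_def using W'(1) by metis
        then show False using C(2) v by blast
      qed
      show "\<not> v \<sim> w" if vw: "\<forall>u\<in>C. \<not> v \<sim> u" "\<forall>u\<in>C. \<not> w \<sim> u" for v w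
      proof
        assume "v \<sim> w"
        obtain e where e: "e \<in> R" using w(1) by blast
        obtain f where f: "f \<in> R" "e \<sim> f" using matchedE[OF w(2) e] by blast
        have "x \<sim> e" "x \<sim> f" using w(3) e f by auto
        moreover have "x \<in> C" "e \<in> C" "f \<in> C" using Ceq e f by auto
        ultimately show False using no_K3_K2[of x e f v w] \<open>v \<sim> w\<close> f vw by (auto simp: adj_commute)
      qed
    qed (rule CV)
  next
    case star
    define Fam where "Fam C \<longleftrightarrow> (\<exists>s L R. star_matching G s L R \<and> C = {s} \<union> L \<union> R)"
      for C
    have verts: "{s} \<union> L \<union> R \<subseteq> verts G" if "star_matching G s L R" for s L R
      using that adj_verts[OF simple] matched_verts[of R] by (auto simp: star_matching_def)
    have "star_matching G a {b} {c, d}"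
      unfolding star_matching_def using matched_pair[OF simple ab(2)] ab irrefl by (auto simp: adj_commute)
    then have Fam0: "Fam ({a} \<union> {b} \<union> {c, d})" unfolding Fam_def by blast
    obtain C where C: "Fam C" "\<And>C'. Fam C' \<Longrightarrow> \<not> C \<subset> C'"
    proof (rule maximal_family[of Fam, OF Fam0])
      show "C \<subseteq> verts G" if "Fam C" for C using that verts unfolding Fam_def by blast
    qed blast
    then obtain s L R where S: "star_matching G s L R" and Ceq: "C = {s} \<union> L \<union> R"
      unfolding Fam_def by blast
    have CV: "C \<subseteq> verts G" using verts[OF S] Ceq by simp
    obtain r where r: "r \<in> R" using S by (auto simp: star_matching_def)
    show ?thesis
    proof (rule that[of C s r])
      show "chordal_unigraph (induced_subgraph G C)"
        using star_matching_unigraph[OF simple S Ceq CV chord[OF CV]] .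
      show "s \<in> C" "r \<in> C" "s \<noteq> r" "\<not> s \<sim> r" using S Ceq r by (auto simp: star_matching_def)
      show "(\<forall>u\<in>C. v \<sim> u) \<or> (\<forall>u\<in>C. \<not> v \<sim> u)" if v: "v \<notin> C" for v
      proof (rule ccontr)
        assume n: "\<not> ?thesis"
        then obtain s' L' R' where "star_matching G s' L' R'" "{s'} \<union> L' \<union> R' = insert v C"
          using star_matching_outside[OF S star, of v] v unfolding Ceq by blast
        then have "Fam (insert v C)" unfolding Fam_def by metis
        then show False using C(2) v by blast
      qed
      show "\<not> v \<sim> w" if vw: "\<forall>u\<in>C. \<not> v \<sim> u" "\<forall>u\<in>C. \<not> w \<sim> u" for v w
      proof
        assume a: "v \<sim> w"
        have S': "matched G R" "\<And>l. l \<in> L \<Longrightarrow> s \<sim> l" "L \<noteq> {}" using S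
          by (auto simp: star_matching_def)
        \<comment> \<open>Every core vertex has a neighbour in the core, so a vertex anticomplete to
          the core lies outside it and \<open>{v, w}\<close> really enlarges it.\<close>
        have nbr: "\<exists>u\<in>C. x \<sim> u" if "x \<in> C" for x
          using that S' matchedE[OF S'(1)] unfolding Ceq by (metis UnE UnI1 UnI2 adj_commute ex_in_conv insertI1 singletonD)
        then have vC: "v \<notin> C" "w \<notin> C" using vw by blast+
        have "matched G (R \<union> {v, w})"
          using S'(1) matched_pair[OF simple a] vw Ceq by (intro matched_Un) (auto simp: adj_commute)
        then have "star_matching G s L (R \<union> {v, w})"
          using S vw vC Ceq unfolding star_matching_def by (auto simp: adj_commute)
        then have "Fam ({s} \<union> L \<union> (R \<union> {v, w}))" unfolding Fam_def by blast
        then show False using C(2) vC Ceq by blast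
      qed
    qed (rule CV)
  qed
qed

lemma chordal_unigraph: "chordal_unigraph G"
  unfolding chordal_unigraph_def
proof (intro conjI chordal allI impI)
  fix H :: "nat graph"
  assume H: "simple_graph H \<and> chordal H \<and> degree_sequence H = degree_sequence G"
  show "H \<simeq> G"
  proof (cases "\<forall>a b c d. a \<sim> b \<longrightarrow> c \<sim> d \<longrightarrow> a \<sim> c \<or> a \<sim> d \<or>
    b \<sim> c \<or> b \<sim> d")
    case True
    then have "split_graph G" using split_if_no_2K2 by blast
    then have "unigraph G"
      using split_unigraph[OF simple] contains_induced_induced[of "verts G" G] induced_verts[OF simple] by simp
    then show ?thesis using H by (auto simp: unigraph_def)
  next
    case False
    then obtain a b c d where ab: "a \<sim> b" "c \<sim> d" "\<not> a \<sim> c" "\<not> a \<sim> d" "\<not> b \<sim> c"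
      "\<not> b \<sim> d" by blast
    obtain C c1 c2 where C: "C \<subseteq> verts G" "chordal_unigraph (induced_subgraph G C)"
      "c1 \<in> C" "c2 \<in> C" "c1 \<noteq> c2" "\<not> c1 \<sim> c2"
      "\<And>v. v \<notin> C \<Longrightarrow> (\<forall>u\<in>C. v \<sim> u) \<or> (\<forall>u\<in>C. \<not> v \<sim> u)"
      "\<And>v w. \<forall>u\<in>C. \<not> v \<sim> u \<Longrightarrow> \<forall>u\<in>C. \<not> w \<sim> u
        \<Longrightarrow> \<not> v \<sim> w"
      using core_exists[OF ab] by blast
    define A where "A = {v \<in> verts G - C. \<forall>u\<in>C. v \<sim> u}"
    define B where "B = {v \<in> verts G - C. \<forall>u\<in>C. \<not> v \<sim> u}"
    have V: "verts G = A \<union> B \<union> C" using C(1,7) by (auto simp: A_def B_def)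
    have dis: "A \<inter> B = {}" "A \<inter> C = {}" "B \<inter> C = {}" using C(3) by (auto simp: A_def B_def)
    have AC: "x \<sim> y" if "x \<in> A" "y \<in> A \<union> C" "x \<noteq> y" for x y
    proof (cases "y \<in> C")
      case False
      then have y: "y \<in> A" using that by auto
      have "c1 \<sim> x" "c2 \<sim> x" "c1 \<sim> y" "c2 \<sim> y" using that(1) y C(3,4) by (auto simp: A_def adj_commute)
      \<comment> \<open>Nonadjacent \<open>x\<close> and \<open>y\<close> would form an induced
        4-cycle with the nonadjacent core vertices \<open>c1\<close> and \<open>c2\<close>.\<close>
      then show ?thesis using no_C4[of x c1 y c2] that(3) C(5,6) by (auto simp: adj_commute)
    qed (use that in \<open>simp add: A_def\<close>)
    have BC: "\<not> x \<sim> y" if "x \<in> B" "y \<in> B \<union> C" for x y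
      using that C(8)[of x y] by (auto simp: B_def)
    let ?W = "A \<union> B \<union> {c1, c2}"
    have W: "?W \<subseteq> verts G" using V C(3,4) by auto
    have "split_graph (induced_subgraph G ?W)"
      unfolding split_graph_iff
    proof (intro exI conjI ballI impI)
      show "verts (induced_subgraph G ?W) = A \<union> (B \<union> {c1, c2})" by auto
      show "A \<inter> (B \<union> {c1, c2}) = {}" using dis C(3,4) by auto
      show "adj (induced_subgraph G ?W) x y" if "x \<in> A" "y \<in> A" "x \<noteq> y" for x y using AC that by auto
      show "\<not> adj (induced_subgraph G ?W) x y" if "x \<in> B \<union> {c1, c2}" "y \<in> B \<union> {c1, c2}" for x y
        using that BC[of x y] BC[of y x] C(3,4,6) irrefl by (auto simp: adj_commute)
    qed
    then have "unigraph (induced_subgraph G ?W)"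
      using split_unigraph[OF simple_induced[OF simple W]] contains_induced_induced[OF W] by blast
    then show ?thesis
      using composition_iso[OF simple V dis AC BC C(3-6) C(2)] H by blast
  qed
qed

lemma forbidden_free_induced:
  assumes "W \<subseteq> verts G"
  shows "forbidden_free (induced_subgraph G W)"
proof -
  \<comment> \<open>Stated once for each vertex type: the disjoint unions live on
    \<open>nat + nat\<close>, the other forbidden graphs on \<open>nat\<close>.\<close>
  have "\<not> contains_induced (induced_subgraph G W) X" if "\<not> contains_induced G X" for X :: "(nat + nat) graph"
    using that contains_induced_trans[OF contains_induced_induced[OF assms]] by blast
  moreover have "\<not> contains_induced (induced_subgraph G W) X" if "\<not> contains_induced G X" for X :: "nat graph"
    using that contains_induced_trans[OF contains_induced_induced[OF assms]] by blast
  ultimately show ?thesis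
    using simple_induced[OF simple assms] free_C4 free_C5 free_P5 free_K3_K2 free_P3_P3 free_P4_K2 free_RS
      free_B1 free_B2 free_B3
    unfolding forbidden_free_def by blast
qed

end

theorem theorem4p4:
  fixes G :: "'a graph"
  assumes "simple_graph G"
  shows "hereditary_chordal_unigraph G \<longleftrightarrow>
    \<not> contains_induced G (cycle_graph 4) \<and>
    \<not> contains_induced G (cycle_graph 5) \<and>
    \<not> contains_induced G (path_graph 5) \<and>
    \<not> contains_induced G (disjoint_union (complete_graph 3) (complete_graph 2)) \<and>
    \<not> contains_induced G (disjoint_union (path_graph 3) (path_graph 3)) \<and>
    \<not> contains_induced G (disjoint_union (path_graph 4) (complete_graph 2)) \<and>
    (\<forall>H\<in>RS_graphs. \<not> contains_induced G H) \<and>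
    \<not> contains_induced G B1 \<and>
    \<not> contains_induced G B2 \<and>
    \<not> contains_induced G B3"
    (is "_ \<longleftrightarrow> ?free")
proof
  assume hcu: "hereditary_chordal_unigraph G"
  then have "chordal_unigraph G"
    using induced_verts[OF assms] unfolding hereditary_chordal_unigraph_def by (metis order_refl)
  then have "\<not> contains_induced G (cycle_graph 4)" "\<not> contains_induced G (cycle_graph 5)"
    by (auto simp: chordal_unigraph_def chordal_def)
  moreover note competitor = not_contained_competitor[OF assms hcu]
  \<comment> \<open>Each of these pairs is used in both directions, either graph serving as the
    competitor of the other.\<close>
  have "\<not> contains_induced G (path_graph 5)" "\<not> contains_induced G K3_K2"
    by (rule competitor[OF _ _ P5_K3_K2(2) P5_K3_K2(3)[symmetric] P5_K3_K2(4)]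
        competitor[OF _ _ P5_K3_K2(1) P5_K3_K2(3)]; use small_simple P5_K3_K2(4) graph_iso_sym in blast)+
  moreover have "\<not> contains_induced G P3_P3" "\<not> contains_induced G P4_K2"
    by (rule competitor[OF _ _ P3_P3_P4_K2(2) P3_P3_P4_K2(3)[symmetric] P3_P3_P4_K2(4)]
        competitor[OF _ _ P3_P3_P4_K2(1) P3_P3_P4_K2(3)]; use small_simple P3_P3_P4_K2(4) graph_iso_sym in blast)+
  moreover have "\<not> contains_induced G B1" "\<not> contains_induced G B2"
    by (rule competitor[OF _ _ B1_B2(2) B1_B2(3)[symmetric] B1_B2(4)]
        competitor[OF _ _ B1_B2(1) B1_B2(3)]; use B_simple B1_B2(4) graph_iso_sym in blast)+
  moreover have "simple_graph B3'" unfolding B3'_def by (rule simple_edge_graph) simp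
  then have "\<not> contains_induced G B3"
    using competitor[OF B_simple(3) _ B3_B3'(1,2)] B3_B3'(3) graph_iso_sym by blast
  moreover have "\<forall>H\<in>RS_graphs. \<not> contains_induced G H"
    using RS_graph_not_contained[OF assms hcu] by blast
  ultimately show ?free by blast
next
  assume ?free
  then interpret forbidden_free G using assms by unfold_locales blast+
  show "hereditary_chordal_unigraph G"
    unfolding hereditary_chordal_unigraph_def
    using forbidden_free.chordal_unigraph[OF forbidden_free_induced] by blast
qed

end
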